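(* Let $V$ be one of the spaces $L^p$ (for some $p\in[1,\infty]$) or $BV$. The delay differential equation $$X'(t)+\sum_{k=1}^\infty A_kX(t-\tau_k)+\int_0^{\tau_*}N(s)X(t-s)\,ds=0\quad(t>0),\qquad X(t)=X_0(t)\quad(-\tau_*\le t<0),\qquad X(0)=x_0$$ is exponentially stable if and only if there exists $\nu_0>0$ such that all solutions $z\in\mathbb{C}$ of the characteristic equation $$\det\Big(zI+\sum_{k=1}^\infty A_ke^{-\tau_kz}+\int_0^{\tau_*}N(s)e^{-sz}\,ds\Big)=0$$ satisfy $\mathrm{Re}(z)<-\nu_0$. Moreover, in that case, there exists $C\ge1$ such that for all $(X_0,x_0)\in V([-\tau_*,0],\mathbb{R}^n)\times\mathbb{R}^n$, the solution $X$ satisfies, for all $t\ge0$, $$\|X_t\|_V+|X(t)|\le Ce^{-\nu_0t}\big(\|X_0\|_V+|x_0|\big).$$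
   Context: Data: $n\ge 1$ is an integer, $\tau_*>0$; $(A_k)_{k\ge1}$ is a sequence of real $n\times n$ matrices with $\sum_{k\ge1}|A_k|<\infty$; $(\tau_k)_{k\ge1}$ is a strictly increasing sequence in $(0,\tau_*]$; $N\in L^1((0,\tau_* ),\mathbb{R}^{n\times n})$. $I$ is the $n\times n$ identity matrix; $|\cdot|$ is the Euclidean norm on $\mathbb{R}^n$ or a matrix norm. Spaces: for $C\subset\mathbb{R}$ with nonempty interior, $V(C,\mathbb{R}^n)$ is either $L^p(C,\mathbb{R}^n)$, $p\in[1,\infty]$, or $BV(C,\mathbb{R}^n)$, the functions of bounded variation with norm the sum of the total variation and the sup norm. Elements are identified when equal almost everywhere (the $BV$ norm being the infimum over representatives). $V_{loc}(\mathbb{R}_+,\mathbb{R}^n)$ denotes the functions belonging to $V(K,\mathbb{R}^n)$ for every compact interval $K\subset\mathbb{R}_+=[0,\infty)$. Partial trajectory: $X_t(s):=X(t+s)$ for $s\in[-\tau_*,0]$, and $\|X_t\|_V$ is its norm in $V([-\tau_*,0],\mathbb{R}^n)$. Solution: given $(X_0,x_0)\in V([-\tau_*,0],\mathbb{R}^n)\times\mathbb{R}^n$, a function $X$ on $[-\tau_*,\infty)$ is a solution if $X=X_0$ (a.e.) on $[-\tau_*,0)$, $X$ is locally absolutely continuous on $[0,\infty)$ with $X(0)=x_0$ and $X'\in V_{loc}(\mathbb{R}_+,\mathbb{R}^n)$, and the differential equation holds for almost every $t>0$. For each $(X_0,x_0)$ there is exactly one solution. Exponential stability: the equation is exponentially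 stable if there exist $\nu>0$ and $C\ge1$ such that for all $(X_0,x_0)\in V([-\tau_*,0],\mathbb{R}^n)\times\mathbb{R}^n$ the solution satisfies $\|X_t\|_V+|X(t)|\le Ce^{-\nu t}(\|X_0\|_V+|x_0|)$ for all $t\ge0$. *)

theory Defs
  imports "HOL-Analysis.Analysis" "HOL-Probability.Essential_Supremum"
begin

text \<open>
  Norms are valued in \<open>[0, \<infinity>]\<close>; a function belongs to a space iff it is Lebesgue measurable
  and its norm is finite.  Elements of the spaces are functions rather than classes, but
  \<open>Lp_norm\<close> and \<open>BV_norm\<close> are invariant under equality almost everywhere on \<open>C\<close>.
\<close>

definition ennreal_powr :: "ennreal \<Rightarrow> real \<Rightarrow> ennreal" where
  "ennreal_powr x r = (if x = \<infinity> then \<infinity> else ennreal (enn2real x powr r))"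

definition Lp_norm :: "ennreal \<Rightarrow> real set \<Rightarrow> (real \<Rightarrow> 'a::euclidean_space) \<Rightarrow> ennreal" where
  "Lp_norm p C f =
     (if p = \<infinity> then esssup (lebesgue_on C) (\<lambda>s. ennreal (norm (f s)))
      else ennreal_powr (\<integral>\<^sup>+ s. ennreal (norm (f s) powr enn2real p) \<partial>lebesgue_on C)
             (1 / enn2real p))"

definition total_variation :: "real set \<Rightarrow> (real \<Rightarrow> 'a::real_normed_vector) \<Rightarrow> ennreal" where
  "total_variation C f =
     (SUP (m, t) \<in> {(m, t :: nat \<Rightarrow> real). mono_on {..m} t \<and> t ` {..m} \<subseteq> C}.
        \<Sum>i<m. ennreal (norm (f (t (Suc i)) - f (t i))))"

definition sup_norm :: "real set \<Rightarrow> (real \<Rightarrow> 'a::real_normed_vector) \<Rightarrow> ennreal" where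
  "sup_norm C f = (SUP s\<in>C. ennreal (norm (f s)))"

definition BV_norm :: "real set \<Rightarrow> (real \<Rightarrow> 'a::real_normed_vector) \<Rightarrow> ennreal" where
  "BV_norm C f =
     (INF g \<in> {g. AE s in lebesgue_on C. g s = f s}. total_variation C g + sup_norm C g)"

datatype fspace = Lp ennreal | BV

fun V_norm :: "fspace \<Rightarrow> real set \<Rightarrow> (real \<Rightarrow> 'a::euclidean_space) \<Rightarrow> ennreal" where
  "V_norm (Lp p) C f = Lp_norm p C f"
| "V_norm BV C f = BV_norm C f"

definition V_space :: "fspace \<Rightarrow> real set \<Rightarrow> (real \<Rightarrow> 'a::euclidean_space) set" where
  "V_space V C = {f. f \<in> borel_measurable (lebesgue_on C) \<and> V_norm V C f < \<infinity>}"

definition V_loc :: "fspace \<Rightarrow> (real \<Rightarrow> 'a::euclidean_space) set" where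
  "V_loc V = {f. \<forall>a b. 0 \<le> a \<longrightarrow> a < b \<longrightarrow> f \<in> V_space V {a..b}}"

text \<open>
  On the real line, \<open>D division_of S\<close> means that \<open>D\<close> is a finite family of nonoverlapping nonempty
  compact intervals with union \<open>S\<close>; the set \<open>S\<close> need not be an interval.
\<close>

definition absolutely_continuous_on :: "real set \<Rightarrow> (real \<Rightarrow> 'a::real_normed_vector) \<Rightarrow> bool" where
  "absolutely_continuous_on C f \<longleftrightarrow>
     (\<forall>\<epsilon>>0. \<exists>\<delta>>0. \<forall>D S. D division_of S \<longrightarrow> S \<subseteq> C \<longrightarrow>
        (\<Sum>K\<in>D. Sup K - Inf K) < \<delta> \<longrightarrow> (\<Sum>K\<in>D. norm (f (Sup K) - f (Inf K))) < \<epsilon>)"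

definition partial_trajectory :: "(real \<Rightarrow> 'a) \<Rightarrow> real \<Rightarrow> real \<Rightarrow> 'a" where
  "partial_trajectory X t = (\<lambda>s. X (t + s))"

text \<open>
  \<open>T\<close> is the maximal delay.  Sequences indexed by \<open>k \<ge> 1\<close> in the usual notation are indexed from 0 here, so
  \<open>A 0\<close> and \<open>\<tau> 0\<close> are the first matrix and the first delay.  Functions on \<open>[-T, \<infinity>)\<close> are
  represented by total functions whose values below \<open>-T\<close> are never used.

  In \<open>dde_at\<close>, the first three conjuncts say that all terms of the equation are meaningful at \<open>t\<close>; they guard
  against the default values of the derivative, the series and the integral.
\<close>

definition dde_at ::
  "real \<Rightarrow> (nat \<Rightarrow> real^'n^'n) \<Rightarrow> (nat \<Rightarrow> real) \<Rightarrow> (real \<Rightarrow> real^'n^'n)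
    \<Rightarrow> (real \<Rightarrow> real^'n) \<Rightarrow> real \<Rightarrow> bool" where
  "dde_at T A \<tau> N X t \<longleftrightarrow>
     X differentiable (at t) \<and>
     summable (\<lambda>k. A k *v X (t - \<tau> k)) \<and>
     set_integrable lebesgue {0<..<T} (\<lambda>s. N s *v X (t - s)) \<and>
     vector_derivative X (at t) + (\<Sum>k. A k *v X (t - \<tau> k))
       + (LINT s:{0<..<T}|lebesgue. N s *v X (t - s)) = 0"

definition dde_solution ::
  "fspace \<Rightarrow> real \<Rightarrow> (nat \<Rightarrow> real^'n^'n) \<Rightarrow> (nat \<Rightarrow> real) \<Rightarrow> (real \<Rightarrow> real^'n^'n)
    \<Rightarrow> (real \<Rightarrow> real^'n) \<Rightarrow> real^'n \<Rightarrow> (real \<Rightarrow> real^'n) \<Rightarrow> bool" where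
  "dde_solution V T A \<tau> N X0 x0 X \<longleftrightarrow>
     (AE t in lebesgue_on {-T..<0}. X t = X0 t) \<and>
     X 0 = x0 \<and>
     (\<forall>a b. 0 \<le> a \<longrightarrow> a \<le> b \<longrightarrow> absolutely_continuous_on {a..b} X) \<and>
     (\<lambda>t. vector_derivative X (at t)) \<in> V_loc V \<and>
     (AE t in lebesgue_on {0<..}. dde_at T A \<tau> N X t)"

definition exp_decay ::
  "fspace \<Rightarrow> real \<Rightarrow> (nat \<Rightarrow> real^'n^'n) \<Rightarrow> (nat \<Rightarrow> real) \<Rightarrow> (real \<Rightarrow> real^'n^'n)
    \<Rightarrow> real \<Rightarrow> real \<Rightarrow> bool" where
  "exp_decay V T A \<tau> N \<nu> C \<longleftrightarrow>
     (\<forall>X0 \<in> V_space V {-T..0}. \<forall>x0 X. dde_solution V T A \<tau> N X0 x0 X \<longrightarrow>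
        (\<forall>t\<ge>0. V_norm V {-T..0} (partial_trajectory X t) + ennreal (norm (X t))
           \<le> ennreal (C * exp (- \<nu> * t)) * (V_norm V {-T..0} X0 + ennreal (norm x0))))"

definition exponentially_stable ::
  "fspace \<Rightarrow> real \<Rightarrow> (nat \<Rightarrow> real^'n^'n) \<Rightarrow> (nat \<Rightarrow> real) \<Rightarrow> (real \<Rightarrow> real^'n^'n) \<Rightarrow> bool" where
  "exponentially_stable V T A \<tau> N \<longleftrightarrow> (\<exists>\<nu>>0. \<exists>C\<ge>1. exp_decay V T A \<tau> N \<nu> C)"

definition char_matrix ::
  "real \<Rightarrow> (nat \<Rightarrow> real^'n^'n) \<Rightarrow> (nat \<Rightarrow> real) \<Rightarrow> (real \<Rightarrow> real^'n^'n)
    \<Rightarrow> complex \<Rightarrow> complex^'n^'n" where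
  "char_matrix T A \<tau> N z =
     mat z
     + (\<Sum>k. map_matrix (\<lambda>a. of_real a * exp (- of_real (\<tau> k) * z)) (A k))
     + (LINT s:{0<..<T}|lebesgue. map_matrix (\<lambda>a. of_real a * exp (- of_real s * z)) (N s))"

end

theory Submission
  imports Defs "HOL-Probability.Characteristic_Functions" "HOL-Probability.Sinc_Integral"
    "HOL-Complex_Analysis.Complex_Analysis" "HOL-Real_Asymp.Real_Asymp"
begin

text \<open>
  Both directions compare the equation with its Laplace transform.

  Stability forces the roots to the left.  If the characteristic matrix at \<open>z\<close> kills \<open>v \<noteq> 0\<close>, then the
  real and imaginary parts of \<open>exp (z t) v\<close> solve the equation, and they cannot both decay faster than
  \<open>exp (t Re z)\<close>.  So decay with rate \<open>\<nu>\<close> implies \<open>Re z \<le> - \<nu>\<close> (\<open>root_of_decay\<close>).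

  Roots to the left force decay (\<open>decay_of_roots\<close>).  The series and the integral are merged into one integral
  \<open>conv X t = \<integral> B r *v X (t - d r) delay_measure\<close> over an abstract measure space, and the equation becomes \<open>X' = - conv X\<close>.
  Moving the contribution of the initial history to the right-hand side as a source \<open>f\<close> with support
  in \<open>[0, T]\<close> leaves a Volterra equation on the half-line,
  \<open>x t = x0 + \<integral>\<^sub>0\<^sup>t (f - conv x)\<close>, whose Laplace transform satisfies \<open>P z (x^ z) = x0 + f^ z\<close>, where \<open>P\<close> is the
  characteristic matrix.  If \<open>det (P z)\<close> has no zero with \<open>Re z \<ge> - \<nu>\<close>, then \<open>P z\<close> is bounded below by a
  multiple of \<open>1 + \<bar>z\<bar>\<close> on that closed half-plane (\<open>char_lower_bound\<close>): for large \<open>z\<close> the term \<open>z I\<close> dominates, and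
  the remaining set is compact.  Hence \<open>x^\<close> extends holomorphically to the half-plane and is \<open>O(1/\<bar>z\<bar>)\<close> there.

  This is not integrable along vertical lines, because \<open>x\<close> jumps at \<open>0\<close> and \<open>f\<close> is merely integrable.
  Therefore the explicit function \<open>g\<close> with \<open>g' = - a g + f\<close>, \<open>g 0 = x0\<close>, \<open>a = \<nu> + 1\<close>, whose transform is
  \<open>(x0 + f^ z) / (z + a)\<close>, is subtracted.  It decays like \<open>exp (- a t)\<close>, and the transform of \<open>x - g\<close> is
  \<open>O(1/\<bar>z\<bar>\<^sup>2)\<close>.  Fourier inversion far to the right and a shift of the contour to the line \<open>Re z = - \<nu>\<close>
  (\<open>laplace_inversion_bound\<close>) give \<open>\<bar>x t\<bar> \<le> C exp (- \<nu> t) (\<bar>x0\<bar> + \<parallel>f\<parallel>\<^sub>1)\<close> (\<open>volterra_decay\<close>).  Since the roots satisfy a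
  strict inequality, the contour may be put on the line \<open>Re z = - \<nu>\<close> itself, which is why the rate is attained.

  This bounds \<open>\<bar>X t\<bar>\<close> by the \<open>L\<^sup>1\<close> norm of the history, which every norm \<open>V\<close> dominates
  (\<open>V_norm_dominates_L1\<close>).  Conversely the norm of \<open>X\<^sub>t\<close> is controlled by the part of the history still
  visible at time \<open>t\<close>, the supremum of \<open>X\<close> and the variation of \<open>X\<close> over the last \<open>T\<close> units of time
  (\<open>V_norm_partial_trajectory_le\<close>).  That variation is at most the integral of \<open>\<bar>X'\<bar>\<close>, and the equation bounds it
  by the integral of \<open>\<bar>X\<bar>\<close> over the last \<open>2 T\<close> units of time.
\<close>

section \<open>Fourier inversion and contour shift\<close>

lemma std_normal_density_fourier:
  "(LINT x|lborel. std_normal_density x * cis (t * x)) = complex_of_real (exp (- t\<^sup>2 / 2))"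
proof -
  have "char std_normal_distribution t = (LINT x|lborel. std_normal_density x *\<^sub>R cis (t * x))"
    unfolding char_def
    by (subst integral_density) (auto simp: cis_conv_exp)
  then show ?thesis
    by (simp add: char_std_normal_distribution scaleR_conv_of_real)
qed

text \<open>
  Multiplying the transform by the Gaussian density scaled by \<open>n\<close> makes Fubini applicable and turns the
  left-hand side into an average of \<open>g\<close> over a Gaussian of width \<open>1 / n\<close> around \<open>t\<close>.  Both sides converge
  by dominated convergence as \<open>n \<rightarrow> \<infinity>\<close>.
\<close>

lemma fourier_inversion:
  fixes g :: "real \<Rightarrow> complex"
  assumes cont: "continuous_on UNIV g" and bnd: "\<And>t. norm (g t) \<le> K"
    and int: "integrable lborel g"
    and intG: "integrable lborel (\<lambda>\<omega>. LINT u|lborel. g u * cis (- \<omega> * u))"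
  shows "(LINT \<omega>|lborel. (LINT u|lborel. g u * cis (- \<omega> * u)) * cis (\<omega> * t)) = 2 * pi * g t"
proof -
  define G where "G \<omega> = (LINT u|lborel. g u * cis (- \<omega> * u))" for \<omega>
  define \<phi> where "\<phi> = std_normal_density"
  have [measurable]: "\<phi> \<in> borel_measurable borel" "g \<in> borel_measurable borel"
     "G \<in> borel_measurable borel"
    using borel_measurable_integrable[OF intG] cont
    by (auto simp: \<phi>_def G_def[abs_def] borel_measurable_continuous_onI)
  have cis_meas[measurable]: "cis \<in> borel_measurable borel"
    by (intro borel_measurable_continuous_onI) (auto simp: cis_conv_exp intro!: continuous_intros)
  have \<phi>0: "0 \<le> \<phi> x" "\<phi> x \<le> \<phi> 0" for x
    by (auto simp: \<phi>_def std_normal_density_def divide_simps)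
  have \<phi>i: "integrable lborel \<phi>" by (simp add: \<phi>_def)
  have \<phi>c: "isCont \<phi> x" for x unfolding \<phi>_def normal_density_def by (intro continuous_intros) auto
  let ?J = "\<lambda>n::nat. LINT \<omega>|lborel. G \<omega> * cis (\<omega> * t) * \<phi> (\<omega> / real (Suc n))"
  have lim1: "?J \<longlonglongrightarrow> (LINT \<omega>|lborel. G \<omega> * cis (\<omega> * t) * \<phi> 0)"
  proof (rule integral_dominated_convergence[where w="\<lambda>\<omega>. norm (G \<omega>) * \<phi> 0"])
    show "integrable lborel (\<lambda>\<omega>. norm (G \<omega>) * \<phi> 0)"
      using intG by (auto simp: G_def)
    have "(\<lambda>n. \<phi> (\<omega> / real (Suc n))) \<longlonglongrightarrow> \<phi> 0" for \<omega>
    proof (rule isCont_tendsto_compose[OF \<phi>c])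
      show "(\<lambda>n. \<omega> / real (Suc n)) \<longlonglongrightarrow> 0"
        using tendsto_mult_right_zero[OF LIMSEQ_inverse_real_of_nat, of \<omega>] by (simp add: divide_inverse)
    qed
    then show "AE \<omega> in lborel. (\<lambda>n. G \<omega> * cis (\<omega> * t) * \<phi> (\<omega> / real (Suc n))) \<longlonglongrightarrow> G \<omega> * cis (\<omega> * t) * \<phi> 0"
      by (intro AE_I2 tendsto_intros)
    show "AE \<omega> in lborel. norm (G \<omega> * cis (\<omega> * t) * \<phi> (\<omega> / real (Suc n))) \<le> norm (G \<omega>) * \<phi> 0" for n
      using \<phi>0 by (intro AE_I2) (auto simp: norm_mult intro!: mult_left_mono)
  qed auto
  have J_eq: "?J n = (LINT v|lborel. g (t - v / Suc n) * complex_of_real (exp (- v\<^sup>2 / 2)))" for n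
  proof -
    define m where "m = real (Suc n)"
    have m: "m > 0" by (simp add: m_def)
    have \<phi>m: "integrable lborel (\<lambda>\<omega>. \<phi> (\<omega> / m))"
      using lborel_integrable_real_affine[OF \<phi>i, of "1/m" 0] m by simp
    have fub: "integrable (lborel \<Otimes>\<^sub>M lborel) (\<lambda>(\<omega>,u). g u * cis (\<omega> * (t - u)) * \<phi> (\<omega> / m))"
    proof (rule lborel_pair.Fubini_integrable)
      show "AE x in lborel. integrable lborel (\<lambda>y. case (x, y) of (\<omega>, u) \<Rightarrow> g u * cis (\<omega> * (t - u)) * complex_of_real (\<phi> (\<omega> / m)))"
        by (intro AE_I2, simp, intro integrable_mult_left, rule Bochner_Integration.integrable_bound[OF int])
           (auto simp: norm_mult)
      show "integrable lborel
     (\<lambda>x. LINT y|lborel. norm (case (x, y) of (\<omega>, u) \<Rightarrow> g u * cis (\<omega> * (t - u)) * complex_of_real (\<phi> (\<omega> / m))))"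
        using \<phi>0 \<phi>m by (simp add: norm_mult)
    qed measurable
    have "?J n = (LINT \<omega>|lborel. (LINT u|lborel. g u * cis (\<omega> * (t - u)) * \<phi> (\<omega> / m)))"
      unfolding G_def m_def[symmetric]
    proof (intro Bochner_Integration.integral_cong refl, goal_cases)
      case (1 \<omega>)
      have *: "cis (\<omega> * (t - u)) = cis (- \<omega> * u) * cis (\<omega> * t)" for u
        by (simp add: cis_mult algebra_simps)
      have "(LINT u|lborel. g u * cis (- \<omega> * u)) * cis (\<omega> * t) * complex_of_real (\<phi> (\<omega> / m))
         = (LINT u|lborel. g u * cis (- \<omega> * u) * (cis (\<omega> * t) * complex_of_real (\<phi> (\<omega> / m))))"
        by simp
      also have "\<dots> = (LINT u|lborel. g u * cis (\<omega> * (t - u)) * \<phi> (\<omega> / m))"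
        by (intro Bochner_Integration.integral_cong refl) (simp add: * )
      finally show ?case by simp
    qed
    also have "\<dots> = (LINT u|lborel. (LINT \<omega>|lborel. g u * cis (\<omega> * (t - u)) * \<phi> (\<omega> / m)))"
      using lborel_pair.Fubini_integral[OF fub] by simp
    also have "\<dots> = (LINT u|lborel. g u * complex_of_real (m * exp (- (m * (t - u))\<^sup>2 / 2)))"
    proof (intro Bochner_Integration.integral_cong refl, goal_cases)
      case (1 u)
      have "(LINT \<omega>|lborel. cis (\<omega> * (t - u)) * \<phi> (\<omega> / m))
        = m *\<^sub>R (LINT x|lborel. cis (0 + m * x * (t - u)) * \<phi> (x))"
        using lborel_integral_real_affine[of m "\<lambda>\<omega>. cis (\<omega> * (t - u)) * complex_of_real (\<phi> (\<omega> / m))" 0] m by simp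
      also have "(LINT x|lborel. cis (0 + m * x * (t - u)) * \<phi> (x)) = exp (- (m * (t - u))\<^sup>2 / 2)"
        unfolding std_normal_density_fourier[symmetric] \<phi>_def
        by (intro Bochner_Integration.integral_cong refl) (simp add: ac_simps)
      finally show ?case by (simp add: mult.assoc scaleR_conv_of_real)
    qed
    also have "\<dots> = (LINT v|lborel. g (t - v / m) * complex_of_real (exp (- v\<^sup>2 / 2)))"
      using m lborel_integral_real_affine[of "-1/m" "\<lambda>u. g u * complex_of_real (m * exp (- (m * (t - u))\<^sup>2 / 2))" t]
      by (simp add: scaleR_conv_of_real mult.left_commute flip: Bochner_Integration.integral_mult_right_zero)
    finally show ?thesis by (simp add: m_def)
  qed
  have "?J \<longlonglongrightarrow> (LINT v|lborel. g t * complex_of_real (exp (- v\<^sup>2 / 2)))"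
    unfolding J_eq
  proof (rule integral_dominated_convergence[where w="\<lambda>v. K * (sqrt (2 * pi) * \<phi> v)"])
    show "integrable lborel (\<lambda>v. K * (sqrt (2 * pi) * \<phi> v))" using \<phi>i by simp
    have "(\<lambda>n. g (t - v / real (Suc n))) \<longlonglongrightarrow> g t" for v
    proof (rule isCont_tendsto_compose[of _ g])
      show "isCont g t" using cont by (simp add: continuous_on_eq_continuous_at)
      show "(\<lambda>n. t - v / real (Suc n)) \<longlonglongrightarrow> t"
        using tendsto_diff[OF tendsto_const[of t] tendsto_mult_right_zero[OF LIMSEQ_inverse_real_of_nat, of v]] by (simp add: divide_inverse)
    qed
    then show "AE v in lborel. (\<lambda>n. g (t - v / real (Suc n)) * complex_of_real (exp (- v\<^sup>2 / 2))) \<longlonglongrightarrow> g t * complex_of_real (exp (- v\<^sup>2 / 2))"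
      by (intro AE_I2 tendsto_intros)
    show "AE v in lborel. norm (g (t - v / real (Suc n)) * complex_of_real (exp (- v\<^sup>2 / 2))) \<le> K * (sqrt (2 * pi) * \<phi> v)" for n
      using bnd by (intro AE_I2) (auto simp: norm_mult \<phi>_def std_normal_density_def intro!: mult_right_mono)
  qed measurable
  moreover have "(LINT v|lborel. g t * complex_of_real (exp (- v\<^sup>2 / 2))) = g t * (sqrt (2 * pi))"
  proof -
    have "(LINT v|lborel. exp (- v\<^sup>2 / 2)) = (LINT v|lborel. sqrt (2 * pi) * \<phi> v)"
      by (intro Bochner_Integration.integral_cong refl) (simp add: \<phi>_def std_normal_density_def)
    also have "\<dots> = sqrt (2 * pi)" by (simp add: \<phi>_def)
    finally show ?thesis by simp
  qed
  ultimately have "(LINT \<omega>|lborel. G \<omega> * cis (\<omega> * t) * \<phi> 0) = g t * (sqrt (2 * pi))"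
    using LIMSEQ_unique[OF lim1] by simp
  moreover have "\<phi> 0 = 1 / sqrt (2 * pi)" by (simp add: \<phi>_def std_normal_density_def)
  moreover have "complex_of_real (sqrt (2 * pi)) \<noteq> 0" by simp
  ultimately have "(LINT \<omega>|lborel. G \<omega> * cis (\<omega> * t)) = g t * (complex_of_real (sqrt (2 * pi)) * complex_of_real (sqrt (2 * pi)))"
    by (simp add: divide_eq_eq mult.assoc del: real_sqrt_mult)
  also have "complex_of_real (sqrt (2 * pi)) * complex_of_real (sqrt (2 * pi)) = 2 * pi"
    by (simp flip: of_real_mult)
  finally show ?thesis by (simp add: G_def)
qed

lemma integral_inverse_1_plus_square:
  "integrable lborel (\<lambda>x::real. inverse (1 + x\<^sup>2))"
  "(LINT x|lborel. inverse (1 + x\<^sup>2)) = pi"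
  using integrable_inverse_1_plus_square LBINT_inverse_1_plus_square
  by (auto simp: set_integrable_def interval_lebesgue_integral_def set_lebesgue_integral_def)

text \<open>
  Cauchy's theorem on the rectangle with vertices \<open>\<sigma> \<plusminus> i R\<close>, \<open>c \<plusminus> i R\<close>: the horizontal sides contribute
  \<open>O(1 / R\<^sup>2)\<close>.
\<close>

lemma contour_shift:
  fixes F :: "complex \<Rightarrow> complex"
  assumes hol: "F holomorphic_on {z. \<sigma> \<le> Re z}" and "\<sigma> < c"
    and bnd: "\<And>z. \<sigma> \<le> Re z \<Longrightarrow> Re z \<le> c \<Longrightarrow> norm (F z) \<le> D / (1 + (Im z)\<^sup>2)"
  shows "(LINT \<omega>|lborel. F (Complex c \<omega>)) = (LINT \<omega>|lborel. F (Complex \<sigma> \<omega>))"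
proof -
  have cont: "continuous_on {z. \<sigma> \<le> Re z} F" using hol by (rule holomorphic_on_imp_continuous_on)
  have contr: "continuous_on UNIV (\<lambda>\<omega>. F (Complex s \<omega>))" if "\<sigma> \<le> s" for s
    using that by (intro continuous_on_compose2[OF cont]) (auto simp: complex_eq_iff Complex_eq intro!: continuous_intros)
  have int: "integrable lborel (\<lambda>\<omega>. F (Complex s \<omega>))" if "\<sigma> \<le> s" "s \<le> c" for s
  proof (rule Bochner_Integration.integrable_bound)
    show "integrable lborel (\<lambda>x. D * inverse (1 + x\<^sup>2))" using integral_inverse_1_plus_square by simp
    show "(\<lambda>\<omega>. F (Complex s \<omega>)) \<in> borel_measurable lborel"
      using contr[of s] that by (simp add: borel_measurable_continuous_onI)
    have "norm (F (Complex s x)) \<le> norm (D * inverse (1 + x\<^sup>2))" for x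
      using bnd[of "Complex s x"] that by (auto simp: divide_inverse)
    then show "AE x in lborel. norm (F (Complex s x)) \<le> norm (D * inverse (1 + x\<^sup>2))" by simp
  qed
  have line: "contour_integral (linepath (Complex s (-R)) (Complex s R)) F
              = \<i> * (LINT \<omega>:{-R..R}|lborel. F (Complex s \<omega>))" if "\<sigma> \<le> s" "R > 0" for s R
  proof (rule contour_integral_unique)
    have "continuous_on {-R..R} (\<lambda>\<omega>. F (Complex s \<omega>))"
      using contr[of s] that continuous_on_subset by blast
    then have "set_integrable lborel {-R..R} (\<lambda>\<omega>. F (Complex s \<omega>))"
      by (rule borel_integrable_atLeastAtMost')
    from set_borel_integral_eq_integral[OF this]
    have "((\<lambda>\<omega>. F (Complex s \<omega>)) has_integral (LINT \<omega>:{-R..R}|lborel. F (Complex s \<omega>))) {-R..R}"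
      using integrable_integral by metis
    then show "(F has_contour_integral \<i> * (LINT \<omega>:{-R..R}|lborel. F (Complex s \<omega>))) (linepath (Complex s (-R)) (Complex s R))"
      using that by (subst has_contour_integral_linepath_same_Re_iff[of _ s _ "-R" R])
         (simp_all add: mult.assoc[symmetric])
  qed
  have D: "D \<ge> 0"
    using order_trans[OF norm_ge_zero bnd[of "Complex \<sigma> 0"]] \<open>\<sigma> < c\<close> by simp
  have est: "norm ((LINT \<omega>:{-R..R}|lborel. F (Complex c \<omega>)) - (LINT \<omega>:{-R..R}|lborel. F (Complex \<sigma> \<omega>)))
     \<le> (D / (1 + R\<^sup>2)) * (c - \<sigma>) + (D / (1 + R\<^sup>2)) * (c - \<sigma>)" if "R > 0" for R
  proof -
    let ?a = "Complex \<sigma> (-R)" and ?b = "Complex c (-R)" and ?d = "Complex c R" and ?e = "Complex \<sigma> R"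
    have conv: "convex {z. \<sigma> \<le> Re z}" by (rule convex_halfspace_Re_ge)
    have seg: "closed_segment x y \<subseteq> {z. \<sigma> \<le> Re z}" if "\<sigma> \<le> Re x" "\<sigma> \<le> Re y" for x y
      using conv that by (simp add: closed_segment_subset)
    have ci: "F contour_integrable_on linepath x y" if "\<sigma> \<le> Re x" "\<sigma> \<le> Re y" for x y
      using contour_integrable_continuous_linepath continuous_on_subset[OF cont seg[OF that]] by blast
    have "(F has_contour_integral 0) (linepath ?a ?b +++ linepath ?b ?d +++ linepath ?d ?e +++ linepath ?e ?a)"
      using seg \<open>\<sigma> < c\<close> by (intro Cauchy_theorem_convex_simple[OF hol conv]) (auto simp: path_image_join)
    then have "contour_integral (linepath ?a ?b) F + contour_integral (linepath ?b ?d) F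
         + contour_integral (linepath ?d ?e) F + contour_integral (linepath ?e ?a) F = 0"
      using ci \<open>\<sigma> < c\<close> by (auto dest!: contour_integral_unique simp: add.assoc)
    moreover have "contour_integral (linepath ?e ?a) F = - contour_integral (linepath ?a ?e) F"
      by (metis contour_integral_reversepath reversepath_linepath valid_path_linepath)
    ultimately have "\<i> * ((LINT \<omega>:{-R..R}|lborel. F (Complex c \<omega>)) - (LINT \<omega>:{-R..R}|lborel. F (Complex \<sigma> \<omega>)))
       = - (contour_integral (linepath ?a ?b) F + contour_integral (linepath ?d ?e) F)"
      using line[of c R] line[of \<sigma> R] that \<open>\<sigma> < c\<close> by (simp add: algebra_simps add_eq_0_iff)
    then have "norm ((LINT \<omega>:{-R..R}|lborel. F (Complex c \<omega>)) - (LINT \<omega>:{-R..R}|lborel. F (Complex \<sigma> \<omega>)))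
       = norm (contour_integral (linepath ?a ?b) F + contour_integral (linepath ?d ?e) F)"
      by (metis norm_minus_cancel norm_mult norm_ii mult_1)
    also have "\<dots> \<le> norm (contour_integral (linepath ?a ?b) F) + norm (contour_integral (linepath ?d ?e) F)"
      by (rule norm_triangle_ineq)
    finally have le: "norm ((LINT \<omega>:{-R..R}|lborel. F (Complex c \<omega>)) - (LINT \<omega>:{-R..R}|lborel. F (Complex \<sigma> \<omega>)))
       \<le> norm (contour_integral (linepath ?a ?b) F) + norm (contour_integral (linepath ?d ?e) F)" .
    have hor: "norm (contour_integral (linepath x y) F) \<le> (D / (1 + R\<^sup>2)) * norm (y - x)"
      if "(Im x = R \<and> Im y = R \<or> Im x = - R \<and> Im y = -R)" "Re x \<in> {\<sigma>..c}" "Re y \<in> {\<sigma>..c}" for x y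
    proof (rule contour_integral_bound_linepath)
      show "F contour_integrable_on linepath x y" using ci that by auto
      fix z assume z: "z \<in> closed_segment x y"
      have "convex {z. \<sigma> \<le> Re z \<and> Re z \<le> c \<and> Im z = Im x}"
        using convex_Int[OF convex_Int[OF convex_halfspace_Re_ge[of \<sigma>] convex_halfspace_Re_le[of c]]
             convex_Int[OF convex_halfspace_Im_ge[of "Im x"] convex_halfspace_Im_le[of "Im x"]]]
        by (rule back_subst[of convex]) auto
      then have "closed_segment x y \<subseteq> {z. \<sigma> \<le> Re z \<and> Re z \<le> c \<and> Im z = Im x}"
        using that by (intro closed_segment_subset) auto
      then show "norm (F z) \<le> D / (1 + R\<^sup>2)" using z bnd[of z] that by auto
    qed (use D in auto)
    have nrm: "norm (?b - ?a) = c - \<sigma>" "norm (?e - ?d) = c - \<sigma>"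
      using \<open>\<sigma> < c\<close> by (simp_all add: cmod_def)
    show ?thesis
      using order_trans[OF le add_mono[OF hor[of ?a ?b] hor[of ?d ?e]]] \<open>\<sigma> < c\<close>
      unfolding nrm by simp
  qed
  have lim: "(\<lambda>n. LINT \<omega>:{-real (Suc n)..real (Suc n)}|lborel. F (Complex s \<omega>)) \<longlonglongrightarrow> (LINT \<omega>|lborel. F (Complex s \<omega>))"
    if "\<sigma> \<le> s" "s \<le> c" for s
    unfolding set_lebesgue_integral_def
  proof (rule integral_dominated_convergence[where w="\<lambda>\<omega>. norm (F (Complex s \<omega>))"])
    show "AE x in lborel. (\<lambda>n. indicat_real {- real (Suc n)..real (Suc n)} x *\<^sub>R F (Complex s x)) \<longlonglongrightarrow> F (Complex s x)"
    proof (rule AE_I2, rule tendsto_eventually)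
      fix x :: real
      obtain n0 :: nat where "\<bar>x\<bar> < n0" using reals_Archimedean2 by blast
      then show "eventually (\<lambda>n. indicat_real {- real (Suc n)..real (Suc n)} x *\<^sub>R F (Complex s x) = F (Complex s x)) sequentially"
        unfolding eventually_sequentially by (intro exI[of _ n0]) (auto simp: indicator_def)
    qed
  qed (use int[OF that] in \<open>auto simp: indicator_def intro!: borel_measurable_scaleR\<close>)
  have "(\<lambda>n. (LINT \<omega>:{-real (Suc n)..real (Suc n)}|lborel. F (Complex c \<omega>)) - (LINT \<omega>:{-real (Suc n)..real (Suc n)}|lborel. F (Complex \<sigma> \<omega>))) \<longlonglongrightarrow> 0"
  proof (rule Lim_null_comparison)
    show "eventually (\<lambda>n. norm ((LINT \<omega>:{-real (Suc n)..real (Suc n)}|lborel. F (Complex c \<omega>)) - (LINT \<omega>:{-real (Suc n)..real (Suc n)}|lborel. F (Complex \<sigma> \<omega>)))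
       \<le> (D / (1 + (real (Suc n))\<^sup>2)) * (c - \<sigma>) + (D / (1 + (real (Suc n))\<^sup>2)) * (c - \<sigma>)) sequentially"
      by (intro always_eventually allI est) simp
    show "(\<lambda>n. (D / (1 + (real (Suc n))\<^sup>2)) * (c - \<sigma>) + (D / (1 + (real (Suc n))\<^sup>2)) * (c - \<sigma>)) \<longlonglongrightarrow> 0" by real_asymp
  qed
  moreover note tendsto_diff[OF lim[of c] lim[of \<sigma>]]
  ultimately show ?thesis using \<open>\<sigma> < c\<close> LIMSEQ_unique by fastforce
qed

text \<open>
  Inversion is applied to \<open>w t exp (- c t)\<close>, which is integrable because \<open>b < c\<close> and continuous on the whole
  line because \<open>w\<close> starts from \<open>0\<close>; then the contour is moved from \<open>Re z = c\<close> to \<open>Re z = \<sigma>\<close>.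
  The constant is \<open>1 / (2 \<pi>)\<close> times the integral of \<open>D / (1 + \<omega>\<^sup>2)\<close>.
\<close>

lemma laplace_inversion_bound:
  fixes w :: "real \<Rightarrow> real" and H :: "complex \<Rightarrow> complex"
  assumes cont: "continuous_on UNIV w" and w0: "\<And>t. t \<le> 0 \<Longrightarrow> w t = 0"
    and bnd: "\<And>t. t \<ge> 0 \<Longrightarrow> \<bar>w t\<bar> \<le> K * exp (b * t)"
    and hol: "H holomorphic_on {z. \<sigma> \<le> Re z}"
    and c: "b < c" "\<sigma> < c"
    and HL: "\<And>z::complex. Re z = c \<Longrightarrow> H z = (LINT t|lborel. w t * exp (- z * t))"
    and HD: "\<And>z. \<sigma> \<le> Re z \<Longrightarrow> norm (H z) \<le> D / (1 + (Im z)\<^sup>2)"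
  shows "\<bar>w t\<bar> \<le> D * exp (\<sigma> * t) / 2"
proof -
  define g where "g t = complex_of_real (w t * exp (- c * t))" for t
  have K: "K \<ge> 0" using bnd[of 0] by simp
  have gb: "norm (g t) \<le> (if t \<ge> 0 then K * exp (- ((c - b) * t)) else 0)" for t
    using mult_right_mono[OF bnd[of t], of "exp (-c * t)"] w0[of t]
    by (auto simp: g_def norm_mult algebra_simps abs_mult simp flip: exp_add)
  have contg: "continuous_on UNIV g" unfolding g_def by (intro continuous_intros cont)
  have G: "(LINT u|lborel. g u * cis (- \<omega> * u)) = H (Complex c \<omega>)" for \<omega>
  proof -
    have "g u * cis (- \<omega> * u) = w u * exp (- Complex c \<omega> * u)" for u
    proof -
      have "- Complex c \<omega> * u = of_real (- c * u) + \<i> * of_real (- \<omega> * u)"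
        by (simp add: Complex_eq algebra_simps)
      then show ?thesis
        unfolding g_def cis_conv_exp by (simp only: exp_add of_real_mult[of "w u"] exp_of_real mult.assoc)
    qed
    then show ?thesis using HL[where z="Complex c \<omega>"] by simp
  qed
  have contH: "continuous_on {z. \<sigma> \<le> Re z} H" using hol by (rule holomorphic_on_imp_continuous_on)
  have contHc: "continuous_on UNIV (\<lambda>\<omega>. H (Complex c \<omega>))"
    using c by (intro continuous_on_compose2[OF contH]) (auto simp: complex_eq_iff Complex_eq intro!: continuous_intros)
  have "2 * pi * g t = (LINT \<omega>|lborel. (LINT u|lborel. g u * cis (- \<omega> * u)) * cis (\<omega> * t))"
  proof (rule fourier_inversion[symmetric, OF contg])
    show "norm (g t) \<le> K" for t
      using gb[of t] K c by (auto split: if_splits simp: mult_le_cancel_left2 intro: order_trans)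
    show "integrable lborel g"
    proof (rule Bochner_Integration.integrable_bound)
      have "set_integrable lborel {0<..} (\<lambda>t. exp (- (t * (c - b))))"
        using c by (intro integrable_I0i_exp_mscale) auto
      then show "integrable lborel (\<lambda>t. indicator {0<..} t * (K * exp (- (t * (c - b)))))"
        by (simp add: set_integrable_def mult.left_commute)
      show "AE t in lborel. norm (g t) \<le> norm (indicator {0<..} t * (K * exp (- (t * (c - b)))))"
      proof (rule AE_I2)
        fix t show "norm (g t) \<le> norm (indicator {0<..} t * (K * exp (- (t * (c - b)))))"
          using gb[of t] K w0[of t] by (cases "t > 0") (auto simp: mult.commute g_def)
      qed
      show "g \<in> borel_measurable lborel" using contg by (simp add: borel_measurable_continuous_onI)
    qed
    show "integrable lborel (\<lambda>\<omega>. LINT u|lborel. g u * cis (- \<omega> * u))"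
      unfolding G
    proof (rule Bochner_Integration.integrable_bound)
      show "integrable lborel (\<lambda>x. D * inverse (1 + x\<^sup>2))" using integral_inverse_1_plus_square by simp
      show "(\<lambda>\<omega>. H (Complex c \<omega>)) \<in> borel_measurable lborel"
        using contHc by (simp add: borel_measurable_continuous_onI)
      have "norm (H (Complex c x)) \<le> norm (D * inverse (1 + x\<^sup>2))" for x
        using HD[of "Complex c x"] c by (auto simp: divide_inverse)
      then show "AE x in lborel. norm (H (Complex c x)) \<le> norm (D * inverse (1 + x\<^sup>2))" by simp
    qed
  qed
  then have "2 * pi * g t * exp (c * t) = (LINT \<omega>|lborel. H (Complex c \<omega>) * cis (\<omega> * t) * exp (c * t))"
    unfolding G by simp
  also have "\<dots> = (LINT \<omega>|lborel. H (Complex c \<omega>) * exp (Complex c \<omega> * t))"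
  proof (intro Bochner_Integration.integral_cong refl)
    fix \<omega>
    have "Complex c \<omega> * t = \<i> * of_real (\<omega> * t) + of_real (c * t)"
      by (simp add: Complex_eq algebra_simps)
    then show "H (Complex c \<omega>) * cis (\<omega> * t) * exp (c * t) = H (Complex c \<omega>) * exp (Complex c \<omega> * t)"
      unfolding cis_conv_exp by (simp only: exp_add exp_of_real mult.assoc)
  qed
  also have "\<dots> = (LINT \<omega>|lborel. H (Complex \<sigma> \<omega>) * exp (Complex \<sigma> \<omega> * t))"
  proof (rule contour_shift[where F="\<lambda>z. H z * exp (z * t)" and D="D * exp (max (c * t) (\<sigma> * t))"])
    show "(\<lambda>z. H z * exp (z * complex_of_real t)) holomorphic_on {z. \<sigma> \<le> Re z}"
      by (intro holomorphic_intros hol)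
    show "norm (H z * exp (z * complex_of_real t)) \<le> D * exp (max (c * t) (\<sigma> * t)) / (1 + (Im z)\<^sup>2)"
      if "\<sigma> \<le> Re z" "Re z \<le> c" for z
    proof -
      have "Re z * t \<le> max (c * t) (\<sigma> * t)"
        using that by (cases "t \<ge> 0") (auto simp: le_max_iff_disj mult_right_mono mult_right_mono_neg)
      then have "norm (H z) * exp (Re z * t) \<le> D / (1 + (Im z)\<^sup>2) * exp (max (c * t) (\<sigma> * t))"
        using HD[OF that(1)] by (intro mult_mono) (auto intro: order_trans[OF norm_ge_zero])
      then show ?thesis by (simp add: norm_mult)
    qed
  qed (fact c)
  finally have eq: "2 * pi * g t * exp (c * t) = (LINT \<omega>|lborel. H (Complex \<sigma> \<omega>) * exp (Complex \<sigma> \<omega> * t))" .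
  have "2 * pi * \<bar>w t\<bar> = norm (2 * pi * g t * exp (c * t))"
    by (simp add: g_def norm_mult abs_mult flip: exp_add)
  also have "\<dots> \<le> (LINT \<omega>|lborel. D * exp (\<sigma> * t) * inverse (1 + \<omega>\<^sup>2))"
    unfolding eq
  proof (rule Bochner_Integration.integral_norm_bound_integral)
    have b: "norm (H (Complex \<sigma> \<omega>) * exp (Complex \<sigma> \<omega> * t)) \<le> D * exp (\<sigma> * t) * inverse (1 + \<omega>\<^sup>2)" for \<omega>
      using mult_right_mono[OF HD[of "Complex \<sigma> \<omega>"], of "exp (\<sigma> * t)"] by (simp add: norm_mult divide_inverse algebra_simps)
    then show "norm (H (Complex \<sigma> \<omega>) * exp (Complex \<sigma> \<omega> * t)) \<le> D * exp (\<sigma> * t) * inverse (1 + \<omega>\<^sup>2)" for \<omega> .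
    show ii: "integrable lborel (\<lambda>\<omega>. D * exp (\<sigma> * t) * inverse (1 + \<omega>\<^sup>2))"
      using integral_inverse_1_plus_square by simp
    have "continuous_on UNIV (\<lambda>\<omega>. H (Complex \<sigma> \<omega>) * exp (Complex \<sigma> \<omega> * t))"
      by (intro continuous_intros continuous_on_compose2[OF contH]) (auto simp: complex_eq_iff Complex_eq intro!: continuous_intros)
    then show "integrable lborel (\<lambda>\<omega>. H (Complex \<sigma> \<omega>) * exp (Complex \<sigma> \<omega> * t))"
      using b by (intro Bochner_Integration.integrable_bound[OF ii]) 
        (auto simp: borel_measurable_continuous_onI intro: order_trans[OF _ abs_ge_self])
  qed
  also have "\<dots> = D * exp (\<sigma> * t) * pi" using integral_inverse_1_plus_square by simp
  finally show ?thesis by simp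
qed

section \<open>Matrices, convolutions and Laplace transforms\<close>

lemma norm_matrix_vector_mult_le:
  fixes A :: "'a::real_normed_field^'n^'m"
  shows "norm (A *v x) \<le> norm A * norm x"
proof -
  have "norm ((A *v x) $ i) \<le> norm (A $ i) * norm x" for i
  proof -
    have "norm ((A *v x) $ i) \<le> (\<Sum>j\<in>UNIV. \<bar>norm (A $ i $ j)\<bar> * \<bar>norm (x $ j)\<bar>)"
      unfolding matrix_vector_mult_def by (auto simp: norm_mult intro!: order_trans[OF norm_sum])
    also have "\<dots> \<le> norm (A $ i) * norm x"
      unfolding norm_vec_def[of x] norm_vec_def[of "A $ i"] by (rule L2_set_mult_ineq)
    finally show ?thesis .
  qed
  then have "norm (A *v x) \<le> L2_set (\<lambda>i. norm (A $ i) * norm x) UNIV"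
    unfolding norm_vec_def[of "A *v x"] by (intro L2_set_mono) auto
  also have "\<dots> = norm A * norm x"
    unfolding norm_vec_def[of A] by (simp add: L2_set_left_distrib)
  finally show ?thesis .
qed

lemma bounded_bilinear_matrix_vector_mult:
  "bounded_bilinear ((*v) :: 'a::real_normed_field^'n^'m \<Rightarrow> _)"
proof
  fix A A' :: "'a^'n^'m" and x y :: "'a^'n" and r :: real
  show "(A + A') *v x = A *v x + A' *v x" by (rule matrix_vector_mult_add_rdistrib)
  show "A *v (x + y) = A *v x + A *v y" by (rule matrix_vector_right_distrib)
  show "(r *\<^sub>R A) *v x = r *\<^sub>R (A *v x)" "A *v (r *\<^sub>R x) = r *\<^sub>R (A *v x)"
    by (auto simp: vec_eq_iff matrix_vector_mult_def scaleR_sum_right)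
  show "\<exists>K. \<forall>A x. norm ((A :: 'a^'n^'m) *v x) \<le> norm A * norm x * K"
    by (intro exI[of _ 1]) (simp add: norm_matrix_vector_mult_le)
qed

text \<open>
  The single application of Fubini behind all convolution facts below: with real weights it gives integrability
  and norm bounds for delayed averages, with exponential weights the multiplicativity of the Laplace transform,
  and with \<open>M = lborel\<close> the transform of an antiderivative.
\<close>

lemma (in sigma_finite_measure) convolution_integral:
  fixes b :: "'a \<Rightarrow> 'b::{banach, second_countable_topology}"
    and v :: "real \<Rightarrow> 'c::{banach, second_countable_topology}"
    and prod :: "'b \<Rightarrow> 'c \<Rightarrow> 'd::{banach, second_countable_topology}"
  assumes bil: "bounded_bilinear prod"
    and b: "integrable M b" and v: "integrable lborel v" and d[measurable]: "d \<in> borel_measurable M"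
  shows "integrable (lborel \<Otimes>\<^sub>M M) (\<lambda>(t, r). prod (b r) (v (t - d r)))"
    and "(LINT t|lborel. (LINT r|M. prod (b r) (v (t - d r)))) = prod (LINT r|M. b r) (LINT t|lborel. v t)"
proof -
  interpret bounded_bilinear prod by fact
  interpret P: pair_sigma_finite lborel M ..
  interpret Q: pair_sigma_finite M lborel ..
  have [measurable]: "b \<in> borel_measurable M" "v \<in> borel_measurable borel"
    using b v by auto
  have meas[measurable]: "(\<lambda>(r, t). prod (b r) (v (t - d r))) \<in> borel_measurable (M \<Otimes>\<^sub>M lborel)"
    unfolding case_prod_beta'
    by (rule borel_measurable_continuous_Pair[of "\<lambda>x. b (fst x)" _ "\<lambda>x. v (snd x - d (fst x))"])
       (auto intro!: continuous_on continuous_intros)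
  have shift: "integrable lborel (\<lambda>t. v (t - s))" "(LINT t|lborel. v (t - s)) = (LINT t|lborel. v t)"
    and shiftn: "integrable lborel (\<lambda>t. norm (v (t - s)))" "(LINT t|lborel. norm (v (t - s))) = (LINT t|lborel. norm (v t))" for s
    using lborel_integrable_real_affine[OF v, of 1 "-s"] lborel_integral_real_affine[of 1 v "-s"]
     lborel_integral_real_affine[of 1 "\<lambda>t. norm (v t)" "-s"] by auto
  obtain K where K: "\<And>a c. norm (prod a c) \<le> norm a * norm c * K" "K \<ge> 0"
    using nonneg_bounded by blast
  have Q: "integrable (M \<Otimes>\<^sub>M lborel) (\<lambda>(r, t). prod (b r) (v (t - d r)))"
  proof (rule Q.Fubini_integrable)
    have int: "integrable lborel (\<lambda>t. prod (b r) (v (t - d r)))" for r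
      by (intro integrable_bounded_linear[OF bounded_linear_right] shift)
    then show "AE x in M. integrable lborel (\<lambda>y. case (x, y) of (r, t) \<Rightarrow> prod (b r) (v (t - d r)))" by simp
    show "integrable M (\<lambda>x. LINT y|lborel. norm (case (x, y) of (r, t) \<Rightarrow> prod (b r) (v (t - d r))))"
    proof (rule Bochner_Integration.integrable_bound)
      show "integrable M (\<lambda>r. norm (b r) * ((LINT t|lborel. norm (v t)) * K))"
        using b by (intro integrable_mult_left) auto
      have "(LINT t|lborel. norm (prod (b r) (v (t - d r)))) \<le> norm (b r) * ((LINT t|lborel. norm (v t)) * K)" for r
      proof -
        have "(LINT t|lborel. norm (prod (b r) (v (t - d r)))) \<le> (LINT t|lborel. norm (b r) * norm (v (t - d r)) * K)"
          using int shiftn K by (intro integral_mono) auto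
        also have "\<dots> = norm (b r) * ((LINT t|lborel. norm (v t)) * K)" using shiftn by simp
        finally show ?thesis .
      qed
      then show "AE r in M. norm (LINT y|lborel. norm (case (r, y) of (r, t) \<Rightarrow> prod (b r) (v (t - d r))))
         \<le> norm (norm (b r) * ((LINT t|lborel. norm (v t)) * K))"
        using K by (auto intro!: AE_I2)
    qed measurable
  qed measurable
  then show int: "integrable (lborel \<Otimes>\<^sub>M M) (\<lambda>(t, r). prod (b r) (v (t - d r)))"
    using Q.integrable_product_swap by fastforce
  have "(LINT t|lborel. (LINT r|M. prod (b r) (v (t - d r)))) = (LINT r|M. (LINT t|lborel. prod (b r) (v (t - d r))))"
    using P.Fubini_integral[OF int] by simp
  also have "\<dots> = (LINT r|M. prod (b r) (LINT t|lborel. v t))"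
    using integral_bounded_linear[OF bounded_linear_right shift(1)] shift(2) by simp
  also have "\<dots> = prod (LINT r|M. b r) (LINT t|lborel. v t)"
    by (rule integral_bounded_linear[OF bounded_linear_left b])
  finally show "(LINT t|lborel. (LINT r|M. prod (b r) (v (t - d r)))) = prod (LINT r|M. b r) (LINT t|lborel. v t)" .
qed

lemma laplace_one:
  fixes z :: complex
  assumes "Re z > 0"
  shows "integrable lborel (\<lambda>t::real. indicator {0::real<..} t *\<^sub>R exp (- z * t))"
    and "(LINT t::real|lborel. indicator {0::real<..} t *\<^sub>R exp (- z * t)) = 1 / z"
proof -
  have z: "z \<noteq> 0" using assms by auto
  have i: "set_integrable lborel {0::real<..} (\<lambda>t. exp (- z * complex_of_real t))"
    unfolding set_integrable_def
  proof (rule Bochner_Integration.integrable_bound)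
    show "integrable lborel (\<lambda>t. indicator {0::real<..} t *\<^sub>R exp (- (t * Re z)))"
      using integrable_I0i_exp_mscale[OF assms] by (simp add: set_integrable_def)
  qed (auto simp: indicator_def mult.commute)
  show "integrable lborel (\<lambda>t::real. indicator {0::real<..} t *\<^sub>R exp (- z * t))"
    using i by (simp add: set_integrable_def)
  have "(LBINT t=ereal 0..\<infinity>. exp (- z * complex_of_real t)) = 0 - (- (1 / z))"
  proof (rule interval_integral_FTC_integrable[where F="\<lambda>t. - exp (- z * complex_of_real t) / z"])
    show "((\<lambda>t. - exp (- z * complex_of_real t) / z) has_vector_derivative exp (- z * complex_of_real x)) (at x)" for x
      using z by (auto intro!: derivative_eq_intros has_vector_derivative_real_field)
    show "isCont (\<lambda>x. exp (- z * complex_of_real x)) x" for x by (intro continuous_intros)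
    show "set_integrable lborel (einterval (ereal 0) \<infinity>) (\<lambda>x. exp (- z * complex_of_real x))"
      using i by (auto simp: einterval_def greaterThan_def)
    show "(((\<lambda>t. - exp (- z * complex_of_real t) / z) \<circ> real_of_ereal) \<longlongrightarrow> - (1 / z)) (at_right (ereal 0))"
      unfolding ereal_tendsto_simps 
      by (rule tendsto_eq_intros refl continuous_intros | use z in simp)+
    show "(((\<lambda>t. - exp (- z * complex_of_real t) / z) \<circ> real_of_ereal) \<longlongrightarrow> 0) (at_left \<infinity>)"
      unfolding ereal_tendsto_simps 
    proof (rule Lim_null_comparison)
      show "eventually (\<lambda>t. norm (- exp (- z * complex_of_real t) / z) \<le> exp (- Re z * t) / norm z) at_top"
        by (intro always_eventually) (auto simp: norm_divide)
      show "((\<lambda>t. exp (- Re z * t) / norm z) \<longlongrightarrow> 0) at_top" using assms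
        by (intro tendsto_divide_zero filterlim_compose[OF exp_at_bot] filterlim_tendsto_neg_mult_at_bot[OF tendsto_const]) (auto simp: filterlim_ident)
    qed
  qed simp
  then show "(LINT t::real|lborel. indicator {0::real<..} t *\<^sub>R exp (- z * t)) = 1 / z"
    by (simp add: interval_integral_to_infinity_eq set_lebesgue_integral_def)
qed

text \<open>
  \<open>exp (- z t) \<integral>\<^sub>0\<^sup>t p\<close> is the convolution of \<open>exp (- z t)\<close> on the positive half-line with
  \<open>p t exp (- z t)\<close>, so its integral is the product of \<open>1 / z\<close> and the transform of \<open>p\<close>.
\<close>

lemma laplace_integral:
  fixes p q :: "real \<Rightarrow> real" and z :: complex
  assumes p: "integrable lborel (\<lambda>t. p t * exp (- c * t))" "\<And>t. t < 0 \<Longrightarrow> p t = 0"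
    and qi: "integrable lborel (\<lambda>t. q t * exp (- z * t))"
    and q: "\<And>t. t \<ge> 0 \<Longrightarrow> q t = q0 + (LINT s:{0..t}|lborel. p s)" "\<And>t. t < 0 \<Longrightarrow> q t = 0"
    and c: "Re z = c" "c > 0"
  shows "z * (LINT t|lborel. q t * exp (- z * t)) = q0 + (LINT t|lborel. p t * exp (- z * t))"
proof -
  have z: "z \<noteq> 0" "Re z > 0" using c by auto
  let ?b = "\<lambda>r. indicator {0::real<..} r *\<^sub>R exp (- z * complex_of_real r)"
  let ?v = "\<lambda>t. p t * exp (- z * complex_of_real t)"
  have [measurable]: "(\<lambda>t. p t * exp (- c * t)) \<in> borel_measurable borel" using p by auto
  have "(\<lambda>t. (p t * exp (- c * t)) * exp (c * t)) \<in> borel_measurable borel" by measurable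
  then have pm[measurable]: "p \<in> borel_measurable borel" by (simp add: mult.assoc flip: exp_add)
  have v: "integrable lborel ?v"
    by (rule Bochner_Integration.integrable_bound[OF p(1)]) (use c in \<open>auto simp: norm_mult abs_mult\<close>)
  have conv: "(LINT r|lborel. ?b r * ?v (t - r)) = exp (- z * t) * (LINT s:{0..t}|lborel. p s)" for t
  proof -
    have "(LINT r|lborel. ?b r * ?v (t - r)) = (LINT s|lborel. ?b (t - s) * ?v s)"
      using lborel_integral_real_affine[of "-1" "\<lambda>r. ?b r * ?v (t - r)" t] by simp
    also have "\<dots> = (LINT s|lborel. exp (- z * t) * complex_of_real (indicator {..<t} s * p s))"
    proof (intro Bochner_Integration.integral_cong refl)
      fix s :: real
      have "exp (- z * complex_of_real (t - s)) * exp (- z * complex_of_real s) = exp (- z * complex_of_real t)"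
        by (simp add: algebra_simps flip: exp_add)
      then show "?b (t - s) * ?v s = exp (- z * t) * complex_of_real (indicator {..<t} s * p s)"
        by (auto simp: indicator_def)
    qed
    also have "\<dots> = exp (- z * t) * complex_of_real (LINT s|lborel. indicator {..<t} s * p s)"
      by (simp del: of_real_mult)
    also have "(LINT s|lborel. indicator {..<t} s * p s) = (LINT s|lborel. indicator {0..t} s *\<^sub>R p s)"
    proof (rule integral_cong_AE)
      show "AE s in lborel. indicator {..<t} s * p s = indicator {0..t} s *\<^sub>R p s"
        using AE_lborel_singleton[of t] by eventually_elim (auto simp: indicator_def p(2))
    qed measurable
    finally show ?thesis by (simp add: set_lebesgue_integral_def)
  qed
  have id: "(\<lambda>r::real. r) \<in> borel_measurable lborel" by simp
  have bb: "bounded_bilinear ((*) :: complex \<Rightarrow> _)" by (rule bounded_bilinear_mult)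
  note F = lborel.convolution_integral[OF bb laplace_one(1)[OF z(2)] v, of "\<lambda>r. r", OF id]
  have i: "integrable lborel (\<lambda>t. exp (- z * t) * complex_of_real (LINT s:{0..t}|lborel. p s))"
    using lborel_pair.integrable_fst[OF F(1)] unfolding conv .
  have e: "(LINT t|lborel. exp (- z * t) * complex_of_real (LINT s:{0..t}|lborel. p s)) = (1 / z) * (LINT t|lborel. ?v t)"
    using F(2) unfolding conv laplace_one(2)[OF z(2)] .
  let ?E = "\<lambda>t. indicator {0::real<..} t *\<^sub>R exp (- z * t)"
    and ?I = "\<lambda>t. exp (- z * t) * complex_of_real (LINT s:{0..t}|lborel. p s)"
  have si: "integrable lborel (\<lambda>t. complex_of_real q0 * ?E t + ?I t)"
    by (intro Bochner_Integration.integrable_add integrable_mult_right i laplace_one(1) z)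
  have "(LINT t|lborel. q t * exp (- z * t)) = (LINT t|lborel. complex_of_real q0 * ?E t + ?I t)"
  proof (rule integral_cong_AE)
    have eq: "q t * exp (- z * t) = complex_of_real q0 * ?E t + ?I t" if "t \<noteq> 0" for t
      using that q[of t] by (cases "t < 0") (auto simp: set_lebesgue_integral_def algebra_simps)
    show "AE t in lborel. q t * exp (- z * t) = complex_of_real q0 * ?E t + ?I t"
      using AE_lborel_singleton[of 0] by eventually_elim (rule eq)
  qed (use qi si in \<open>auto intro: borel_measurable_integrable\<close>)
  also have "\<dots> = complex_of_real q0 * (1 / z) + (1 / z) * (LINT t|lborel. ?v t)"
    by (subst Bochner_Integration.integral_add)
       (intro integrable_mult_right i laplace_one(1) z, rule i, simp only: integral_mult_right_zero laplace_one(2)[OF z(2)] e)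
  finally show ?thesis using z by (simp add: field_simps)
qed

text \<open>
  Since \<open>d\<close> is bounded, the exponential series may be integrated term by term, which yields a power series with
  infinite radius of convergence.
\<close>

lemma entire_laplace_compact:
  fixes b :: "'a \<Rightarrow> complex" and d :: "'a \<Rightarrow> real"
  assumes b: "integrable M b" and d[measurable]: "d \<in> borel_measurable M" and T: "\<And>r. \<bar>d r\<bar> \<le> T"
  shows "(\<lambda>z. LINT r|M. b r * exp (- z * d r)) holomorphic_on S"
proof -
  define a where "a n = (LINT r|M. b r * ((- complex_of_real (d r)) ^ n /\<^sub>R fact n))" for n
  have [measurable]: "b \<in> borel_measurable M" using b by auto
  have sums: "(\<lambda>n. a n * (z - 0) ^ n) sums (LINT r|M. b r * exp (- z * d r))" for z
  proof -
    let ?f = "\<lambda>n r. b r * ((- z * complex_of_real (d r)) ^ n /\<^sub>R fact n)"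
    have nb: "norm (?f n r) \<le> norm (b r) * ((norm z * T) ^ n /\<^sub>R fact n)" for n r
      using T[of r] by (auto simp: norm_mult norm_power intro!: mult_left_mono power_mono)
    have int: "integrable M (?f n)" for n
    proof (rule Bochner_Integration.integrable_bound)
      show "integrable M (\<lambda>r. norm (b r) * ((norm z * T) ^ n /\<^sub>R fact n))" using b by simp
      show "AE r in M. norm (?f n r) \<le> norm (norm (b r) * ((norm z * T) ^ n /\<^sub>R fact n))"
        by (intro AE_I2) (simp only: real_norm_def, rule order_trans[OF nb abs_ge_self])
    qed measurable
    have "(\<lambda>n. LINT r|M. ?f n r) sums (LINT r|M. (\<Sum>n. ?f n r))"
    proof (rule sums_integral[OF int])
      show "AE r in M. summable (\<lambda>n. norm (?f n r))"
      proof (rule AE_I2, rule summable_comparison_test'[where N=0])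
        fix r
        show "summable (\<lambda>n. norm (b r) * ((norm z * T) ^ n /\<^sub>R fact n))"
          by (intro summable_mult summable_exp_generic)
        show "norm (norm (?f n r)) \<le> norm (b r) * ((norm z * T) ^ n /\<^sub>R fact n)" for n
          using nb by (simp only: real_norm_def abs_norm_cancel)
      qed
      show "summable (\<lambda>n. LINT r|M. norm (?f n r))"
      proof (rule summable_comparison_test'[where N=0])
        show "summable (\<lambda>n. (LINT r|M. norm (b r)) * ((norm z * T) ^ n /\<^sub>R fact n))"
          by (intro summable_mult summable_exp_generic)
        have "(LINT r|M. norm (?f n r)) \<le> (LINT r|M. norm (b r) * ((norm z * T) ^ n /\<^sub>R fact n))" for n
          by (intro integral_mono nb integrable_norm int) (use b in simp)
        then show "norm (LINT r|M. norm (?f n r)) \<le> (LINT r|M. norm (b r)) * ((norm z * T) ^ n /\<^sub>R fact n)" for n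
          by (simp del: norm_scaleR norm_mult)
      qed
    qed
    also have "(\<lambda>n. LINT r|M. ?f n r) = (\<lambda>n. a n * (z - 0) ^ n)"
    proof
      fix n
      have "?f n r = (b r * ((- complex_of_real (d r)) ^ n /\<^sub>R fact n)) * z ^ n" for r
        proof -
        have "(- z * complex_of_real (d r)) ^ n = (- complex_of_real (d r)) ^ n * z ^ n"
          by (simp add: power_mult_distrib[symmetric] mult.commute)
        then show ?thesis by simp
      qed
      then show "(LINT r|M. ?f n r) = a n * (z - 0) ^ n"
        unfolding a_def by (simp only: Bochner_Integration.integral_mult_left_zero diff_zero)
    qed
    also have "(LINT r|M. (\<Sum>n. ?f n r)) = (LINT r|M. b r * exp (- z * d r))"
      unfolding exp_def by (intro Bochner_Integration.integral_cong refl suminf_mult summable_exp_generic)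
    finally show ?thesis .
  qed
  have "(\<lambda>z. LINT r|M. b r * exp (- z * d r)) field_differentiable (at z)" for z
  proof -
    have "(\<lambda>z. LINT r|M. b r * exp (- z * d r)) holomorphic_on ball 0 (norm z + 1)"
      by (rule power_series_holomorphic) (rule sums)
    then show ?thesis by (rule holomorphic_on_imp_differentiable_at) auto
  qed
  then show ?thesis by (auto simp: holomorphic_on_def intro: field_differentiable_at_within)
qed

text \<open>
  The function \<open>exp (- b t) (a + b \<integral>\<^sub>0\<^sup>t u)\<close> has a nonpositive derivative.
\<close>

lemma gronwall_integral:
  fixes u :: "real \<Rightarrow> real"
  assumes cont: "continuous_on {0..} u" and b: "b \<ge> 0"
    and le: "\<And>t. t \<ge> 0 \<Longrightarrow> u t \<le> a + b * integral {0..t} u" and t: "t \<ge> 0"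
  shows "u t \<le> a * exp (b * t)"
proof -
  define v where "v t = exp (- b * t) * (a + b * integral {0..t} u)" for t
  have contt: "continuous_on {0..t} u" using cont by (rule continuous_on_subset) auto
  have "v t \<le> v 0"
  proof (rule DERIV_nonpos_imp_decreasing_open[OF t])
    show "continuous_on {0..t} v"
      unfolding v_def by (intro continuous_intros indefinite_integral_continuous_1 integrable_continuous_real contt)
    fix x assume x: "0 < x" "x < t"
    have "((\<lambda>x. integral {0..x} u) has_real_derivative u x) (at x within {0..t})"
      using contt x by (intro integral_has_real_derivative) auto
    then have "((\<lambda>x. integral {0..x} u) has_real_derivative u x) (at x)"
      using x by (simp add: at_within_Icc_at)
    then have "(v has_real_derivative exp (- b * x) * (b * (u x - (a + b * integral {0..x} u)))) (at x)"
      unfolding v_def by (auto intro!: derivative_eq_intros simp: algebra_simps)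
    moreover have "exp (- b * x) * (b * (u x - (a + b * integral {0..x} u))) \<le> 0"
      using le[of x] x b by (intro mult_nonneg_nonpos) (auto simp: mult_nonneg_nonpos)
    ultimately show "\<exists>y. (v has_real_derivative y) (at x) \<and> y \<le> 0" by blast
  qed
  then have "exp (- b * t) * (a + b * integral {0..t} u) \<le> a" by (simp add: v_def)
  then have "a + b * integral {0..t} u \<le> a * exp (b * t)"
    by (simp add: exp_minus field_simps)
  then show ?thesis using le[OF t] by simp
qed

definition cvec :: "real^'n \<Rightarrow> complex^'n" where "cvec x = (\<chi> i. complex_of_real (x $ i))"

lemma norm_cvec [simp]: "norm (cvec x) = norm x"
  by (simp add: cvec_def norm_vec_def)

lemma bounded_linear_cvec: "bounded_linear cvec"
  by (rule bounded_linear_intro[where K=1]) (simp_all add: cvec_def vec_eq_iff norm_cvec[unfolded cvec_def] complex_eq_iff)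

lemma norm_vector_scalar_mult: "norm (c *s v) = norm c * norm (v :: complex^'n)"
  by (simp add: norm_vec_def norm_mult L2_set_right_distrib)

lemma bounded_bilinear_vector_scalar_mult: "bounded_bilinear ((*s) :: complex \<Rightarrow> complex^'n \<Rightarrow> _)"
proof
  show "\<exists>K. \<forall>c v. norm (c *s (v::complex^'n)) \<le> norm c * norm v * K"
    by (intro exI[of _ 1]) (simp add: norm_vector_scalar_mult)
qed (auto simp: vec_eq_iff algebra_simps)

text \<open>
  The two-sided transform; it is applied to functions that vanish on the negative half-line.
\<close>

definition laplace :: "(real \<Rightarrow> real^'n) \<Rightarrow> complex \<Rightarrow> complex^'n" where
  "laplace u z = (LINT t|lborel. exp (- z * of_real t) *s cvec (u t))"

lemma laplace_integrable:
  assumes "integrable lborel (\<lambda>t. exp (- c * t) *\<^sub>R u t)" "Re z = c"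
  shows "integrable lborel (\<lambda>t. exp (- z * of_real t) *s cvec (u t))"
proof (rule Bochner_Integration.integrable_bound[OF assms(1)])
  have "(\<lambda>t. exp (c * t) *\<^sub>R (exp (- c * t) *\<^sub>R u t)) \<in> borel_measurable borel"
    by (rule borel_measurable_scaleR) (use borel_measurable_integrable[OF assms(1)] in auto)
  moreover have "exp (c * t) *\<^sub>R (exp (- c * t) *\<^sub>R u t) = u t" for t
    unfolding scaleR_scaleR exp_add[symmetric] by simp
  ultimately have [measurable]: "u \<in> borel_measurable borel" by (simp only:)
  show "(\<lambda>t. exp (- z * of_real t) *s cvec (u t)) \<in> borel_measurable lborel"
    by (rule borel_measurable_continuous_Pair[where H="\<lambda>c x. c *s cvec x"])
       (auto intro!: bounded_bilinear.continuous_on[OF bounded_bilinear_vector_scalar_mult]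
         bounded_linear.continuous_on[OF bounded_linear_cvec] continuous_intros)
  show "AE t in lborel. norm (exp (- z * of_real t) *s cvec (u t)) \<le> norm (exp (- c * t) *\<^sub>R u t)"
    using assms(2) by (auto simp: norm_vector_scalar_mult)
qed

lemma laplace_nth:
  fixes z :: complex
  assumes "integrable lborel (\<lambda>t. exp (- c * t) *\<^sub>R u t)" "Re z = c"
  shows "laplace u z $ i = (LINT t|lborel. u t $ i * exp (- z * t))"
  unfolding laplace_def
  by (subst integral_bounded_linear[OF bounded_linear_vec_nth laplace_integrable[OF assms], symmetric])
     (simp add: cvec_def mult.commute)

lemma laplace_diff:
  assumes "integrable lborel (\<lambda>t. exp (- c * t) *\<^sub>R u t)" "integrable lborel (\<lambda>t. exp (- c * t) *\<^sub>R v t)" "Re z = c"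
  shows "laplace (\<lambda>t. u t - v t) z = laplace u z - laplace v z"
  unfolding laplace_def Bochner_Integration.integral_diff[OF laplace_integrable[OF assms(1,3)] laplace_integrable[OF assms(2,3)], symmetric]
  by (simp add: linear_diff[OF bounded_linear.linear[OF bounded_linear_cvec]] vector_ssub_ldistrib)

lemma laplace_vector_integral:
  fixes p q :: "real \<Rightarrow> real^'n" and z :: complex
  assumes p: "integrable lborel (\<lambda>t. exp (- c * t) *\<^sub>R p t)" "\<And>t. t < 0 \<Longrightarrow> p t = 0"
    and pi: "\<And>t. t \<ge> 0 \<Longrightarrow> set_integrable lborel {0..t} p"
    and qi: "integrable lborel (\<lambda>t. exp (- c * t) *\<^sub>R q t)" 
    and q: "\<And>t. t \<ge> 0 \<Longrightarrow> q t = q0 + (LINT s:{0..t}|lborel. p s)" "\<And>t. t < 0 \<Longrightarrow> q t = 0"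
    and c: "Re z = c" "c > 0"
  shows "z *s laplace q z = cvec q0 + laplace p z"
proof (subst vec_eq_iff, intro allI)
  fix i
  have 1: "integrable lborel (\<lambda>t. p t $ i * exp (- c * t))"
    using integrable_bounded_linear[OF bounded_linear_vec_nth p(1), of i] by (simp add: mult.commute)
  have 2: "q t $ i = q0 $ i + (LINT s:{0..t}|lborel. p s $ i)" if "t \<ge> 0" for t
    using q(1)[OF that] integral_bounded_linear[OF bounded_linear_vec_nth pi[OF that, unfolded set_integrable_def], of i]
    by (simp add: set_lebesgue_integral_def)
  have "integrable lborel (\<lambda>t. complex_of_real (q t $ i) * exp (- z * of_real t))"
    using integrable_bounded_linear[OF bounded_linear_vec_nth laplace_integrable[OF qi c(1)], of i]
    by (simp add: cvec_def mult.commute)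
  then show "(z *s laplace q z) $ i = (cvec q0 + laplace p z) $ i"
    using laplace_integral[OF 1 _ _ 2 _ c] p(2) q(2)
    by (simp add: laplace_nth[OF qi c(1)] laplace_nth[OF p(1) c(1)] cvec_def)
qed

text \<open>
  A matrix-valued measure of delays in \<open>[0, T]\<close>, given by a density \<open>B\<close> and a delay \<open>d\<close> on an auxiliary space,
  so that discrete and distributed delays are treated at once.
\<close>

locale delay_kernel = sigma_finite_measure M for M :: "'r measure" +
  fixes B :: "'r \<Rightarrow> real^'n^'n" and d :: "'r \<Rightarrow> real" and T :: real
  assumes B: "integrable M B" and d[measurable]: "d \<in> borel_measurable M"
    and d_bounds: "\<And>r. 0 \<le> d r" "\<And>r. d r \<le> T"
begin

definition conv :: "(real \<Rightarrow> real^'n) \<Rightarrow> real \<Rightarrow> real^'n" where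
  "conv u t = (LINT r|M. B r *v u (t - d r))"

definition mass :: real where "mass = (LINT r|M. norm (B r))"

definition kernel :: "complex \<Rightarrow> 'r \<Rightarrow> complex^'n^'n" where
  "kernel z r = map_matrix (\<lambda>a. of_real a * exp (- of_real (d r) * z)) (B r)"

definition symbol :: "complex \<Rightarrow> complex^'n^'n" where
  "symbol z = (LINT r|M. kernel z r)"

lemma T_nonneg: "0 \<le> T" using d_bounds[of undefined] by linarith

lemma mass_nonneg: "0 \<le> mass" by (simp add: mass_def)

lemma conv_cong:
  assumes "\<And>s. t - T \<le> s \<Longrightarrow> s \<le> t \<Longrightarrow> u s = v s"
  shows "conv u t = conv v t"
  unfolding conv_def using assms d_bounds by (intro Bochner_Integration.integral_cong refl) (simp add: algebra_simps)

text \<open>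
  The weight \<open>exp (- c t)\<close> is multiplicative, so it can be distributed over \<open>B\<close> and \<open>u\<close>; on \<open>B\<close> it is harmless because the
  delays are bounded.
\<close>

lemma weighted_conv:
  assumes u: "integrable lborel (\<lambda>t. exp (- c * t) *\<^sub>R u t)"
  shows "AE t in lborel. integrable M (\<lambda>r. B r *v u (t - d r))"
    and "integrable lborel (\<lambda>t. exp (- c * t) *\<^sub>R conv u t)"
proof -
  have [measurable]: "B \<in> borel_measurable M" using B by auto
  have Bc: "integrable M (\<lambda>r. exp (- c * d r) *\<^sub>R B r)"
  proof (rule Bochner_Integration.integrable_bound)
    show "integrable M (\<lambda>r. exp (\<bar>c\<bar> * T) * norm (B r))" using B by simp
    have "- c * d r \<le> \<bar>c\<bar> * T" for r
      using d_bounds[of r] by (intro order_trans[OF mult_right_mono[of "-c" "\<bar>c\<bar>"] mult_left_mono]) auto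
    then show "AE r in M. norm (exp (- c * d r) *\<^sub>R B r) \<le> norm (exp (\<bar>c\<bar> * T) * norm (B r))"
      by (intro AE_I2) (auto intro!: mult_right_mono)
  qed measurable
  interpret P: pair_sigma_finite lborel M ..
  have eq: "(exp (- c * d r) *\<^sub>R B r) *v (exp (- c * (t - d r)) *\<^sub>R u (t - d r)) = exp (- c * t) *\<^sub>R (B r *v u (t - d r))" for r t
  proof -
    interpret m: bounded_bilinear "(*v) :: real^'n^'n \<Rightarrow> _" by (rule bounded_bilinear_matrix_vector_mult)
    have "exp (- c * d r) * exp (- c * (t - d r)) = exp (- c * t)" by (simp add: algebra_simps flip: exp_add)
    then show ?thesis by (simp only: m.scaleR_left m.scaleR_right scaleR_scaleR mult.commute)
  qed
  note F = convolution_integral[OF bounded_bilinear_matrix_vector_mult Bc u d, unfolded eq]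
  from P.AE_integrable_fst[OF F(1)]
  show "AE t in lborel. integrable M (\<lambda>r. B r *v u (t - d r))"
  proof eventually_elim
    case (elim t)
    then have "integrable M (\<lambda>r. exp (c * t) *\<^sub>R (exp (- c * t) *\<^sub>R (B r *v u (t - d r))))"
      by (intro impI integrable_scaleR_right[of _ M "\<lambda>r. exp (- c * t) *\<^sub>R (B r *v u (t - d r))"]) simp
    moreover have "exp (c * t) *\<^sub>R (exp (- c * t) *\<^sub>R v) = v" for v :: "real^'n"
      unfolding scaleR_scaleR exp_add[symmetric] by simp
    ultimately show ?case by (simp only:)
  qed
  from P.integrable_fst[OF F(1)]
  show "integrable lborel (\<lambda>t. exp (- c * t) *\<^sub>R conv u t)" by (simp add: conv_def)
qed

lemma conv_integrable:
  assumes u: "integrable lborel u"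
  shows "AE t in lborel. integrable M (\<lambda>r. B r *v u (t - d r))"
    and "integrable lborel (conv u)"
    and "(LINT t|lborel. norm (conv u t)) \<le> mass * (LINT t|lborel. norm (u t))"
proof -
  show 1: "AE t in lborel. integrable M (\<lambda>r. B r *v u (t - d r))" and 2: "integrable lborel (conv u)"
    using weighted_conv[of 0 u] u by auto
  interpret P: pair_sigma_finite lborel M ..
  note F = convolution_integral[OF bounded_bilinear_mult integrable_norm[OF B] integrable_norm[OF u] d]
  have "(LINT t|lborel. norm (conv u t)) \<le> (LINT t|lborel. LINT r|M. norm (B r) * norm (u (t - d r)))"
  proof (rule integral_mono_AE)
    show "AE t in lborel. norm (conv u t) \<le> (LINT r|M. norm (B r) * norm (u (t - d r)))"
      using 1 P.AE_integrable_fst[OF F(1)]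
    proof eventually_elim
      case (elim t)
      have "norm (conv u t) \<le> (LINT r|M. norm (B r *v u (t - d r)))" unfolding conv_def by (rule integral_norm_bound)
      also have "\<dots> \<le> (LINT r|M. norm (B r) * norm (u (t - d r)))"
        using elim by (intro integral_mono norm_matrix_vector_mult_le) auto
      finally show ?case .
    qed
  qed (use 2 P.integrable_fst[OF F(1)] in auto)
  then show "(LINT t|lborel. norm (conv u t)) \<le> mass * (LINT t|lborel. norm (u t))"
    using F(2) by (simp add: mass_def)
qed

lemma norm_kernel: "norm (kernel z r) = exp (- d r * Re z) * norm (B r)"
  by (simp add: kernel_def norm_vec_def norm_mult map_matrix_def mult.commute[of _ "exp _"] flip: L2_set_right_distrib)

lemma kernel_integrable: "integrable M (kernel z)"
  and norm_symbol_le: "- \<nu> \<le> Re z \<Longrightarrow> 0 \<le> \<nu> \<Longrightarrow> norm (symbol z) \<le> mass * exp (\<nu> * T)"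
proof -
  have [measurable]: "B \<in> borel_measurable M" using B by auto
  have le: "norm (kernel z r) \<le> exp (\<nu> * T) * norm (B r)" if "- \<nu> \<le> Re z" "0 \<le> \<nu>" for r \<nu>
  proof -
    have "- d r * Re z \<le> d r * \<nu>" using that d_bounds[of r] mult_left_mono[of "-\<nu>" "Re z" "d r"] by simp
    also have "\<dots> \<le> \<nu> * T" using that d_bounds[of r] mult_left_mono[of "d r" T \<nu>] by (simp add: mult.commute)
    finally show ?thesis unfolding norm_kernel by (intro mult_right_mono) auto
  qed
  show *: "integrable M (kernel z)"
  proof (rule Bochner_Integration.integrable_bound)
    show "integrable M (\<lambda>r. exp (\<bar>Re z\<bar> * T) * norm (B r))" using B by simp
    show "AE r in M. norm (kernel z r) \<le> norm (exp (\<bar>Re z\<bar> * T) * norm (B r))"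
      using le[of "\<bar>Re z\<bar>"] by (intro AE_I2) auto
    show "kernel z \<in> borel_measurable M" unfolding kernel_def[abs_def] map_matrix_def
      by (rule borel_measurable_continuous_Pair[where H="\<lambda>x A. \<chi> i j. of_real (A $ i $ j) * exp (- of_real x * z)"])
         (auto intro!: continuous_intros continuous_on_vec_lambda)
  qed
  show "norm (symbol z) \<le> mass * exp (\<nu> * T)" if "- \<nu> \<le> Re z" "0 \<le> \<nu>"
  proof -
    have "norm (symbol z) \<le> (LINT r|M. norm (kernel z r))" unfolding symbol_def by (rule integral_norm_bound)
    also have "\<dots> \<le> (LINT r|M. exp (\<nu> * T) * norm (B r))"
      by (intro integral_mono le that integrable_norm * ) (use B in simp)
    finally show ?thesis by (simp add: mass_def mult.commute)
  qed
qed

lemma symbol_nth: "symbol z $ i $ j = (LINT r|M. of_real (B r $ i $ j) * exp (- z * d r))"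
proof -
  have "symbol z $ i $ j = (LINT r|M. kernel z r $ i $ j)"
    unfolding symbol_def
    using integral_bounded_linear[OF bounded_linear_compose[OF bounded_linear_vec_nth bounded_linear_vec_nth] kernel_integrable[of z], of i j]
    by simp
  then show ?thesis by (simp add: kernel_def mult.commute)
qed

lemma symbol_holomorphic: "(\<lambda>z. symbol z $ i $ j) holomorphic_on S"
  unfolding symbol_nth
proof (rule entire_laplace_compact[where T=T])
  have "integrable M (\<lambda>r. B r $ i $ j)"
    using integrable_bounded_linear[OF bounded_linear_compose[OF bounded_linear_vec_nth bounded_linear_vec_nth] B] by simp
  then show "integrable M (\<lambda>r. complex_of_real (B r $ i $ j))" by simp
qed (use d_bounds in auto)

lemma laplace_conv:
  assumes u: "integrable lborel (\<lambda>t. exp (- c * t) *\<^sub>R u t)" and c: "Re z = c"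
  shows "laplace (conv u) z = symbol z *v laplace u z"
proof -
  interpret P: pair_sigma_finite lborel M ..
  note w = weighted_conv[OF u]
  note F = convolution_integral[OF bounded_bilinear_matrix_vector_mult kernel_integrable[of z] laplace_integrable[OF u c] d]
  have eq: "kernel z r *v (exp (- z * of_real (t - d r)) *s cvec v) = exp (- z * of_real t) *s cvec (B r *v v)" for r t v
  proof -
    have "exp (- of_real (d r) * z) * exp (- z * of_real (t - d r)) = exp (- z * of_real t)"
      by (simp add: algebra_simps flip: exp_add)
    then show ?thesis
      by (simp add: vec_eq_iff kernel_def cvec_def matrix_vector_mult_def sum_distrib_left mult_ac)
  qed
  have bl: "bounded_linear (\<lambda>x. a *s cvec x)" for a
    by (intro bounded_linear_compose[OF bounded_bilinear.bounded_linear_right[OF bounded_bilinear_vector_scalar_mult] bounded_linear_cvec])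
  have "laplace (conv u) z = (LINT t|lborel. LINT r|M. kernel z r *v (exp (- z * of_real (t - d r)) *s cvec (u (t - d r))))"
    unfolding laplace_def
  proof (rule integral_cong_AE)
    show "AE t in lborel. exp (- z * of_real t) *s cvec (conv u t) = (LINT r|M. kernel z r *v (exp (- z * of_real (t - d r)) *s cvec (u (t - d r))))"
      using w(1)
    proof eventually_elim
      case (elim t)
      show ?case unfolding eq conv_def by (rule integral_bounded_linear[OF bl elim, symmetric])
    qed
  qed (intro borel_measurable_integrable laplace_integrable[OF w(2) c] P.integrable_fst[OF F(1)])+
  also have "\<dots> = symbol z *v laplace u z"
    using F(2) by (simp add: symbol_def laplace_def)
  finally show ?thesis .
qed

end

section \<open>Decay for the Volterra equation\<close>

lemma mat_vector_mult: "mat z *v v = z *s (v :: complex^'n)"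
  by (simp add: vec_eq_iff mat_def matrix_vector_mult_def if_distrib[of "\<lambda>x. x * _"] cong: if_cong)

lemma continuous_on_atLeast:
  fixes h :: "real \<Rightarrow> 'a::topological_space"
  assumes "\<And>R. continuous_on {a..R} h"
  shows "continuous_on {a..} h"
  unfolding continuous_on_eq_continuous_within
proof
  fix x assume "x \<in> {a..}"
  then have "continuous (at x within {a..x+1}) h"
    using assms[of "x+1"] unfolding continuous_on_eq_continuous_within by auto
  moreover have "at x within {a..} = at x within {a..x+1}"
    by (rule at_within_nhd[of _ "{..<x+1}"]) auto
  ultimately show "continuous (at x within {a..}) h" by simp
qed

lemma indicator_exp_integrable: "integrable lborel (\<lambda>t::real. indicator {0..} t * exp (- t))"
proof -
  have "integrable lborel (\<lambda>t::real. indicator {0<..} t * exp (- t))"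
    using integrable_I0i_exp_mscale[of 1] by (simp add: set_integrable_def)
  moreover have "AE t::real in lborel. indicator {0<..} t * exp (- t) = indicator {0..} t * exp (- t)"
    using AE_lborel_singleton[of "0::real"] by eventually_elim (auto simp: indicator_def)
  ultimately show ?thesis
    by (subst integrable_cong_AE[where g="\<lambda>t::real. indicator {0<..} t * exp (- t)"]) (auto elim: eventually_mono)
qed

lemma continuous_on_halfline_measurable:
  fixes x :: "real \<Rightarrow> 'b::real_normed_vector"
  assumes "continuous_on {0..} x" "\<And>t. t < 0 \<Longrightarrow> x t = 0"
  shows "x \<in> borel_measurable borel"
proof -
  have "(\<lambda>t. indicator {0..} t *\<^sub>R x t) \<in> borel_measurable borel"
    by (rule borel_measurable_continuous_on_indicator) (use assms in auto)
  also have "(\<lambda>t. indicator {0..} t *\<^sub>R x t) = x"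
    using assms(2) by (auto simp: fun_eq_iff indicator_def not_le)
  finally show ?thesis .
qed

lemma exp_bounded_integrable:
  fixes x :: "real \<Rightarrow> 'b::{banach, second_countable_topology}"
  assumes "continuous_on {0..} x" "\<And>t. t < 0 \<Longrightarrow> x t = 0"
    and "\<And>t. t \<ge> 0 \<Longrightarrow> norm (x t) \<le> K * exp (b * t)"
  shows "integrable lborel (\<lambda>t. exp (- (b + 1) * t) *\<^sub>R x t)"
proof (rule Bochner_Integration.integrable_bound)
  show "integrable lborel (\<lambda>t::real. K * (indicator {0..} t * exp (- t)))"
    using indicator_exp_integrable by simp
  have [measurable]: "x \<in> borel_measurable borel" using continuous_on_halfline_measurable[OF assms(1,2)] .
  show "(\<lambda>t. exp (- (b + 1) * t) *\<^sub>R x t) \<in> borel_measurable lborel" by measurable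
  have "norm (exp (- (b + 1) * t) *\<^sub>R x t) \<le> norm (K * (indicator {0..} t * exp (- t)))" for t
  proof (cases "t \<ge> 0")
    case True
    then have "norm (exp (- (b + 1) * t) *\<^sub>R x t) \<le> exp (- (b + 1) * t) * (K * exp (b * t))"
      using assms(3)[of t] by simp
    also have "\<dots> = K * exp (- t)" by (simp add: algebra_simps flip: exp_add)
    also have "\<dots> \<le> \<bar>K * exp (- t)\<bar>" by simp
    finally show ?thesis using True by simp
  qed (simp add: assms(2))
  then show "AE t in lborel. norm (exp (- (b + 1) * t) *\<^sub>R x t) \<le> norm (K * (indicator {0..} t * exp (- t)))"
    by simp
qed

lemma halfline_locally_integrable:
  fixes x :: "real \<Rightarrow> 'b::{banach, second_countable_topology}"
  assumes "continuous_on {0..} x" "\<And>t. t < 0 \<Longrightarrow> x t = 0"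
  shows "integrable lborel (\<lambda>s. indicator {..R} s *\<^sub>R x s)"
proof -
  have "set_integrable lborel {0..R} x"
    by (intro borel_integrable_atLeastAtMost' continuous_on_subset[OF assms(1)]) auto
  moreover have "indicator {0..R} s *\<^sub>R x s = indicator {..R} s *\<^sub>R x s" for s
    using assms(2)[of s] by (cases "s < 0") (auto simp: indicator_def)
  ultimately show ?thesis by (simp add: set_integrable_def)
qed

lemma set_integral_bound_integral:
  fixes f :: "real \<Rightarrow> 'b::{banach, second_countable_topology}"
  assumes "integrable lborel f" "A \<in> sets borel"
  shows "norm (LINT s:A|lborel. f s) \<le> (LINT s|lborel. norm (f s))"
proof -
  have "norm (LINT s:A|lborel. f s) \<le> (LINT s|lborel. norm (indicator A s *\<^sub>R f s))"
    unfolding set_lebesgue_integral_def by (rule integral_norm_bound)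
  also have "\<dots> \<le> (LINT s|lborel. norm (f s))"
    using assms by (intro integral_mono integrable_norm integrable_mult_indicator) (auto simp: indicator_def)
  finally show ?thesis .
qed

context delay_kernel begin

text \<open>
  With \<open>K\<close> a bound for the symbol on the half-plane, the term \<open>z v\<close> dominates as soon as \<open>\<bar>z\<bar> > 2 K + 1\<close>.
  For the other \<open>z\<close> the continuous function \<open>\<bar>P z v\<bar>\<close> has a positive minimum over unit vectors \<open>v\<close>.
\<close>

lemma char_lower_bound:
  assumes nu: "\<nu> \<ge> 0" and det: "\<And>z. - \<nu> \<le> Re z \<Longrightarrow> det (mat z + symbol z) \<noteq> 0"
  shows "\<exists>m>0. \<forall>z v. - \<nu> \<le> Re z \<longrightarrow> m * (1 + norm z) * norm v \<le> norm ((mat z + symbol z) *v v)"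
proof -
  define K where "K = mass * exp (\<nu> * T)"
  have K0: "K \<ge> 0" by (simp add: K_def mass_nonneg)
  have P: "(mat z + symbol z) *v v = z *s v + symbol z *v v" for z v
    by (simp add: matrix_vector_mult_add_rdistrib mat_vector_mult)
  define R where "R = 2 * K + 1"
  define S where "S = ({z. - \<nu> \<le> Re z} \<inter> cball 0 R) \<times> (sphere 0 1 :: (complex^'n) set)"
  let ?F = "\<lambda>(z, v). norm ((mat z + symbol z) *v v)"
  have "continuous_on UNIV (\<lambda>z. \<chi> i j. symbol z $ i $ j)"
    by (intro continuous_on_vec_lambda holomorphic_on_imp_continuous_on symbol_holomorphic)
  then have contsym: "continuous_on UNIV symbol" by simp
  have cont: "continuous_on S ?F"
    unfolding P case_prod_beta'
    by (intro continuous_on_norm continuous_on_add continuous_on_fst continuous_on_snd continuous_on_id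
          bounded_bilinear.continuous_on[OF bounded_bilinear_vector_scalar_mult]
          bounded_bilinear.continuous_on[OF bounded_bilinear_matrix_vector_mult]
          continuous_on_compose2[OF contsym]) auto
  have comp: "compact S"
    unfolding S_def by (intro compact_Times closed_Int_compact closed_halfspace_Re_ge compact_cball compact_sphere)
  have "axis undefined 1 \<in> (sphere 0 1 :: (complex^'n) set)" by simp
  then have ne: "(0, axis undefined 1) \<in> S" using nu K0 by (auto simp: S_def R_def)
  obtain s where s: "s \<in> S" "\<And>y. y \<in> S \<Longrightarrow> ?F s \<le> ?F y"
    using continuous_attains_inf[OF comp _ cont] ne by blast
  have pos: "?F s > 0"
  proof -
    obtain z v where zv: "s = (z, v)" by force
    have "(mat z + symbol z) *v v \<noteq> 0"
    proof
      assume 0: "(mat z + symbol z) *v v = 0"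
      have d: "det (mat z + symbol z) \<noteq> 0" using s(1) zv det by (auto simp: S_def)
      have "v = 0" using cramer[OF d, of v 0] cramer[OF d, of 0 0] 0 by simp
      then show False using s(1) zv by (auto simp: S_def)
    qed
    then show ?thesis by (simp add: zv)
  qed
  define m where "m = min (1/4) (?F s / (1 + R))"
  have m4: "m \<le> 1/4" unfolding m_def by (rule min.cobounded1)
  have R: "R > 0" using K0 by (simp add: R_def)
  have "m > 0" using pos R by (simp add: m_def)
  moreover have "m * (1 + norm z) * norm v \<le> norm ((mat z + symbol z) *v v)" if z: "- \<nu> \<le> Re z" for z v
  proof (cases "norm z \<le> R")
    case True
    show ?thesis
    proof (cases "v = 0")
      case False
      let ?u = "v /\<^sub>R norm v"
      interpret m: bounded_bilinear "(*v) :: complex^'n^'n \<Rightarrow> _" by (rule bounded_bilinear_matrix_vector_mult)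
      have "(z, ?u) \<in> S" using True z False by (auto simp: S_def)
      from s(2)[OF this] have "?F s \<le> norm ((mat z + symbol z) *v v) / norm v"
        by (simp add: m.scaleR_right divide_inverse_commute)
      then have "?F s * norm v \<le> norm ((mat z + symbol z) *v v)" using False by (simp add: le_divide_eq)
      moreover have "m * (1 + norm z) \<le> ?F s / (1 + R) * (1 + R)"
        using True R pos by (intro mult_mono) (auto simp: m_def)
      then have "m * (1 + norm z) \<le> ?F s" using R by simp
      ultimately show ?thesis using mult_right_mono[of "m * (1 + norm z)" "?F s" "norm v"] by simp
    qed simp
  next
    case False
    have "norm (symbol z *v v) \<le> K * norm v"
      using norm_matrix_vector_mult_le[of "symbol z" v] norm_symbol_le[OF z nu] mult_right_mono[of "norm (symbol z)" K "norm v"]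
      by (simp add: K_def)
    moreover have "norm (z *s v) - norm (symbol z *v v) \<le> norm ((mat z + symbol z) *v v)"
      unfolding P by (rule norm_diff_ineq)
    moreover have "m * (1 + norm z) * norm v \<le> (norm z - K) * norm v"
    proof (rule mult_right_mono)
      have "m * (1 + norm z) \<le> 1/4 * (1 + norm z)" by (rule mult_right_mono[OF m4]) simp
      also have "\<dots> \<le> norm z - K" using False K0 by (simp add: R_def not_le field_simps)
      finally show "m * (1 + norm z) \<le> norm z - K" .
    qed simp
    ultimately show ?thesis by (simp add: norm_vector_scalar_mult left_diff_distrib)
  qed
  ultimately show ?thesis by blast
qed

text \<open>
  On \<open>{a..b}\<close> only the values of \<open>u\<close> on \<open>{a - T..b}\<close> enter, so the global convolution estimate applies to \<open>u\<close>
  cut off outside this interval.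
\<close>

lemma conv_local:
  assumes u: "\<And>R. integrable lborel (\<lambda>s. indicator {..R} s *\<^sub>R u s)"
  shows "AE t in lborel. integrable M (\<lambda>r. B r *v u (t - d r))"
    and "set_integrable lborel {a..b} (conv u)"
    and "(LINT s:{a..b}|lborel. norm (conv u s)) \<le> mass * (LINT s:{a - T..b}|lborel. norm (u s))"
proof -
  have "AE t in lborel. \<forall>R::nat. integrable M (\<lambda>r. B r *v (indicator {..real R} (t - d r) *\<^sub>R u (t - d r)))"
    unfolding AE_all_countable using conv_integrable(1)[OF u] by blast
  then show "AE t in lborel. integrable M (\<lambda>r. B r *v u (t - d r))"
  proof eventually_elim
    case (elim t)
    obtain R :: nat where R: "t \<le> R" using real_arch_simple by blast
    have "indicator {..real R} (t - d r) *\<^sub>R u (t - d r) = u (t - d r)" for r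
      using R d_bounds(1)[of r] by (auto simp: indicator_def)
    then show ?case using elim[rule_format, of R] by simp
  qed
  let ?u = "\<lambda>s. indicator {a - T..b} s *\<^sub>R u s"
  have "integrable lborel (\<lambda>s. indicator {a - T..} s *\<^sub>R (indicator {..b} s *\<^sub>R u s))"
    by (rule integrable_mult_indicator[OF _ u]) simp
  also have "(\<lambda>s. indicator {a - T..} s *\<^sub>R (indicator {..b} s *\<^sub>R u s)) = ?u" by (auto simp: indicator_def)
  finally have ui: "integrable lborel ?u" .
  note c = conv_integrable[OF ui]
  have eq: "conv u s = conv ?u s" if "s \<in> {a..b}" for s
    by (rule conv_cong) (use that in \<open>auto simp: indicator_def\<close>)
  have "set_integrable lborel {a..b} (conv ?u)"
    using c(2) by (rule integrable_mult_indicator[folded set_integrable_def, rotated]) simp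
  moreover have "(\<lambda>s. indicator {a..b} s *\<^sub>R conv ?u s) = (\<lambda>s. indicator {a..b} s *\<^sub>R conv u s)"
    using eq by (auto simp: fun_eq_iff indicator_def)
  ultimately show si: "set_integrable lborel {a..b} (conv u)" by (simp add: set_integrable_def)
  have "(LINT s:{a..b}|lborel. norm (conv u s)) \<le> (LINT s|lborel. norm (conv ?u s))"
    unfolding set_lebesgue_integral_def
  proof (rule integral_mono)
    show "integrable lborel (\<lambda>s. indicator {a..b} s *\<^sub>R norm (conv u s))"
      using set_integrable_norm[OF si] by (simp add: set_integrable_def)
    show "indicator {a..b} s *\<^sub>R norm (conv u s) \<le> norm (conv ?u s)" for s
      using eq[of s] by (auto simp: indicator_def)
  qed (use c(2) in auto)
  also note c(3)
  finally show "(LINT s:{a..b}|lborel. norm (conv u s)) \<le> mass * (LINT s:{a - T..b}|lborel. norm (u s))"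
    by (simp add: set_lebesgue_integral_def)
qed

lemma conv_bound_Icc:
  assumes x: "continuous_on {0..} x" "\<And>t. t < 0 \<Longrightarrow> x t = 0"
  shows "set_integrable lborel {0..t} (conv x)"
    and "(LINT s:{0..t}|lborel. norm (conv x s)) \<le> mass * (LINT s:{0..t}|lborel. norm (x s))"
proof -
  note xi = halfline_locally_integrable[OF x]
  show "set_integrable lborel {0..t} (conv x)" by (rule conv_local(2)[OF xi])
  have "(LINT s:{0 - T..t}|lborel. norm (x s)) = (LINT s:{0..t}|lborel. norm (x s))"
    unfolding set_lebesgue_integral_def
  proof (intro Bochner_Integration.integral_cong refl)
    fix s show "indicator {0 - T..t} s *\<^sub>R norm (x s) = indicator {0..t} s *\<^sub>R norm (x s)"
      using x(2)[of s] T_nonneg by (cases "s < 0") (auto simp: indicator_def)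
  qed
  then show "(LINT s:{0..t}|lborel. norm (conv x s)) \<le> mass * (LINT s:{0..t}|lborel. norm (x s))"
    using conv_local(3)[OF xi, of 0 t] by simp
qed

text \<open>
  Gronwall's inequality gives this crude a priori bound, by which the Laplace transform of \<open>x\<close> exists far to the right.
\<close>

lemma solution_exp_bound:
  assumes f: "integrable lborel f"
    and x: "continuous_on {0..} x" "\<And>t. t < 0 \<Longrightarrow> x t = 0"
    and eq: "\<And>t. t \<ge> 0 \<Longrightarrow> x t = x0 + (LINT s:{0..t}|lborel. f s - conv x s)"
    and t: "t \<ge> 0"
  shows "norm (x t) \<le> (norm x0 + (LINT s|lborel. norm (f s))) * exp (mass * t)"
proof (rule gronwall_integral[OF _ mass_nonneg _ t])
  show "continuous_on {0..} (\<lambda>t. norm (x t))" by (intro continuous_intros x)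
  fix t :: real assume t: "t \<ge> 0"
  have fi: "set_integrable lborel {0..t} f"
    using f by (rule integrable_mult_indicator[folded set_integrable_def, rotated]) simp
  note c = conv_bound_Icc[OF x, of t]
  have "norm (x t) \<le> norm x0 + (norm (LINT s:{0..t}|lborel. f s) + norm (LINT s:{0..t}|lborel. conv x s))"
  proof -
    have "(LINT s:{0..t}|lborel. f s - conv x s) = (LINT s:{0..t}|lborel. f s) - (LINT s:{0..t}|lborel. conv x s)"
      by (rule set_integral_diff(2)[OF fi c(1)])
    then show ?thesis
      unfolding eq[OF t] by (simp only:) (intro order_trans[OF norm_triangle_ineq] add_left_mono norm_triangle_ineq4)
  qed
  moreover have "norm (LINT s:{0..t}|lborel. conv x s) \<le> mass * (LINT s:{0..t}|lborel. norm (x s))"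
    using set_integral_norm_bound[OF c(1)] c(2) by linarith
  moreover have "(LINT s:{0..t}|lborel. norm (x s)) = integral {0..t} (\<lambda>t. norm (x t))"
  proof (rule set_borel_integral_eq_integral)
    show "set_integrable lborel {0..t} (\<lambda>t. norm (x t))"
      by (intro borel_integrable_atLeastAtMost' continuous_on_norm continuous_on_subset[OF x(1)]) auto
  qed
  ultimately show "norm (x t) \<le> norm x0 + (LINT s|lborel. norm (f s)) + mass * integral {0..t} (\<lambda>t. norm (x t))"
    using set_integral_bound_integral[OF f, of "{0..t}"] by simp
qed

end

context delay_kernel begin

lemma laplace_source_holomorphic:
  fixes f :: "real \<Rightarrow> real^'n"
  assumes f: "integrable lborel f" and supp: "\<And>t. t \<notin> {0..T} \<Longrightarrow> f t = 0"
  shows "(\<lambda>z. LINT t|lborel. of_real (f t $ i) * exp (- z * of_real t)) holomorphic_on S"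
proof -
  have "(\<lambda>z. LINT t|lborel. of_real (f t $ i) * exp (- z * of_real (max 0 (min T t)))) holomorphic_on S"
    using T_nonneg integrable_bounded_linear[OF bounded_linear_vec_nth f]
    by (intro entire_laplace_compact[where T=T]) auto
  also have "(\<lambda>z. LINT t|lborel. complex_of_real (f t $ i) * exp (- z * of_real (max 0 (min T t))))
     = (\<lambda>z. LINT t|lborel. of_real (f t $ i) * exp (- z * of_real t))"
  proof (intro ext Bochner_Integration.integral_cong refl)
    fix z :: complex and t :: real
    show "complex_of_real (f t $ i) * exp (- z * of_real (max 0 (min T t))) = of_real (f t $ i) * exp (- z * of_real t)"
      using supp[of t] by (cases "t \<in> {0..T}") auto
  qed
  finally show ?thesis .
qed

lemma exp_weight_source:
  fixes f :: "real \<Rightarrow> real^'n"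
  assumes f: "integrable lborel f" and supp: "\<And>t. t \<notin> {0..T} \<Longrightarrow> f t = 0"
  shows "integrable lborel (\<lambda>t. exp (a * t) *\<^sub>R f t)"
    and "0 \<le> a \<Longrightarrow> (LINT t|lborel. norm (exp (a * t) *\<^sub>R f t)) \<le> exp (a * T) * (LINT t|lborel. norm (f t))"
proof -
  have le: "norm (exp (a * t) *\<^sub>R f t) \<le> exp (\<bar>a\<bar> * T) * norm (f t)" for t
  proof (cases "t \<in> {0..T}")
    case True
    then have "a * t \<le> \<bar>a\<bar> * T" by (intro order_trans[OF mult_right_mono[of a "\<bar>a\<bar>"] mult_left_mono]) auto
    then show ?thesis by (auto intro!: mult_right_mono)
  qed (simp add: supp)
  have [measurable]: "f \<in> borel_measurable borel" using f by auto
  show i: "integrable lborel (\<lambda>t. exp (a * t) *\<^sub>R f t)"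
  proof (rule Bochner_Integration.integrable_bound)
    show "integrable lborel (\<lambda>t. exp (\<bar>a\<bar> * T) * norm (f t))" using f by simp
    show "AE t in lborel. norm (exp (a * t) *\<^sub>R f t) \<le> norm (exp (\<bar>a\<bar> * T) * norm (f t))"
      using le by (intro AE_I2) simp
  qed measurable
  assume "0 \<le> a"
  have "(LINT t|lborel. norm (exp (a * t) *\<^sub>R f t)) \<le> (LINT t|lborel. exp (\<bar>a\<bar> * T) * norm (f t))"
    by (intro integral_mono le integrable_norm i) (use f in simp)
  then show "(LINT t|lborel. norm (exp (a * t) *\<^sub>R f t)) \<le> exp (a * T) * (LINT t|lborel. norm (f t))"
    using \<open>0 \<le> a\<close> by simp
qed


text \<open>
  The solution of \<open>g' = - a g + f\<close>, \<open>g 0 = x0\<close>, extended by \<open>0\<close> to negative times.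
\<close>

definition relax :: "real \<Rightarrow> real^'n \<Rightarrow> (real \<Rightarrow> real^'n) \<Rightarrow> real \<Rightarrow> real^'n" where
  "relax a x0 f t = (if t < 0 then 0 else exp (- a * t) *\<^sub>R (x0 + (LINT s:{0..t}|lborel. exp (a * s) *\<^sub>R f s)))"

lemma relax_bound:
  fixes f :: "real \<Rightarrow> real^'n"
  assumes f: "integrable lborel f" and supp: "\<And>t. t \<notin> {0..T} \<Longrightarrow> f t = 0" and "0 \<le> a"
  shows "norm (relax a x0 f t) \<le> exp (a * T) * exp (- a * t) * (norm x0 + (LINT t|lborel. norm (f t)))"
proof (cases "t < 0")
  case False
  note e = exp_weight_source[OF f supp, of a]
  have "norm (x0 + (LINT s:{0..t}|lborel. exp (a * s) *\<^sub>R f s)) \<le> norm x0 + exp (a * T) * (LINT t|lborel. norm (f t))"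
    using set_integral_bound_integral[OF e(1), of "{0..t}"] e(2) \<open>0 \<le> a\<close>
    by (intro order_trans[OF norm_triangle_ineq] add_left_mono) auto
  also have "\<dots> \<le> exp (a * T) * (norm x0 + (LINT t|lborel. norm (f t)))"
    using \<open>0 \<le> a\<close> T_nonneg mult_right_mono[of 1 "exp (a * T)" "norm x0"] by (simp add: distrib_left)
  finally show ?thesis
    using False mult_left_mono[of _ _ "exp (- a * t)"] by (fastforce simp: relax_def mult_ac)
qed (simp add: relax_def)

lemma relax_continuous:
  fixes f :: "real \<Rightarrow> real^'n"
  assumes f: "integrable lborel f" and supp: "\<And>t. t \<notin> {0..T} \<Longrightarrow> f t = 0"
  shows "continuous_on {0..} (relax a x0 f)"
proof -
  have "continuous_on {0..} (\<lambda>t. exp (- a * t) *\<^sub>R (x0 + (LINT s:{0..t}|lborel. exp (a * s) *\<^sub>R f s)))"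
  proof (rule continuous_on_atLeast)
    fix R :: real
    have "set_integrable lborel {0..R} (\<lambda>s. exp (a * s) *\<^sub>R f s)"
      by (intro integrable_mult_indicator[folded set_integrable_def] exp_weight_source f supp) auto
    moreover from this have "set_integrable lborel {0..t} (\<lambda>s. exp (a * s) *\<^sub>R f s)" if "t \<in> {0..R}" for t
      by (rule set_integrable_subset) (use that in auto)
    ultimately have "continuous_on {0..R} (\<lambda>t. LINT s:{0..t}|lborel. exp (a * s) *\<^sub>R f s)"
      using indefinite_integral_continuous_1[of "\<lambda>s. exp (a * s) *\<^sub>R f s" 0 R] set_borel_integral_eq_integral
      by (subst continuous_on_cong[OF refl set_borel_integral_eq_integral(2)]) auto
    then show "continuous_on {0..R} (\<lambda>t. exp (- a * t) *\<^sub>R (x0 + (LINT s:{0..t}|lborel. exp (a * s) *\<^sub>R f s)))"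
      by (intro continuous_intros)
  qed
  then show ?thesis by (rule continuous_on_eq) (auto simp: relax_def)
qed

text \<open>
  The function \<open>exp (a t) g t\<close> is an antiderivative of \<open>exp (a t) f t\<close>, and its transform at \<open>z + a\<close> is the
  transform of \<open>g\<close> at \<open>z\<close>.
\<close>

lemma relax_laplace:
  fixes f :: "real \<Rightarrow> real^'n"
  assumes f: "integrable lborel f" and supp: "\<And>t. t \<notin> {0..T} \<Longrightarrow> f t = 0"
    and z: "Re z = c" "1 \<le> c" "0 \<le> a"
  shows "integrable lborel (\<lambda>t. exp (- c * t) *\<^sub>R relax a x0 f t)"
    and "(z + of_real a) *s laplace (relax a x0 f) z = cvec x0 + laplace f z"
proof -
  let ?D = "norm x0 + (LINT t|lborel. norm (f t))"
  have ind: "relax a x0 f t = 0" if "t < 0" for t using that by (simp add: relax_def)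
  have bd: "norm (relax a x0 f t) \<le> exp (a * T) * ?D * exp ((-a) * t)" for t
    using relax_bound[OF f supp z(3), of x0 t] by (simp add: mult_ac)
  have bd2: "norm (relax a x0 f t) \<le> exp (a * T) * ?D * exp ((c - 1) * t)" if "t \<ge> 0" for t
  proof -
    have "(- a) * t \<le> (c - 1) * t" using z that by (intro mult_right_mono) auto
    then show ?thesis by (intro order_trans[OF bd mult_left_mono]) auto
  qed
  show i: "integrable lborel (\<lambda>t. exp (- c * t) *\<^sub>R relax a x0 f t)"
    using exp_bounded_integrable[OF relax_continuous[OF f supp] ind bd2] by simp
  let ?u = "\<lambda>t. exp (a * t) *\<^sub>R relax a x0 f t" and ?p = "\<lambda>t. exp (a * t) *\<^sub>R f t"
  have lap: "laplace (\<lambda>t. exp (a * t) *\<^sub>R v t) (z + of_real a) = laplace v z" for v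
  proof -
    have "exp (- (z + of_real a) * of_real t) *s cvec (exp (a * t) *\<^sub>R v t) = exp (- z * of_real t) *s cvec (v t)" for t
    proof -
      have "exp (- (z + of_real a) * of_real t) * of_real (exp (a * t)) = exp (- z * of_real t)"
        by (simp add: algebra_simps flip: exp_add exp_of_real)
      then show ?thesis by (simp add: vec_eq_iff cvec_def mult.assoc[symmetric])
    qed
    then show ?thesis unfolding laplace_def by simp
  qed
  have sc: "exp (- (c + a) * t) *\<^sub>R exp (a * t) *\<^sub>R v = exp (- c * t) *\<^sub>R v" for t and v :: "real^'n"
    unfolding scaleR_scaleR exp_add[symmetric] by (simp add: algebra_simps)
  have "(z + of_real a) *s laplace ?u (z + of_real a) = cvec x0 + laplace ?p (z + of_real a)"
  proof (rule laplace_vector_integral[where c="c + a"])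
    show "integrable lborel (\<lambda>t. exp (- (c + a) * t) *\<^sub>R ?p t)"
      unfolding sc by (rule exp_weight_source(1)[OF f supp])
    show "set_integrable lborel {0..t} ?p" for t
      by (intro integrable_mult_indicator[folded set_integrable_def] exp_weight_source f supp) auto
    show "integrable lborel (\<lambda>t. exp (- (c + a) * t) *\<^sub>R ?u t)" unfolding sc by (rule i)
    show "?u t = x0 + (LINT s:{0..t}|lborel. ?p s)" if "0 \<le> t" for t
      using that by (simp add: relax_def flip: exp_add)
  qed (use z supp ind in auto)
  then show "(z + of_real a) *s laplace (relax a x0 f) z = cvec x0 + laplace f z" unfolding lap .
qed

text \<open>
  The difference \<open>w = x - g\<close>, where \<open>g\<close> is \<open>relax a x0 f\<close> with \<open>a = \<nu> + 1\<close>, has a transform \<open>w^\<close> with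
  \<open>P z (w^ z) = (a - symbol z) (x0 + f^ z) / (z + a)\<close>.  Cramer's rule displays the solution of this linear system as a
  holomorphic function on the half-plane, and the lower bound for \<open>P\<close> makes it \<open>O(1/\<bar>z\<bar>\<^sup>2)\<close>, so that
  the inversion bound applies to each component of \<open>w\<close>.
\<close>

theorem volterra_decay:
  assumes nu: "\<nu> \<ge> 0" and det: "\<And>z. - \<nu> \<le> Re z \<Longrightarrow> det (mat z + symbol z) \<noteq> 0"
  shows "\<exists>C\<ge>0. \<forall>f x x0 t. integrable lborel f \<longrightarrow> (\<forall>t. t \<notin> {0..T} \<longrightarrow> f t = 0) \<longrightarrow>
      continuous_on {0..} x \<longrightarrow> (\<forall>t<0. x t = 0) \<longrightarrow>
      (\<forall>t\<ge>0. x t = x0 + (LINT s:{0..t}|lborel. f s - conv x s)) \<longrightarrow> 0 \<le> t \<longrightarrow>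
      norm (x t) \<le> C * exp (- \<nu> * t) * (norm x0 + (LINT s|lborel. norm (f s)))"
proof -
  obtain m where m: "m > 0" "\<And>z v. - \<nu> \<le> Re z \<Longrightarrow> m * (1 + norm z) * norm v \<le> norm ((mat z + symbol z) *v v)"
    using char_lower_bound[OF nu det] by blast
  define K where "K = mass * exp (\<nu> * T)"
  have K: "K \<ge> 0" by (simp add: K_def mass_nonneg)
  define a where "a = \<nu> + 1"
  define E where "E = 2 * (a + K) * exp (\<nu> * T) / m"
  define C where "C = CARD('n) * (E / 2) + exp (a * T)"
  have a: "a \<ge> 0" using nu by (simp add: a_def)
  have E: "E \<ge> 0" using a K m by (simp add: E_def)
  have "C \<ge> 0" using E by (simp add: C_def)
  moreover have "norm (x t) \<le> C * exp (- \<nu> * t) * (norm x0 + (LINT s|lborel. norm (f s)))"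
    if f: "integrable lborel f" and supp: "\<forall>t. t \<notin> {0..T} \<longrightarrow> f t = 0"
      and x: "continuous_on {0..} x" and x_neg: "\<forall>t<0. x t = 0"
      and eq: "\<forall>t\<ge>0. x t = x0 + (LINT s:{0..t}|lborel. f s - conv x s)" and t: "0 \<le> t"
    for f x x0 t
  proof -
    define D where "D = norm x0 + (LINT s|lborel. norm (f s))"
    have D: "D \<ge> 0" by (simp add: D_def)
    have supp': "\<And>t. t \<notin> {0..T} \<Longrightarrow> f t = 0" and x_neg': "\<And>t. t < 0 \<Longrightarrow> x t = 0"
      and eq': "\<And>t. t \<ge> 0 \<Longrightarrow> x t = x0 + (LINT s:{0..t}|lborel. f s - conv x s)"
      using supp x_neg eq by auto
    define g where "g = relax a x0 f"
    define w where "w = (\<lambda>t. x t - g t)"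
    \<comment> \<open>right of the exponential bound for \<open>x\<close>, so that all transforms exist on the line \<open>Re z = c\<close>\<close>
    define c where "c = mass + 1"
    have c1: "1 \<le> c" using mass_nonneg by (simp add: c_def)
    have c: "c > 0" "mass < c" "- \<nu> < c" using mass_nonneg nu by (auto simp: c_def)
    have xb: "norm (x t) \<le> D * exp (mass * t)" if "t \<ge> 0" for t
      unfolding D_def by (rule solution_exp_bound[OF f x x_neg' eq' that])
    have gb: "norm (g t) \<le> exp (a * T) * exp (- a * t) * D" for t
      unfolding g_def D_def by (rule relax_bound[OF f supp' a])
    have xi: "integrable lborel (\<lambda>t. exp (- c * t) *\<^sub>R x t)"
      unfolding c_def by (rule exp_bounded_integrable[OF x x_neg' xb])
    have gi: "integrable lborel (\<lambda>t. exp (- c * t) *\<^sub>R g t)"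
      unfolding g_def by (rule relax_laplace(1)[where z="of_real c", OF f supp' _ _ a]) (use c1 in auto)
    have fi: "integrable lborel (\<lambda>t. exp (- c * t) *\<^sub>R f t)"
      by (rule exp_weight_source(1)[OF f supp'])
    have ci: "integrable lborel (\<lambda>t. exp (- c * t) *\<^sub>R conv x t)" by (rule weighted_conv(2)[OF xi])
    have conv_neg: "conv x t = 0" if "t < 0" for t
      using that x_neg' d_bounds by (simp add: conv_def less_le_trans[OF that])
    have lap_x: "(mat z + symbol z) *v laplace x z = cvec x0 + laplace f z" if "Re z = c" for z
    proof -
      have "z *s laplace x z = cvec x0 + laplace (\<lambda>s. f s - conv x s) z"
      proof (rule laplace_vector_integral[OF _ _ _ xi eq' x_neg' that c(1)])
        show "integrable lborel (\<lambda>t. exp (- c * t) *\<^sub>R (f t - conv x t))"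
          using Bochner_Integration.integrable_diff[OF fi ci] by (simp add: scaleR_diff_right)
        show "f t - conv x t = 0" if "t < 0" for t using that supp' conv_neg by simp
        show "set_integrable lborel {0..t} (\<lambda>t. f t - conv x t)" if "t \<ge> 0" for t
          by (intro set_integral_diff(1) integrable_mult_indicator[folded set_integrable_def] f conv_bound_Icc(1)[OF x x_neg']) auto
      qed
      then show ?thesis
        unfolding laplace_diff[OF fi ci that] laplace_conv[OF xi that]
        by (simp add: matrix_vector_mult_add_rdistrib mat_vector_mult algebra_simps)
    qed
    define Q where "Q z = (1 / (z + of_real a)) *s (of_real a *s (cvec x0 + laplace f z) - symbol z *v (cvec x0 + laplace f z))" for z
    have za: "z + of_real a \<noteq> 0" "1 \<le> norm (z + of_real a)" "\<bar>Im z\<bar> \<le> norm (z + of_real a)" if "- \<nu> \<le> Re z" for z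
    proof -
      show "\<bar>Im z\<bar> \<le> norm (z + of_real a)" using abs_Im_le_cmod[of "z + of_real a"] by simp
      show "1 \<le> norm (z + of_real a)" using abs_Re_le_cmod[of "z + of_real a"] that by (simp add: a_def)
      then show "z + of_real a \<noteq> 0" by (metis norm_zero not_one_le_zero)
    qed
    have lap_w: "(mat z + symbol z) *v laplace w z = Q z" if z: "Re z = c" for z
    proof -
      have zn: "- \<nu> \<le> Re z" using z c by simp
      have r: "(z + of_real a) *s laplace g z = cvec x0 + laplace f z"
        unfolding g_def by (rule relax_laplace(2)[OF f _ z c1 a]) (rule supp')
      interpret s: bounded_bilinear "(*v) :: complex^'n^'n \<Rightarrow> _" by (rule bounded_bilinear_matrix_vector_mult)
      have g: "laplace g z = (1 / (z + of_real a)) *s (cvec x0 + laplace f z)"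
      proof -
        have "laplace g z = (1 / (z + of_real a)) *s ((z + of_real a) *s laplace g z)"
          using za(1)[OF zn] unfolding vector_smult_assoc by simp
        then show ?thesis by (simp only: r)
      qed
      have sm: "symbol z *v (k *s v) = k *s (symbol z *v v)" for k v
        by (simp add: vec_eq_iff matrix_vector_mult_def sum_distrib_left mult_ac)
      have "(mat z + symbol z) *v laplace w z = (cvec x0 + laplace f z) - (z *s laplace g z + symbol z *v laplace g z)"
        unfolding w_def laplace_diff[OF xi gi z] s.diff_right lap_x[OF z]
        by (simp add: matrix_vector_mult_add_rdistrib mat_vector_mult)
      also have "\<dots> = Q z"
      proof -
        define F where "F = cvec x0 + laplace f z"
        have "Fi - (z * (1 / (z + of_real a) * Fi) + 1 / (z + of_real a) * Si) = 1 / (z + of_real a) * (of_real a * Fi - Si)" for Fi Si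
        proof -
          define y where "y = z + of_real a"
          have y: "y \<noteq> 0" using za(1)[OF zn] by (simp add: y_def)
          have z: "z = y - of_real a" by (simp add: y_def)
          show ?thesis unfolding z using y by (simp add: field_simps)
        qed
        then show ?thesis unfolding g sm Q_def F_def[symmetric] by (simp add: vec_eq_iff diff_divide_distrib)
      qed
      finally show ?thesis .
    qed
    have F_bound: "norm (cvec x0 + laplace f z) \<le> exp (\<nu> * T) * D" if z: "- \<nu> \<le> Re z" for z
    proof -
      have "norm (laplace f z) \<le> (LINT t|lborel. norm (exp (- z * of_real t) *s cvec (f t)))"
        unfolding laplace_def by (rule integral_norm_bound)
      also have "\<dots> \<le> (LINT t|lborel. exp (\<nu> * T) * norm (f t))"
      proof (rule integral_mono)
        show "integrable lborel (\<lambda>t. norm (exp (- z * of_real t) *s cvec (f t)))"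
          by (rule integrable_norm, rule laplace_integrable[OF exp_weight_source(1)[OF f supp'] refl])
        show "norm (exp (- z * of_real t) *s cvec (f t)) \<le> exp (\<nu> * T) * norm (f t)" for t
        proof (cases "t \<in> {0..T}")
          case True
          have "- Re z * t \<le> \<nu> * T"
            using True nu z by (intro order_trans[OF mult_right_mono[of "- Re z" \<nu>] mult_left_mono]) auto
          then show ?thesis by (auto simp: norm_vector_scalar_mult intro!: mult_right_mono)
        qed (use supp' in \<open>simp add: norm_vector_scalar_mult\<close>)
      qed (use f in auto)
      finally have "norm (laplace f z) \<le> exp (\<nu> * T) * (LINT t|lborel. norm (f t))" by simp
      moreover have "norm x0 \<le> exp (\<nu> * T) * norm x0"
        using nu T_nonneg mult_right_mono[of 1 "exp (\<nu> * T)" "norm x0"] by simp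
      ultimately show ?thesis
        by (intro order_trans[OF norm_triangle_ineq]) (simp add: D_def distrib_left)
    qed
    have Q_bound: "norm (Q z) \<le> (a + K) * (exp (\<nu> * T) * D) / norm (z + of_real a)" if z: "- \<nu> \<le> Re z" for z
    proof -
      let ?F = "cvec x0 + laplace f z"
      have "norm (of_real a *s ?F - symbol z *v ?F) \<le> a * norm ?F + K * norm ?F"
      proof (rule order_trans[OF norm_triangle_ineq4 add_mono])
        show "norm (of_real a *s ?F) \<le> a * norm ?F" using a unfolding norm_vector_scalar_mult by simp
        show "norm (symbol z *v ?F) \<le> K * norm ?F"
          using norm_symbol_le[OF z nu]
          by (intro order_trans[OF norm_matrix_vector_mult_le] mult_right_mono) (auto simp: K_def)
      qed
      also have "\<dots> \<le> (a + K) * (exp (\<nu> * T) * D)"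
        unfolding distrib_right[symmetric] using F_bound[OF z] a K by (intro mult_left_mono) auto
      finally show ?thesis
        unfolding Q_def norm_vector_scalar_mult norm_divide norm_one
        by (simp add: divide_right_mono)
    qed
    \<comment> \<open>Cramer's rule for the system \<open>P z v = Q z\<close>, chosen because holomorphy can be read off from it\<close>
    define H where "H z = (\<chi> k. det (\<chi> i j. if j = k then Q z $ i else (mat z + symbol z) $ i $ j) / det (mat z + symbol z))" for z
    have H: "(mat z + symbol z) *v v = Q z \<longleftrightarrow> v = H z" if "- \<nu> \<le> Re z" for z v
      unfolding H_def by (rule cramer[OF det[OF that]])
    have HL: "laplace w z = H z" if "Re z = c" for z
      using H[of z] lap_w[OF that] that c by simp
    have H_bound: "norm (H z) \<le> E * D / (1 + (Im z)\<^sup>2)" if z: "- \<nu> \<le> Re z" for z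
    proof -
      have "m * (1 + norm z) * norm (H z) \<le> (a + K) * (exp (\<nu> * T) * D) / norm (z + of_real a)"
        using m(2)[OF z, of "H z"] H[OF z, of "H z"] Q_bound[OF z] by simp
      moreover have y: "0 < norm (z + of_real a)" using za(2)[OF z] by linarith
      ultimately have le1: "norm (H z) * (norm (z + of_real a) * (1 + norm z)) \<le> (a + K) * (exp (\<nu> * T) * D) / m"
        using m(1) by (simp only: pos_le_divide_eq mult_ac)
      have "(1 + (Im z)\<^sup>2) / 2 \<le> norm (z + of_real a) * (1 + norm z)"
      proof -
        have "1 * 1 \<le> norm (z + of_real a) * (1 + norm z)"
          using za(2)[OF z] by (intro mult_mono) auto
        moreover have "\<bar>Im z\<bar> * \<bar>Im z\<bar> \<le> norm (z + of_real a) * (1 + norm z)"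
          using za(3)[OF z] abs_Im_le_cmod[of z] by (intro mult_mono) auto
        ultimately show ?thesis by (simp add: power2_eq_square)
      qed
      then have "norm (H z) * ((1 + (Im z)\<^sup>2) / 2) \<le> (a + K) * (exp (\<nu> * T) * D) / m"
        by (intro order_trans[OF mult_left_mono le1]) auto
      moreover have "E * D = 2 * ((a + K) * (exp (\<nu> * T) * D) / m)" by (simp add: E_def)
      moreover have "0 < 1 + (Im z)\<^sup>2" by (simp add: add_pos_nonneg)
      ultimately show ?thesis by (simp only: pos_le_divide_eq)
    qed
    have sym_hol: "(\<lambda>z. (mat z + symbol z) $ i $ j) holomorphic_on S" for i j S
      by (cases "i = j") (auto simp: mat_def intro!: holomorphic_intros symbol_holomorphic)
    have lapf_nth: "laplace f z $ i = (LINT t|lborel. of_real (f t $ i) * exp (- z * of_real t))" for z i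
      by (rule laplace_nth[OF exp_weight_source(1)[OF f supp'] refl])
    have lapf_hol: "(\<lambda>z. laplace f z $ i) holomorphic_on S" for i S
      unfolding lapf_nth by (rule laplace_source_holomorphic[OF f supp'])
    have Q_hol: "(\<lambda>z. Q z $ i) holomorphic_on {z. - \<nu> \<le> Re z}" for i
      unfolding Q_def matrix_vector_mult_def using za(1)
      by (auto intro!: holomorphic_intros lapf_hol symbol_holomorphic simp: cvec_def)
    have H_hol: "(\<lambda>z. H z $ k) holomorphic_on {z. - \<nu> \<le> Re z}" for k
    proof -
      have "(\<lambda>z. (\<chi> i j. if j = k then Q z $ i else (mat z + symbol z) $ i $ j) $ i $ j) holomorphic_on {z. - \<nu> \<le> Re z}" for i j
        using Q_hol sym_hol by (cases "j = k") auto
      then show ?thesis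
        unfolding H_def vec_lambda_beta det_def using det[unfolded det_def]
        by (intro holomorphic_on_divide holomorphic_on_sum holomorphic_on_mult holomorphic_on_const holomorphic_on_prod sym_hol) auto
    qed
    have w_neg: "w t = 0" if "t \<le> 0" for t
    proof (cases "t = 0")
      case True
      have "(LINT s:{0}|lborel. h s) = 0" for h :: "real \<Rightarrow> real^'n"
        unfolding set_lebesgue_integral_def
        by (rule integral_eq_zero_AE, rule eventually_mono[OF AE_lborel_singleton[of 0]]) auto
      then show ?thesis using True eq'[of 0] by (simp add: w_def g_def relax_def)
    qed (use that x_neg' in \<open>simp add: w_def g_def relax_def\<close>)
    have w_cont: "continuous_on UNIV w"
    proof -
      have "continuous_on {0..} w"
        unfolding w_def g_def by (intro continuous_intros x relax_continuous f supp')
      moreover have "continuous_on {..0} w"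
        using w_neg by (subst continuous_on_cong[OF refl, of _ _ "\<lambda>_. 0"]) auto
      ultimately have "continuous_on ({..0} \<union> {0..}) w" by (intro continuous_on_closed_Un) auto
      also have "{..0} \<union> {0..} = (UNIV :: real set)" by auto
      finally show ?thesis .
    qed
    have w_bound: "norm (w t) \<le> (D + exp (a * T) * D) * exp (mass * t)" if "t \<ge> 0" for t
    proof -
      have "exp (a * T) * exp (- a * t) * D \<le> exp (a * T) * exp (mass * t) * D"
      proof -
        have "- a * t \<le> mass * t"
          using that a mass_nonneg mult_nonneg_nonneg[of a t] mult_nonneg_nonneg[of mass t] by linarith
        then show ?thesis using D by (intro mult_right_mono mult_left_mono) auto
      qed
      then show ?thesis unfolding w_def
        using xb[OF that] gb[of t] by (intro order_trans[OF norm_triangle_ineq4]) (simp add: algebra_simps)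
    qed
    have wi: "integrable lborel (\<lambda>t. exp (- c * t) *\<^sub>R w t)"
      using Bochner_Integration.integrable_diff[OF xi gi] by (simp add: scaleR_diff_right w_def)
    have wk: "\<bar>w t $ k\<bar> \<le> E * D * exp (- \<nu> * t) / 2" for k
    proof (rule laplace_inversion_bound[where H="\<lambda>z. H z $ k" and w="\<lambda>t. w t $ k" and c=c and b=mass and K="D + exp (a * T) * D"])
      show "continuous_on UNIV (\<lambda>t. w t $ k)" by (intro continuous_intros w_cont)
      show "\<bar>w t $ k\<bar> \<le> (D + exp (a * T) * D) * exp (mass * t)" if "t \<ge> 0" for t
        using w_bound[OF that] component_le_norm_cart[of "w t" k] by linarith
      show "H z $ k = (LINT t|lborel. (w t $ k) * exp (- z * t))" if "Re z = c" for z :: complex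
        unfolding HL[OF that, symmetric] by (rule laplace_nth[OF wi that])
      show "norm (H z $ k) \<le> E * D / (1 + (Im z)\<^sup>2)" if "- \<nu> \<le> Re z" for z
        using H_bound[OF that] Finite_Cartesian_Product.norm_nth_le[of "H z" k] by linarith
    qed (use w_neg H_hol c in auto)
    have "norm (w t) \<le> (\<Sum>k\<in>UNIV. \<bar>w t $ k\<bar>)" by (rule norm_le_l1_cart)
    also have "\<dots> \<le> (\<Sum>k\<in>(UNIV::'n set). E * D * exp (- \<nu> * t) / 2)" by (intro sum_mono wk)
    finally have "norm (w t) \<le> CARD('n) * (E / 2) * exp (- \<nu> * t) * D" by (simp add: mult_ac)
    moreover have "norm (g t) \<le> exp (a * T) * exp (- \<nu> * t) * D"
      using t D by (intro order_trans[OF gb] mult_right_mono mult_left_mono) (auto simp: a_def algebra_simps)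
    moreover have "norm (x t) \<le> norm (w t) + norm (g t)"
      using norm_triangle_ineq[of "w t" "g t"] by (simp add: w_def)
    ultimately have "norm (x t) \<le> CARD('n) * (E / 2) * exp (- \<nu> * t) * D + exp (a * T) * exp (- \<nu> * t) * D" by linarith
    also have "\<dots> = C * exp (- \<nu> * t) * D" by (simp add: C_def algebra_simps)
    finally show ?thesis by (simp add: D_def)
  qed
  ultimately show ?thesis by blast
qed

end

section \<open>The fundamental theorem for absolutely continuous functions\<close>

lemma absolutely_continuous_onD:
  assumes "absolutely_continuous_on C f" "e > 0"
  obtains \<delta> where "\<delta> > 0" "\<And>D. D division_of \<Union>D \<Longrightarrow> \<Union>D \<subseteq> C \<Longrightarrow> (\<Sum>K\<in>D. Sup K - Inf K) < \<delta>
     \<Longrightarrow> (\<Sum>K\<in>D. norm (f (Sup K) - f (Inf K))) < e"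
  using assms unfolding absolutely_continuous_on_def by meson

lemma absolutely_continuous_on_imp_continuous_on:
  fixes f :: "real \<Rightarrow> 'a::real_normed_vector"
  assumes ac: "absolutely_continuous_on {a..b} f"
  shows "continuous_on {a..b} f"
proof (rule continuous_onI)
  fix x and e :: real assume x: "x \<in> {a..b}" and e: "e > 0"
  obtain \<delta> where \<delta>: "\<delta> > 0" "\<And>D. D division_of \<Union>D \<Longrightarrow> \<Union>D \<subseteq> {a..b} \<Longrightarrow> (\<Sum>K\<in>D. Sup K - Inf K) < \<delta>
     \<Longrightarrow> (\<Sum>K\<in>D. norm (f (Sup K) - f (Inf K))) < e"
    using absolutely_continuous_onD[OF ac e] by blast
  have "dist (f y) (f x) \<le> e" if y: "y \<in> {a..b}" "dist y x < \<delta>" for y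
  proof -
    let ?u = "min x y" and ?v = "max x y"
    have "{{?u..?v}} division_of \<Union>{{?u..?v}}"
      using division_of_self[of ?u ?v] by auto
    moreover have "\<Union>{{?u..?v}} \<subseteq> {a..b}" using x y by auto
    ultimately have "norm (f ?v - f ?u) < e"
      using \<delta>(2)[of "{{?u..?v}}"] y by (auto simp: dist_real_def)
    then show ?thesis by (auto simp: dist_norm min_def max_def norm_minus_commute split: if_splits)
  qed
  then show "\<exists>d>0. \<forall>y\<in>{a..b}. dist y x < d \<longrightarrow> dist (f y) (f x) \<le> e" using \<delta>(1) by blast
qed

lemma lipschitz_imp_absolutely_continuous_on:
  fixes f :: "real \<Rightarrow> 'a::real_normed_vector"
  assumes L: "\<And>u v. u \<in> C \<Longrightarrow> v \<in> C \<Longrightarrow> norm (f v - f u) \<le> L * \<bar>v - u\<bar>"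
  shows "absolutely_continuous_on C f"
  unfolding absolutely_continuous_on_def
proof (intro allI impI)
  fix e :: real assume e: "e > 0"
  have "(\<Sum>K\<in>D. norm (f (Sup K) - f (Inf K))) < e"
    if D: "D division_of S" and S: "S \<subseteq> C" and small: "(\<Sum>K\<in>D. Sup K - Inf K) < e / (\<bar>L\<bar> + 1)" for D S
  proof -
    have K: "norm (f (Sup K) - f (Inf K)) \<le> (\<bar>L\<bar> + 1) * (Sup K - Inf K)" if "K \<in> D" for K
    proof -
      obtain u v where uv: "K = {u..v}" "u \<le> v" "K \<subseteq> S"
        using division_ofD(2-4)[OF D \<open>K \<in> D\<close>] by (metis atLeastatMost_empty_iff box_real(2))
      then have "u \<in> C" "v \<in> C" using S by auto
      then have "norm (f v - f u) \<le> L * (v - u)" using L[of u v] uv by simp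
      also have "\<dots> \<le> (\<bar>L\<bar> + 1) * (v - u)" using uv by (intro mult_right_mono) auto
      finally show ?thesis using uv by simp
    qed
    have "(\<Sum>K\<in>D. norm (f (Sup K) - f (Inf K))) \<le> (\<bar>L\<bar> + 1) * (\<Sum>K\<in>D. Sup K - Inf K)"
      unfolding sum_distrib_left by (rule sum_mono) (rule K)
    also have "\<dots> < e" using small by (simp add: field_simps)
    finally show ?thesis .
  qed
  then show "\<exists>\<delta>>0. \<forall>D S. D division_of S \<longrightarrow> S \<subseteq> C \<longrightarrow>
        (\<Sum>K\<in>D. Sup K - Inf K) < \<delta> \<longrightarrow> (\<Sum>K\<in>D. norm (f (Sup K) - f (Inf K))) < e"
    using e by (intro exI[of _ "e / (\<bar>L\<bar> + 1)"]) auto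
qed

lemma negligible_outer_open:
  fixes S :: "real set"
  assumes "negligible S" "e > 0"
  obtains G where "open G" "S \<subseteq> G" "G \<in> lmeasurable" "measure lebesgue G < e"
proof -
  have S: "S \<in> null_sets lebesgue" using assms by (simp add: negligible_iff_null_sets)
  then obtain G where G: "open G" "S \<subseteq> G" "G - S \<in> lmeasurable" "emeasure lebesgue (G - S) < ennreal e"
    using sets_lebesgue_outer_open[of S e] assms(2) by auto
  have "G = (G - S) \<union> S" using G by auto
  then have em: "emeasure lebesgue G = emeasure lebesgue (G - S)"
    using S G(1,3) by (metis emeasure_Un_null_set fmeasurableD)
  then have "emeasure lebesgue G < ennreal e" using G by simp
  moreover then have "G \<in> lmeasurable" using G(1) by (intro fmeasurableI) (auto simp: less_top intro: order_less_trans)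
  ultimately have "measure lebesgue G < e"
    using emeasure_eq_measure2[of G lebesgue] assms(2) by (simp add: ennreal_less_iff)
  then show ?thesis using that G \<open>G \<in> lmeasurable\<close> by blast
qed

text \<open>
  The cells of a division overlap in null sets only.
\<close>

lemma sum_length_division_le:
  fixes D :: "real set set"
  assumes D: "D division_of \<Union>D" and G: "\<Union>D \<subseteq> G" "G \<in> lmeasurable"
  shows "(\<Sum>K\<in>D. Sup K - Inf K) \<le> measure lebesgue G"
proof -
  have len: "Sup K - Inf K = measure lebesgue K" "K \<in> lmeasurable" if "K \<in> D" for K
  proof -
    have "K \<noteq> {}" "\<exists>u v. K = cbox u v" using division_ofD(3,4)[OF D that] by auto
    then show "Sup K - Inf K = measure lebesgue K" "K \<in> lmeasurable" by auto
  qed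
  have fin: "finite D" using D by auto
  have "(\<Sum>K\<in>D. Sup K - Inf K) = (\<Sum>K\<in>D. measure lebesgue K)" using len by simp
  also have "\<dots> = measure lebesgue (\<Union>D)" by (rule content_division[OF D])
  also have "\<dots> \<le> measure lebesgue G"
    using G fin len by (intro measure_mono_fmeasurable) (auto intro!: sets.finite_Union)
  finally show ?thesis .
qed

text \<open>
  A gauge argument.  Cells tagged outside \<open>S\<close> obey the straddle estimate.  Cells tagged in \<open>S\<close> are confined to an open
  set of small measure around \<open>S\<close>, so by absolute continuity the increments of \<open>f\<close> over them have a small sum.
\<close>

lemma absolutely_continuous_on_FTC:
  fixes f :: "real \<Rightarrow> 'a::banach"
  assumes ab: "a \<le> b" and ac: "absolutely_continuous_on {a..b} f" and S: "negligible S"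
    and vecd: "\<And>x. x \<in> {a..b} - S \<Longrightarrow> (f has_vector_derivative f' x) (at x within {a..b})"
  shows "(f' has_integral (f b - f a)) {a..b}"
proof -
  define g where "g x = (if x \<in> S then 0 else f' x)" for x
  have "(g has_integral (f b - f a)) {a..b}"
    unfolding has_integral_real
  proof (intro allI impI)
    fix e0 :: real assume e0: "e0 > 0"
    define e where "e = e0 / (2 * (b - a + 1))"
    have e: "e > 0" using e0 ab by (simp add: e_def)
    obtain \<delta> where \<delta>: "\<delta> > 0" "\<And>D. D division_of \<Union>D \<Longrightarrow> \<Union>D \<subseteq> {a..b} \<Longrightarrow> (\<Sum>K\<in>D. Sup K - Inf K) < \<delta>
       \<Longrightarrow> (\<Sum>K\<in>D. norm (f (Sup K) - f (Inf K))) < e0 / 2"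
      using absolutely_continuous_onD[OF ac half_gt_zero[OF e0]] by blast
    obtain G where G: "open G" "S \<subseteq> G" "G \<in> lmeasurable" "measure lebesgue G < \<delta>"
      using negligible_outer_open[OF S \<delta>(1)] by blast
    have "\<forall>x. \<exists>d>0. x \<in> {a..b} - S \<longrightarrow>
         (\<forall>y\<in>{a..b}. norm (y-x) < d \<longrightarrow> norm (f y - f x - (y-x) *\<^sub>R f' x) \<le> e * norm (y-x))"
      using vecd[unfolded has_vector_derivative_def has_derivative_within_alt] e
      by (metis (no_types, lifting) zero_less_one)
    then obtain d where d: "\<And>x. 0 < d x"
      "\<And>x y. \<lbrakk>x \<in> {a..b} - S; y \<in> {a..b}; norm (y-x) < d x\<rbrakk>
         \<Longrightarrow> norm (f y - f x - (y-x) *\<^sub>R f' x) \<le> e * norm (y-x)"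
      by metis
    define \<gamma> where "\<gamma> x = (if x \<in> S then G else ball x (d x))" for x
    have "gauge \<gamma>" using G d by (auto simp: gauge_def \<gamma>_def)
    moreover have "norm ((\<Sum>(x, K)\<in>p. measure lborel K *\<^sub>R g x) - (f b - f a)) < e0"
      if p: "p tagged_division_of {a..b}" and fine: "\<gamma> fine p" for p
    proof -
      define p1 where "p1 = {(x, K) \<in> p. x \<notin> S}"
      define p2 where "p2 = {(x, K) \<in> p. x \<in> S}"
      have fin: "finite p" using p by blast
      have pp: "p = p1 \<union> p2" "p1 \<inter> p2 = {}" "finite p1" "finite p2"
        using fin by (auto simp: p1_def p2_def intro: rev_finite_subset)
      define h where "h = (\<lambda>(x, K). measure lborel K *\<^sub>R g x - (f (Sup K) - f (Inf K)))"
      have ba: "b - a = (\<Sum>(x,K)\<in>p. Sup K - Inf K)" "f b - f a = (\<Sum>(x,K)\<in>p. f(Sup K) - f(Inf K))"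
        using additive_tagged_division_1[where f= "\<lambda>x. x", OF ab p] additive_tagged_division_1[where f= f, OF ab p] by auto
      have K: "\<exists>u v. K = {u..v} \<and> u \<le> v \<and> x \<in> K \<and> K \<subseteq> {a..b} \<and> K \<subseteq> \<gamma> x" if "(x, K) \<in> p" for x K
      proof -
        have "x \<in> K" "K \<subseteq> {a..b}" "\<exists>u v. K = cbox u v" using tagged_division_ofD(2-4)[OF p that] by auto
        moreover have "K \<subseteq> \<gamma> x" using fine that by (auto simp: fine_def)
        ultimately show ?thesis by (metis atLeastatMost_empty_iff2 box_real(2) empty_iff)
      qed
      have "(\<Sum>(x, K)\<in>p. measure lborel K *\<^sub>R g x) - (f b - f a) = sum h p"
        by (simp add: ba h_def split_def sum_subtractf)
      also have "\<dots> = sum h p1 + sum h p2" using pp by (simp add: sum.union_disjoint)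
      finally have eq: "(\<Sum>(x, K)\<in>p. measure lborel K *\<^sub>R g x) - (f b - f a) = sum h p1 + sum h p2" .
      have "norm (sum h p1) \<le> (\<Sum>(x, K)\<in>p1. e * (Sup K - Inf K))"
      proof (rule sum_norm_le, safe)
        fix x K assume "(x, K) \<in> p1"
        then have xK: "(x, K) \<in> p" "x \<notin> S" by (auto simp: p1_def)
        from K[OF xK(1)] xK(2) obtain u v where k: "K = {u..v}" "u \<le> v" "x \<in> K" "K \<subseteq> {a..b}" "K \<subseteq> ball x (d x)"
          by (auto simp: \<gamma>_def)
        have uv: "norm (u - x) < d x" "norm (v - x) < d x" "u \<in> {a..b}" "v \<in> {a..b}" "x \<in> {a..b} - S"
        proof -
          have "u \<in> K" "v \<in> K" using k by auto
          then have "u \<in> ball x (d x)" "v \<in> ball x (d x)" "u \<in> {a..b}" "v \<in> {a..b}" "x \<in> {a..b}"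
            using k(3-5) by blast+
          then show "norm (u - x) < d x" "norm (v - x) < d x" "u \<in> {a..b}" "v \<in> {a..b}" "x \<in> {a..b} - S"
            using xK by (auto simp: dist_real_def)
        qed
        have "norm ((v - u) *\<^sub>R f' x - (f v - f u)) = norm (f u - f x - (u - x) *\<^sub>R f' x - (f v - f x - (v - x) *\<^sub>R f' x))"
          by (auto simp: algebra_simps)
        also have "\<dots> \<le> norm (f u - f x - (u - x) *\<^sub>R f' x) + norm (f v - f x - (v - x) *\<^sub>R f' x)"
          by (rule norm_triangle_ineq4)
        also have "\<dots> \<le> e * norm (u - x) + e * norm (v - x)"
          using uv by (intro add_mono d) auto
        also have "\<dots> = e * (v - u)" using k by (auto simp: algebra_simps)
        finally show "norm (h (x, K)) \<le> e * (Sup K - Inf K)" using k xK by (simp add: h_def g_def)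
      qed
      also have "\<dots> \<le> (\<Sum>(x, K)\<in>p. e * (Sup K - Inf K))"
      proof (rule sum_mono2[OF fin])
        show "p1 \<subseteq> p" using pp by blast
        fix y assume "y \<in> p - p1"
        then show "0 \<le> (case y of (x, K) \<Rightarrow> e * (Sup K - Inf K))"
          using K[of "fst y" "snd y"] e by (cases y) auto
      qed
      also have "\<dots> = e * (b - a)" unfolding ba by (simp add: sum_distrib_left split_def)
      also have "\<dots> < e0 / 2"
        using e0 ab unfolding e_def by (simp add: field_simps)
      finally have n1: "norm (sum h p1) < e0 / 2" .
      define D where "D = snd ` p2"
      have p2: "p2 tagged_partial_division_of {a..b}"
        using p tagged_partial_division_subset[of p _ p2] pp by (auto simp: tagged_division_of_def)
      have D: "D division_of \<Union>D" unfolding D_def by (rule partial_division_of_tagged_division[OF p2])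
      have DG: "\<Union>D \<subseteq> G" "\<Union>D \<subseteq> {a..b}" 
      proof -
        have "K \<subseteq> G \<inter> {a..b}" if "K \<in> D" for K
        proof -
          obtain x where "(x, K) \<in> p" "x \<in> S" using \<open>K \<in> D\<close> by (auto simp: D_def p2_def)
          then show ?thesis using K[of x K] by (auto simp: \<gamma>_def)
        qed
        then show "\<Union>D \<subseteq> G" "\<Union>D \<subseteq> {a..b}" by blast+
      qed
      have small: "(\<Sum>K\<in>D. Sup K - Inf K) < \<delta>" using sum_length_division_le[OF D DG(1) G(3)] G(4) by linarith
      \<comment> \<open>the increment of \<open>f\<close> over a cell; \<open>Sup {}\<close> and \<open>Inf {}\<close> may differ, hence the value at \<open>{}\<close>\<close>
      define q where "q K = (if K = {} then 0 else norm (f (Sup K) - f (Inf K)))" for K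
      have "norm (sum h p2) \<le> (\<Sum>(x, K)\<in>p2. q K)"
      proof (rule sum_norm_le, safe)
        fix x K assume "(x, K) \<in> p2"
        then have xK: "(x, K) \<in> p" "x \<in> S" by (auto simp: p2_def)
        then show "norm (h (x, K)) \<le> q K" using K[OF xK(1)] by (auto simp: h_def g_def q_def norm_minus_commute)
      qed
      also have "\<dots> = sum q D" unfolding D_def
        by (rule sum.over_tagged_division_lemma[OF tagged_partial_division_of_Union_self[OF p2]])
           (auto simp: q_def)
      also have "\<dots> = (\<Sum>K\<in>D. norm (f (Sup K) - f (Inf K)))"
        using division_ofD(3)[OF D] by (intro sum.cong) (auto simp: q_def)
      also have "\<dots> < e0 / 2" by (rule \<delta>(2)[OF D DG(2) small])
      finally have "norm (sum h p2) < e0 / 2" .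
      with n1 show ?thesis unfolding eq using norm_triangle_ineq[of "sum h p1" "sum h p2"] by linarith
    qed
    ultimately show "\<exists>\<gamma>. gauge \<gamma> \<and> (\<forall>\<D>. \<D> tagged_division_of {a..b} \<and> \<gamma> fine \<D> \<longrightarrow>
        norm ((\<Sum>(x, K)\<in>\<D>. measure lborel K *\<^sub>R g x) - (f b - f a)) < e0)"
      by (intro exI[of _ \<gamma>] conjI allI impI) auto
  qed
  \<comment> \<open>\<open>f'\<close> is arbitrary on the null set \<open>S\<close>\<close>
  then show ?thesis
    by (rule has_integral_spike[OF S, rotated]) (auto simp: g_def)
qed

section \<open>The norms on histories\<close>

text \<open>
  Used with \<open>f\<close> ranging over the representatives in the definition of \<open>BV_norm\<close>.
\<close>

lemma ennreal_le_mult_INF: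
  fixes x s :: ennreal and c :: real
  assumes le: "\<And>i. i \<in> I \<Longrightarrow> x \<le> ennreal c * (f i + s)" and c: "c > 0"
  shows "x \<le> ennreal c * ((INF i\<in>I. f i) + s)"
proof (rule ennreal_le_epsilon)
  fix e :: real assume fin: "ennreal c * ((INF i\<in>I. f i) + s) < top" and e: "0 < e"
  have "(INF i\<in>I. f i) + s < top" using fin c by (auto simp: ennreal_mult_less_top)
  then have "(INF i\<in>I. f i) < top" by (auto simp: less_top)
  then have "(INF i\<in>I. f i) < (INF i\<in>I. f i) + ennreal (e / c)"
    using e c by (cases "INF i\<in>I. f i") (auto simp flip: ennreal_plus intro!: ennreal_lessI add_nonneg_pos)
  then obtain i where i: "i \<in> I" "f i < (INF i\<in>I. f i) + ennreal (e / c)"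
    unfolding INF_less_iff by blast
  have "x \<le> ennreal c * (f i + s)" by (rule le[OF i(1)])
  also have "\<dots> \<le> ennreal c * ((INF i\<in>I. f i) + ennreal (e / c) + s)"
    using i(2) by (intro mult_left_mono add_right_mono) auto
  also have "\<dots> = ennreal c * ((INF i\<in>I. f i) + s) + ennreal c * ennreal (e / c)"
    by (simp add: distrib_left ac_simps)
  also have "ennreal c * ennreal (e / c) = ennreal e" using c e by (simp flip: ennreal_mult)
  finally show "x \<le> ennreal c * ((INF i\<in>I. f i) + s) + ennreal e" .
qed

lemma AE_lborel_shift:
  assumes "AE s in lborel. P s" "c \<noteq> 0"
  shows "AE s in lborel. P (t + c * s :: real)"
proof -
  obtain N where N: "N \<in> null_sets lborel" "{s. \<not> P s} \<subseteq> N"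
    using assms(1) by (auto simp: eventually_ae_filter)
  have "AE s in lborel. t + c * s \<notin> N"
    using N(1) assms(2) AE_not_in[OF N(1)] by (intro AE_borel_affine) auto
  then show ?thesis using N(2) by (auto elim!: eventually_mono)
qed

lemma AE_lebesgue_on_iff:
  "C \<in> sets borel \<Longrightarrow> (AE s in lebesgue_on C. P s) \<longleftrightarrow> (AE s in lborel. s \<in> C \<longrightarrow> P s)"
  by (subst AE_restrict_space_iff) (auto simp: AE_completion_iff)

lemma nn_integral_lebesgue_on_borel:
  assumes "C \<in> sets borel" "f \<in> borel_measurable borel"
  shows "(\<integral>\<^sup>+ s. f s \<partial>lebesgue_on C) = (\<integral>\<^sup>+ s. f s * indicator C s \<partial>lborel)"
  using assms by (subst nn_integral_restrict_space) (auto simp: nn_integral_completion)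

lemma borel_measurable_lebesgue_on_borel:
  "f \<in> borel_measurable borel \<Longrightarrow> f \<in> borel_measurable (lebesgue_on C)"
  by (intro measurable_restrict_space1 measurable_completion) auto

lemma V_norm_cong_AE:
  fixes f g :: "real \<Rightarrow> 'a::euclidean_space"
  assumes ae: "AE s in lebesgue_on C. f s = g s"
    and "f \<in> borel_measurable (lebesgue_on C)" "g \<in> borel_measurable (lebesgue_on C)"
  shows "V_norm V C f = V_norm V C g"
proof (cases V)
  case (Lp p)
  have "(\<integral>\<^sup>+ s. ennreal (norm (f s) powr enn2real p) \<partial>lebesgue_on C) = (\<integral>\<^sup>+ s. ennreal (norm (g s) powr enn2real p) \<partial>lebesgue_on C)"
    by (rule nn_integral_cong_AE) (use ae in \<open>auto elim!: eventually_mono\<close>)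
  moreover have "esssup (lebesgue_on C) (\<lambda>s. ennreal (norm (f s))) = esssup (lebesgue_on C) (\<lambda>s. ennreal (norm (g s)))"
    using assms by (intro esssup_AE_cong) (auto elim!: eventually_mono)
  ultimately show ?thesis by (simp add: Lp Lp_norm_def)
next
  case BV
  have "(AE s in lebesgue_on C. h s = f s) \<longleftrightarrow> (AE s in lebesgue_on C. h s = g s)" for h
    using ae by (auto elim: eventually_elim2)
  then show ?thesis by (simp add: BV BV_norm_def)
qed

lemma Lp_norm_le:
  assumes q: "p \<noteq> \<infinity>" "enn2real p \<ge> 1" and K: "K \<ge> 1" and c: "c \<ge> 0"
    and le: "(\<integral>\<^sup>+ s. ennreal (norm (f s) powr enn2real p) \<partial>lebesgue_on C) \<le> ennreal (K * c powr enn2real p)"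
  shows "Lp_norm p C f \<le> ennreal (K * c)"
proof -
  let ?q = "enn2real p" and ?I = "\<integral>\<^sup>+ s. ennreal (norm (f s) powr enn2real p) \<partial>lebesgue_on C"
  have fin: "?I < top" using le by (auto intro: order_le_less_trans)
  then have "enn2real ?I \<le> K * c powr ?q" using le K c by (simp add: enn2real_leI)
  then have "enn2real ?I powr (1 / ?q) \<le> (K * c powr ?q) powr (1 / ?q)"
    using q by (intro powr_mono2) auto
  also have "\<dots> = K powr (1 / ?q) * c" using K c q by (simp add: powr_mult powr_powr)
  also have "\<dots> \<le> K powr 1 * c" using K c q by (intro mult_right_mono powr_mono) auto
  finally have "enn2real ?I powr (1 / ?q) \<le> K * c" using K by simp
  then show ?thesis using q fin by (auto simp: Lp_norm_def ennreal_powr_def intro: ennreal_leI)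
qed

lemma enn2real_ge_1: "1 \<le> p \<Longrightarrow> p \<noteq> \<infinity> \<Longrightarrow> 1 \<le> enn2real p" for p :: ennreal
  by (metis enn2real_1 enn2real_mono infinity_ennreal_def less_top)

text \<open>
  For \<open>p < \<infinity>\<close> the norms are compared through \<open>x \<le> l + l\<^sup>1\<^sup>-\<^sup>q x\<^sup>q\<close> with \<open>q = p\<close> and \<open>l = \<parallel>f\<parallel>\<^sub>p\<close>, which replaces
  the Hoelder inequality at the cost of the constant \<open>1 + (b - a)\<close>.
\<close>

lemma V_norm_dominates_L1:
  fixes f :: "real \<Rightarrow> 'a::euclidean_space"
  assumes V: "V = BV \<or> (\<exists>p\<ge>1. V = Lp p)" and f: "f \<in> borel_measurable (lebesgue_on {a..b})" and ab: "a \<le> b"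
  shows "(\<integral>\<^sup>+ s. ennreal (norm (f s)) \<partial>lebesgue_on {a..b}) \<le> ennreal (1 + (b - a)) * V_norm V {a..b} f"
proof (cases V)
  case (Lp p)
  with V have p: "1 \<le> p" by auto
  let ?M = "lebesgue_on {a..b}" 
  have sp: "emeasure ?M (space ?M) = ennreal (b - a)"
    using ab by (simp add: emeasure_restrict_space)
  have fm: "(\<lambda>s. ennreal (norm (f s))) \<in> borel_measurable ?M" using f by measurable
  show ?thesis
  proof (cases "p = \<infinity>")
    case True
    let ?c = "Lp_norm p {a..b} f"
    have "AE s in ?M. ennreal (norm (f s)) \<le> ?c"
      using esssup_AE[of "\<lambda>s. ennreal (norm (f s))" ?M] True by (simp add: Lp_norm_def)
    then have "(\<integral>\<^sup>+ s. ennreal (norm (f s)) \<partial>?M) \<le> (\<integral>\<^sup>+ s. ?c \<partial>?M)" by (rule nn_integral_mono_AE)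
    also have "\<dots> = ennreal (b - a) * ?c" using sp by (simp add: mult.commute)
    also have "\<dots> \<le> ennreal (1 + (b - a)) * ?c" by (intro mult_right_mono ennreal_leI) auto
    finally show ?thesis by (simp add: Lp)
  next
    case False
    let ?q = "enn2real p" and ?I = "\<integral>\<^sup>+ s. ennreal (norm (f s) powr enn2real p) \<partial>?M"
    have q: "?q \<ge> 1" using p False by (rule enn2real_ge_1)
    show ?thesis
    proof (cases "?I = \<infinity>")
      case True
      then have "V_norm V {a..b} f = \<infinity>" using False by (simp add: Lp Lp_norm_def ennreal_powr_def)
      then show ?thesis using ab by (simp add: ennreal_mult_top)
    next
      case fin: False
      define l where "l = enn2real ?I powr (1 / ?q)"
      have Vl: "V_norm V {a..b} f = ennreal l" using False fin by (simp add: Lp Lp_norm_def ennreal_powr_def l_def)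
      have lq: "?I = ennreal (l powr ?q)"
        using q fin by (simp add: l_def powr_powr less_top)
      show ?thesis
      proof (cases "l = 0")
        case True
        then have "?I = 0" using lq q by simp
        then have "AE s in ?M. ennreal (norm (f s) powr ?q) = 0"
          using f by (subst (asm) nn_integral_0_iff_AE) auto
        then have "(\<integral>\<^sup>+ s. ennreal (norm (f s)) \<partial>?M) = (\<integral>\<^sup>+ s. 0 \<partial>?M)"
          by (intro nn_integral_cong_AE) (auto elim!: eventually_mono simp: ennreal_eq_0_iff)
        then show ?thesis by simp
      next
        case False
        have l: "l > 0" using False by (simp add: l_def)
        \<comment> \<open>for \<open>x > l\<close> write \<open>x\<close> as \<open>l\<^sup>1\<^sup>-\<^sup>q x l\<^sup>q\<^sup>-\<^sup>1\<close> and enlarge the last factor\<close>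
        have pt: "x \<le> l + l powr (1 - ?q) * x powr ?q" if "x \<ge> 0" for x
        proof (cases "x \<le> l")
          case False
          have "x powr 1 = l powr (1 - ?q) * (x powr 1 * l powr (?q - 1))"
            using l by (simp add: powr_add[symmetric] mult.left_commute)
          also have "\<dots> \<le> l powr (1 - ?q) * (x powr 1 * x powr (?q - 1))"
            using l False q by (intro mult_left_mono powr_mono2) auto
          also have "x powr 1 * x powr (?q - 1) = x powr ?q" unfolding powr_add[symmetric] by simp
          finally show ?thesis using l that False by simp
        qed (use l in \<open>auto intro: add_increasing2\<close>)
        have "(\<integral>\<^sup>+ s. ennreal (norm (f s)) \<partial>?M) \<le> (\<integral>\<^sup>+ s. ennreal l + ennreal (l powr (1 - ?q)) * ennreal (norm (f s) powr ?q) \<partial>?M)"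
          using pt l by (intro nn_integral_mono) (auto simp flip: ennreal_mult ennreal_plus intro!: ennreal_leI)
        also have "\<dots> = ennreal l * ennreal (b - a) + ennreal (l powr (1 - ?q)) * ?I"
          using f sp by (subst nn_integral_add) (auto simp: nn_integral_cmult)
        also have "\<dots> = ennreal (l * (b - a)) + ennreal (l powr (1 - ?q) * l powr ?q)"
          unfolding lq using l ab by (simp flip: ennreal_mult)
        also have "l powr (1 - ?q) * l powr ?q = l" using l by (simp flip: powr_add)
        also have "ennreal (l * (b - a)) + ennreal l = ennreal (1 + (b - a)) * ennreal l"
          using l ab by (simp flip: ennreal_mult ennreal_plus add: algebra_simps)
        finally show ?thesis unfolding Vl .
      qed
    qed
  qed
next
  case BV
  have "(\<integral>\<^sup>+ s. ennreal (norm (f s)) \<partial>lebesgue_on {a..b}) \<le> ennreal (1 + (b - a)) * ((INF g \<in> {g. AE s in lebesgue_on {a..b}. g s = f s}. total_variation {a..b} g + sup_norm {a..b} g) + 0)"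
  proof (rule ennreal_le_mult_INF)
    fix g assume "g \<in> {g. AE s in lebesgue_on {a..b}. g s = f s}"
    then have g: "AE s in lebesgue_on {a..b}. g s = f s" by simp
    have "(\<integral>\<^sup>+ s. ennreal (norm (f s)) \<partial>lebesgue_on {a..b}) = (\<integral>\<^sup>+ s. ennreal (norm (g s)) \<partial>lebesgue_on {a..b})"
      by (rule nn_integral_cong_AE) (use g in \<open>auto elim!: eventually_mono\<close>)
    also have "\<dots> \<le> (\<integral>\<^sup>+ s. sup_norm {a..b} g \<partial>lebesgue_on {a..b})"
      by (intro nn_integral_mono) (auto simp: sup_norm_def intro!: SUP_upper)
    also have "\<dots> = ennreal (b - a) * sup_norm {a..b} g"
      using ab by (simp add: emeasure_restrict_space mult.commute)
    also have "\<dots> \<le> ennreal (1 + (b - a)) * (total_variation {a..b} g + sup_norm {a..b} g + 0)"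
      by (intro mult_mono ennreal_leI) auto
    finally show "(\<integral>\<^sup>+ s. ennreal (norm (f s)) \<partial>lebesgue_on {a..b}) \<le> ennreal (1 + (b - a)) * (total_variation {a..b} g + sup_norm {a..b} g + 0)" .
  qed (use ab in auto)
  then show ?thesis by (simp add: BV BV_norm_def)
qed

lemma total_variation_upper:
  assumes "mono_on {..m} t" "t ` {..m} \<subseteq> C"
  shows "(\<Sum>i<m. ennreal (norm (f (t (Suc i)) - f (t i)))) \<le> total_variation C f"
  unfolding total_variation_def using assms by (intro SUP_upper2[of "(m, t)"]) auto

text \<open>
  The increments of \<open>v\<close> along a partition telescope.
\<close>

lemma total_variation_le:
  fixes f :: "real \<Rightarrow> 'a::real_normed_vector"
  assumes v: "\<And>a b. lo \<le> a \<Longrightarrow> a \<le> b \<Longrightarrow> b \<le> hi \<Longrightarrow> norm (f b - f a) \<le> v b - v a" and le: "lo \<le> hi"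
  shows "total_variation {lo..hi} f \<le> ennreal (v hi - v lo)"
  unfolding total_variation_def
proof (rule SUP_least, safe)
  fix m :: nat and t :: "nat \<Rightarrow> real" assume t: "mono_on {..m} t" "t ` {..m} \<subseteq> {lo..hi}"
  have r: "lo \<le> t i" "t i \<le> hi" if "i \<le> m" for i using t(2) that by auto
  have "(\<Sum>i<m. ennreal (norm (f (t (Suc i)) - f (t i)))) \<le> (\<Sum>i<m. ennreal (v (t (Suc i)) - v (t i)))"
  proof (intro sum_mono ennreal_leI v)
    fix i assume i: "i \<in> {..<m}"
    show "lo \<le> t i" "t (Suc i) \<le> hi" using r i by auto
    show "t i \<le> t (Suc i)" using i by (intro mono_onD[OF t(1)]) auto
  qed
  also have "\<dots> = ennreal (\<Sum>i<m. v (t (Suc i)) - v (t i))"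
  proof (rule sum_ennreal)
    fix i assume i: "i \<in> {..<m}"
    have "norm (f (t (Suc i)) - f (t i)) \<le> v (t (Suc i)) - v (t i)"
      using i r by (intro v mono_onD[OF t(1)]) auto
    then show "0 \<le> v (t (Suc i)) - v (t i)" using norm_ge_zero order_trans by blast
  qed
  also have "(\<Sum>i<m. v (t (Suc i)) - v (t i)) = v (t m) - v (t 0)" by (rule sum_lessThan_telescope)
  also have "\<dots> \<le> v hi - v lo"
  proof -
    have "0 \<le> v hi - v (t m)" "0 \<le> v (t 0) - v lo"
      using r[of m] r[of 0] v[of "t m" hi] v[of lo "t 0"]
        norm_ge_zero[of "f hi - f (t m)"] norm_ge_zero[of "f (t 0) - f lo"] by linarith+
    then show ?thesis by linarith
  qed
  finally show "(\<Sum>i<m. ennreal (norm (f (t (Suc i)) - f (t i)))) \<le> ennreal (v hi - v lo)"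
    using ennreal_leI by blast
qed

text \<open>
  A partition crosses the gluing point at most once, and clamping its points to either side of it gives partitions
  for \<open>g\<close> and for \<open>X\<close>.  The jump is counted with the increments of a step function, which telescope.
\<close>

lemma total_variation_glue:
  fixes g X :: "real \<Rightarrow> 'a::real_normed_vector"
  assumes t: "0 \<le> t" "t < T"
  defines "Z \<equiv> \<lambda>s. if t + s < 0 then g (t + s) else X (t + s)"
  shows "total_variation {-T..0} Z \<le> total_variation {-T..0} g + total_variation {0..t} X + ennreal (norm (X 0 - g 0))"
  unfolding total_variation_def[of _ Z]
proof (rule SUP_least, safe)
  fix m :: nat and r :: "nat \<Rightarrow> real" assume r: "mono_on {..m} r" "r ` {..m} \<subseteq> {-T..0}"
  let ?lo = "\<lambda>i. min (t + r i) 0" and ?hi = "\<lambda>i. max (t + r i) 0"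
  let ?J = "norm (X 0 - g 0)" and ?st = "\<lambda>i. if t + r i < 0 then 0 else (1::real)"
  have rle: "r i \<le> r (Suc i)" if "i < m" for i using that by (intro mono_onD[OF r(1)]) auto
  have step: "norm (Z (r (Suc i)) - Z (r i)) \<le> norm (g (?lo (Suc i)) - g (?lo i)) + norm (X (?hi (Suc i)) - X (?hi i)) + ?J * (?st (Suc i) - ?st i)"
    if "i < m" for i
  proof -
    consider "t + r (Suc i) < 0" "t + r i < 0" | "t + r i < 0" "t + r (Suc i) \<ge> 0" | "t + r i \<ge> 0" "t + r (Suc i) \<ge> 0"
      using rle[OF \<open>i < m\<close>] by linarith
    then show ?thesis
    proof cases
      case 2
      have "Z (r (Suc i)) - Z (r i) = (g 0 - g (t + r i)) + (X (t + r (Suc i)) - X 0) + (X 0 - g 0)"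
        using 2 by (simp add: Z_def)
      also have "norm \<dots> \<le> norm (g 0 - g (t + r i)) + norm (X (t + r (Suc i)) - X 0) + norm (X 0 - g 0)"
        by (intro norm_triangle_le add_mono) auto
      finally show ?thesis using 2 by (cases "t + r (Suc i) = 0") (simp_all add: min_def max_def)
    qed (auto simp: Z_def min_def max_def)
  qed
  have st: "0 \<le> ?st (Suc i) - ?st i" if "i < m" for i using rle[OF that] by auto
  have "(\<Sum>i<m. ennreal (norm (Z (r (Suc i)) - Z (r i)))) \<le> (\<Sum>i<m. ennreal (norm (g (?lo (Suc i)) - g (?lo i))) + ennreal (norm (X (?hi (Suc i)) - X (?hi i))) + ennreal (?J * (?st (Suc i) - ?st i)))"
  proof (rule sum_mono)
    fix i assume "i \<in> {..<m}"
    then have i: "i < m" by simp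
    have "0 \<le> ?J * (?st (Suc i) - ?st i)" using st[OF i] by (intro mult_nonneg_nonneg) auto
    then show "ennreal (norm (Z (r (Suc i)) - Z (r i))) \<le> ennreal (norm (g (?lo (Suc i)) - g (?lo i))) + ennreal (norm (X (?hi (Suc i)) - X (?hi i))) + ennreal (?J * (?st (Suc i) - ?st i))"
      using ennreal_leI[OF step[OF i]] by (simp add: ennreal_plus)
  qed
  also have "\<dots> = (\<Sum>i<m. ennreal (norm (g (?lo (Suc i)) - g (?lo i)))) + (\<Sum>i<m. ennreal (norm (X (?hi (Suc i)) - X (?hi i)))) + (\<Sum>i<m. ennreal (?J * (?st (Suc i) - ?st i)))"
    by (simp only: sum.distrib)
  also have "\<dots> \<le> total_variation {-T..0} g + total_variation {0..t} X + ennreal ?J"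
  proof (intro add_mono)
    have rb: "- T \<le> r i" "r i \<le> 0" if "i \<le> m" for i using r(2) that by auto
    have "mono_on {..m} ?lo" "mono_on {..m} ?hi"
      using mono_onD[OF r(1)] by (auto intro!: mono_onI min.mono max.mono)
    moreover have "?lo ` {..m} \<subseteq> {-T..0}" "?hi ` {..m} \<subseteq> {0..t}"
      using rb t by force+
    ultimately show "(\<Sum>i<m. ennreal (norm (g (?lo (Suc i)) - g (?lo i)))) \<le> total_variation {-T..0} g"
      "(\<Sum>i<m. ennreal (norm (X (?hi (Suc i)) - X (?hi i)))) \<le> total_variation {0..t} X"
      using total_variation_upper[of m ?lo] total_variation_upper[of m ?hi] by auto
    have "(\<Sum>i<m. ennreal (?J * (?st (Suc i) - ?st i))) = ennreal (\<Sum>i<m. ?J * (?st (Suc i) - ?st i))"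
      using st by (intro sum_ennreal mult_nonneg_nonneg) auto
    also have "(\<Sum>i<m. ?J * (?st (Suc i) - ?st i)) = ?J * (?st m - ?st 0)"
      by (simp only: sum_distrib_left[symmetric] sum_lessThan_telescope[of ?st m])
    also have "\<dots> \<le> ?J * 1" by (intro mult_left_mono) auto
    finally show "(\<Sum>i<m. ennreal (?J * (?st (Suc i) - ?st i))) \<le> ennreal ?J" using ennreal_leI by simp
  qed
  finally show "(\<Sum>i<m. ennreal (norm (Z (r (Suc i)) - Z (r i)))) \<le> total_variation {-T..0} g + total_variation {0..t} X + ennreal ?J" .
qed

lemma total_variation_shift_le:
  "total_variation {-T..0} (\<lambda>s. X (t + s)) \<le> total_variation {t - T..t} (X :: real \<Rightarrow> 'a::real_normed_vector)"
  unfolding total_variation_def[of _ "\<lambda>s. X (t + s)"]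
proof (rule SUP_least, safe)
  fix m :: nat and r :: "nat \<Rightarrow> real" assume r: "mono_on {..m} r" "r ` {..m} \<subseteq> {-T..0}"
  then have "mono_on {..m} (\<lambda>i. t + r i)" "(\<lambda>i. t + r i) ` {..m} \<subseteq> {t - T..t}"
    by (auto simp: mono_on_def image_subset_iff)
  then show "(\<Sum>i<m. ennreal (norm (X (t + r (Suc i)) - X (t + r i)))) \<le> total_variation {t - T..t} X"
    by (rule total_variation_upper)
qed


lemma sup_norm_upper: "s \<in> C \<Longrightarrow> ennreal (norm (f s)) \<le> sup_norm C f"
  unfolding sup_norm_def by (rule SUP_upper)

lemma sup_norm_least: "(\<And>s. s \<in> C \<Longrightarrow> ennreal (norm (f s)) \<le> c) \<Longrightarrow> sup_norm C f \<le> c"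
  unfolding sup_norm_def by (rule SUP_least)

lemma nn_integral_shift_le:
  fixes f :: "real \<Rightarrow> ennreal"
  assumes [measurable]: "f \<in> borel_measurable borel"
  shows "(\<integral>\<^sup>+ s. f (t + s) * indicator {-T..0} (t + s) \<partial>lborel) = (\<integral>\<^sup>+ s. f s * indicator {-T..0} s \<partial>lborel)"
  using nn_integral_real_affine[of "\<lambda>s. f s * indicator {-T..0} s" 1 t] by simp

text \<open>
  The history \<open>y0\<close> enters only while \<open>t < T\<close>.  The factor \<open>3 + T\<close> covers all cases: \<open>1 + T\<close> suffices for \<open>p < \<infinity>\<close>,
  \<open>1\<close> for \<open>p = \<infinity>\<close>, and \<open>3\<close> for \<open>BV\<close>, where the jump at the gluing point is estimated by suprema.
\<close>

lemma V_norm_partial_trajectory_le: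
  fixes X y0 :: "real \<Rightarrow> 'a::euclidean_space"
  assumes V: "V = BV \<or> (\<exists>p\<ge>1. V = Lp p)" and T: "T > 0" and t: "t \<ge> 0" and S: "S \<ge> 0"
    and Xm: "X \<in> borel_measurable borel" and ym: "y0 \<in> borel_measurable borel"
    and X0: "\<And>s. s < 0 \<Longrightarrow> X s = y0 s"
    and bnd: "\<And>s. 0 \<le> s \<Longrightarrow> t - T \<le> s \<Longrightarrow> s \<le> t \<Longrightarrow> norm (X s) \<le> S"
    and tv: "total_variation {max (t - T) 0..t} X \<le> ennreal S"
  shows "V_norm V {-T..0} (partial_trajectory X t)
     \<le> ennreal (3 + T) * ((if t < T then V_norm V {-T..0} y0 else 0) + ennreal S)"
proof (cases V)
  case (Lp p)
  with V have p: "1 \<le> p" by auto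
  have "ennreal 1 \<le> ennreal (3 + T)" using T by (intro ennreal_leI) auto
  then have le1: "c \<le> ennreal (3 + T) * c" for c
    using mult_right_mono[of "ennreal 1" "ennreal (3 + T)" c] by simp
  let ?Y = "partial_trajectory X t"
  have Ym[measurable]: "?Y \<in> borel_measurable borel"
    unfolding partial_trajectory_def using Xm by measurable
  note [measurable] = ym
  have Yc: "?Y s = y0 (t + s)" if "t + s < 0" for s using X0[OF that] by (simp add: partial_trajectory_def)
  have Yb: "norm (?Y s) \<le> S" if "s \<in> {-T..0}" "t + s \<ge> 0" for s
    using bnd[of "t + s"] that by (simp add: partial_trajectory_def)
  show ?thesis
  proof (cases "p = \<infinity>")
    case True
    let ?w = "if t < T then V_norm V {-T..0} y0 else 0"
    have "AE s in lebesgue_on {-T..0}. ennreal (norm (y0 s)) \<le> V_norm V {-T..0} y0"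
      using esssup_AE[of "\<lambda>s. ennreal (norm (y0 s))" "lebesgue_on {-T..0}"] True by (simp add: Lp Lp_norm_def)
    then have "AE s in lborel. s \<in> {-T..0} \<longrightarrow> ennreal (norm (y0 s)) \<le> V_norm V {-T..0} y0"
      by (simp add: AE_lebesgue_on_iff)
    from AE_lborel_shift[OF this, of 1 t]
    have sh: "AE s in lborel. - T \<le> t + s \<and> t + s \<le> 0 \<longrightarrow> ennreal (norm (y0 (t + s))) \<le> V_norm V {-T..0} y0"
      by simp
    then have "AE s in lborel. s \<in> {-T..0} \<longrightarrow> ennreal (norm (?Y s)) \<le> ?w + ennreal S"
    proof (rule eventually_mono, intro impI)
      fix s assume 1: "- T \<le> t + s \<and> t + s \<le> 0 \<longrightarrow> ennreal (norm (y0 (t + s))) \<le> V_norm V {-T..0} y0"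
        and "s \<in> {-T..0}"
      then have s: "- T \<le> s \<and> s \<le> 0" by simp
      show "ennreal (norm (?Y s)) \<le> ?w + ennreal S"
      proof (cases "t + s < 0")
        case True
        then show ?thesis using 1 s t Yc[OF True] by (auto intro: add_increasing2)
      next
        case False
        then show ?thesis using Yb[of s] s by (intro add_increasing ennreal_leI) auto
      qed
    qed
    then have "AE s in lebesgue_on {-T..0}. ennreal (norm (?Y s)) \<le> ?w + ennreal S"
      by (simp add: AE_lebesgue_on_iff)
    then have "V_norm V {-T..0} ?Y \<le> ?w + ennreal S"
      using True by (auto simp: Lp Lp_norm_def intro!: esssup_I borel_measurable_lebesgue_on_borel)
    also have "\<dots> \<le> ennreal (3 + T) * (?w + ennreal S)"
      by (rule le1)
    finally show ?thesis .
  next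
    case False
    let ?q = "enn2real p"
    have q: "?q \<ge> 1" using p False by (rule enn2real_ge_1)
    define I0 where "I0 = (\<integral>\<^sup>+ s. ennreal (norm (y0 s) powr ?q) \<partial>lebesgue_on {-T..0})"
    have I0: "I0 = (\<integral>\<^sup>+ s. ennreal (norm (y0 s) powr ?q) * indicator {-T..0} s \<partial>lborel)"
      unfolding I0_def by (rule nn_integral_lebesgue_on_borel) auto
    show ?thesis
    proof (cases "t < T \<and> I0 = \<infinity>")
      case True
      then have "V_norm V {-T..0} y0 = \<infinity>" using False by (simp add: Lp Lp_norm_def ennreal_powr_def I0_def)
      then show ?thesis using True T by (simp add: ennreal_mult_top)
    next
      case fin: False
      define w where "w = (if t < T then enn2real I0 powr (1 / ?q) else 0)"
      have w0: "w \<ge> 0" by (simp add: w_def)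
      have wV: "(if t < T then V_norm V {-T..0} y0 else 0) = ennreal w"
        using fin False by (auto simp: Lp Lp_norm_def ennreal_powr_def I0_def w_def)
      have wI: "t < T \<Longrightarrow> I0 = ennreal (w powr ?q)"
        using q fin by (simp add: w_def powr_powr less_top)
      have "(\<integral>\<^sup>+ s. ennreal (norm (?Y s) powr ?q) \<partial>lebesgue_on {-T..0})
          = (\<integral>\<^sup>+ s. ennreal (norm (?Y s) powr ?q) * indicator {-T..0} s \<partial>lborel)"
        by (rule nn_integral_lebesgue_on_borel) auto
      also have "\<dots> \<le> (\<integral>\<^sup>+ s. (if t < T then ennreal (norm (y0 (t + s)) powr ?q) * indicator {-T..0} (t + s) else 0)
          + ennreal (S powr ?q) * indicator {-T..0} s \<partial>lborel)"
      proof (rule nn_integral_mono)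
        fix s
        show "ennreal (norm (?Y s) powr ?q) * indicator {-T..0} s \<le>
          (if t < T then ennreal (norm (y0 (t + s)) powr ?q) * indicator {-T..0} (t + s) else 0) + ennreal (S powr ?q) * indicator {-T..0} s"
        proof (cases "s \<in> {-T..0}")
          case True
          show ?thesis
          proof (cases "t + s < 0")
            case neg: True
            then show ?thesis using True t Yc[OF neg] by auto
          next
            case False
            have "ennreal (norm (?Y s) powr ?q) \<le> ennreal (S powr ?q)"
              using Yb[OF True] False q by (intro ennreal_leI powr_mono2) auto
            then show ?thesis using True by (intro add_increasing) auto
          qed
        qed simp
      qed
      also have "\<dots> = (if t < T then I0 else 0) + ennreal (S powr ?q) * ennreal T"
        using T by (subst nn_integral_add) (auto simp: nn_integral_cmult I0 nn_integral_shift_le[of "\<lambda>s. ennreal (norm (y0 s) powr ?q)" t T])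
      also have "\<dots> \<le> ennreal ((w + S) powr ?q) + ennreal ((w + S) powr ?q) * ennreal T"
        using w0 S q wI by (intro add_mono mult_right_mono ennreal_leI) (auto intro!: ennreal_leI powr_mono2)
      also have "\<dots> = ennreal ((1 + T) * (w + S) powr ?q)"
        using T by (simp add: algebra_simps flip: ennreal_mult ennreal_plus)
      finally have "Lp_norm p {-T..0} ?Y \<le> ennreal ((1 + T) * (w + S))"
        using T w0 S by (intro Lp_norm_le[OF False q]) auto
      also have "\<dots> \<le> ennreal ((3 + T) * (w + S))" using T w0 S by (intro ennreal_leI mult_right_mono) auto
      also have "\<dots> = ennreal (3 + T) * (ennreal w + ennreal S)"
        using T w0 S by (simp add: ennreal_mult)
      finally show ?thesis unfolding wV using Lp by simp
    qed
  qed
next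
  case BV
  have le3: "ennreal 3 * c \<le> ennreal (3 + T) * c" for c
    using T by (intro mult_right_mono ennreal_leI) auto
  show ?thesis
  proof (cases "t < T")
    case False
    have "BV_norm {-T..0} (partial_trajectory X t) \<le> total_variation {-T..0} (partial_trajectory X t) + sup_norm {-T..0} (partial_trajectory X t)"
      unfolding BV_norm_def by (rule INF_lower) simp
    also have "\<dots> \<le> ennreal S + ennreal S"
    proof (rule add_mono)
      show "total_variation {-T..0} (partial_trajectory X t) \<le> ennreal S"
        unfolding partial_trajectory_def using False tv
        by (intro order_trans[OF total_variation_shift_le]) auto
      show "sup_norm {-T..0} (partial_trajectory X t) \<le> ennreal S"
        using False by (intro sup_norm_least ennreal_leI) (auto simp: partial_trajectory_def intro!: bnd)
    qed
    also have "\<dots> \<le> ennreal 3 * ennreal S"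
    proof -
      have "ennreal S + ennreal S = ennreal (2 * S)" using S by (simp flip: ennreal_plus)
      moreover have "ennreal 3 * ennreal S = ennreal (3 * S)" using S by (intro ennreal_mult[symmetric]) auto
      ultimately show ?thesis using S by (simp only: ennreal_leI)
    qed
    also note le3
    finally show ?thesis using False BV by simp
  next
    case True
    have "BV_norm {-T..0} (partial_trajectory X t) \<le> ennreal (3 + T) *
        ((INF g \<in> {g. AE s in lebesgue_on {-T..0}. g s = y0 s}. total_variation {-T..0} g + sup_norm {-T..0} g) + ennreal S)"
    proof (rule ennreal_le_mult_INF)
      fix g assume "g \<in> {g. AE s in lebesgue_on {-T..0}. g s = y0 s}"
      then have "AE s in lborel. s \<in> {-T..0} \<longrightarrow> g s = y0 s" by (simp add: AE_lebesgue_on_iff)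
      from AE_lborel_shift[OF this, of 1 t]
      have g: "AE s in lborel. t + s \<in> {-T..0} \<longrightarrow> g (t + s) = y0 (t + s)" by simp
      define Z where "Z = (\<lambda>s. if t + s < 0 then g (t + s) else X (t + s))"
      have "AE s in lebesgue_on {-T..0}. Z s = partial_trajectory X t s"
        unfolding AE_lebesgue_on_iff[OF borel_closed[OF closed_atLeastAtMost]] using g
        by eventually_elim (use t in \<open>auto simp: Z_def partial_trajectory_def X0\<close>)
      then have "BV_norm {-T..0} (partial_trajectory X t) \<le> total_variation {-T..0} Z + sup_norm {-T..0} Z"
        unfolding BV_norm_def by (intro INF_lower) simp
      also have "\<dots> \<le> (total_variation {-T..0} g + ennreal S + (ennreal S + sup_norm {-T..0} g)) + (sup_norm {-T..0} g + ennreal S)"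
      proof (rule add_mono)
        have "total_variation {-T..0} Z \<le> total_variation {-T..0} g + total_variation {0..t} X + ennreal (norm (X 0 - g 0))"
          unfolding Z_def by (rule total_variation_glue[OF t True])
        also have "\<dots> \<le> total_variation {-T..0} g + ennreal S + (ennreal S + sup_norm {-T..0} g)"
        proof (intro add_mono order_refl)
          show "total_variation {0..t} X \<le> ennreal S" using tv True by simp
          have "ennreal (norm (X 0 - g 0)) \<le> ennreal (norm (X 0)) + ennreal (norm (g 0))"
            by (simp add: norm_triangle_ineq4 flip: ennreal_plus)
          also have "\<dots> \<le> ennreal S + sup_norm {-T..0} g"
            using True t T by (intro add_mono ennreal_leI bnd sup_norm_upper) auto
          finally show "ennreal (norm (X 0 - g 0)) \<le> ennreal S + sup_norm {-T..0} g" .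
        qed
        finally show "total_variation {-T..0} Z \<le> total_variation {-T..0} g + ennreal S + (ennreal S + sup_norm {-T..0} g)" .
        show "sup_norm {-T..0} Z \<le> sup_norm {-T..0} g + ennreal S"
        proof (rule sup_norm_least)
          fix s assume s: "s \<in> {-T..0}"
          show "ennreal (norm (Z s)) \<le> sup_norm {-T..0} g + ennreal S"
          proof (cases "t + s < 0")
            case True
            then show ?thesis using s t by (auto simp: Z_def intro!: add_increasing2 sup_norm_upper)
          next
            case False
            then show ?thesis using s True bnd[of "t + s"] by (auto simp: Z_def intro!: add_increasing ennreal_leI)
          qed
        qed
      qed
      also have "\<dots> = total_variation {-T..0} g + 2 * sup_norm {-T..0} g + 3 * ennreal S"
      proof -
        have "a + s + (s + b) + (b + s) = a + 2 * b + 3 * s" for a b s :: ennreal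
        proof -
          have "3 * s = s + s + s" "2 * b = b + b"
            using distrib_right[of 2 1 s] distrib_right[of 1 1 s] distrib_right[of 1 1 b] by simp_all
          then show ?thesis by (simp add: ac_simps)
        qed
        then show ?thesis .
      qed
      also have "\<dots> \<le> 3 * total_variation {-T..0} g + 3 * sup_norm {-T..0} g + 3 * ennreal S"
        using mult_right_mono[of 1 3 "total_variation {-T..0} g"] by (intro add_mono mult_right_mono) auto
      also have "\<dots> = ennreal 3 * (total_variation {-T..0} g + sup_norm {-T..0} g + ennreal S)"
        by (simp add: distrib_left)
      also note le3
      finally show "BV_norm {-T..0} (partial_trajectory X t) \<le> ennreal (3 + T) * (total_variation {-T..0} g + sup_norm {-T..0} g + ennreal S)" .
    qed (use T in auto)
    then show ?thesis using True by (simp add: BV BV_norm_def)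
  qed
qed

lemma lipschitz_in_V_space:
  fixes f :: "real \<Rightarrow> 'a::euclidean_space"
  assumes V: "V = BV \<or> (\<exists>p\<ge>1. V = Lp p)" and ab: "a \<le> b" and cont: "continuous_on UNIV f"
    and L: "\<And>u v. a \<le> u \<Longrightarrow> u \<le> v \<Longrightarrow> v \<le> b \<Longrightarrow> norm (f v - f u) \<le> L * (v - u)"
  shows "f \<in> V_space V {a..b}"
proof -
  have fm: "f \<in> borel_measurable borel" using cont by (rule borel_measurable_continuous_onI)
  have "bounded (f ` {a..b})"
    by (intro compact_imp_bounded compact_continuous_image continuous_on_subset[OF cont]) auto
  then obtain K where K: "\<And>s. s \<in> {a..b} \<Longrightarrow> norm (f s) \<le> K" "K > 0"
    unfolding bounded_pos by blast
  have "V_norm V {a..b} f < \<infinity>"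
  proof (cases V)
    case (Lp p)
    with V have p: "1 \<le> p" by auto
    show ?thesis
    proof (cases "p = \<infinity>")
      case True
      have "esssup (lebesgue_on {a..b}) (\<lambda>s. ennreal (norm (f s))) \<le> ennreal K"
        by (intro esssup_I borel_measurable_lebesgue_on_borel AE_I2) (use fm K in \<open>auto intro!: ennreal_leI\<close>)
      then show ?thesis using True by (auto simp: Lp Lp_norm_def intro: order_le_less_trans)
    next
      case False
      have q: "enn2real p \<ge> 1" using p False by (rule enn2real_ge_1)
      have "(\<integral>\<^sup>+ s. ennreal (norm (f s) powr enn2real p) \<partial>lebesgue_on {a..b}) \<le> (\<integral>\<^sup>+ s. ennreal (K powr enn2real p) \<partial>lebesgue_on {a..b})"
        using K q by (intro nn_integral_mono ennreal_leI powr_mono2) auto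
      also have "\<dots> = ennreal (K powr enn2real p * (b - a))"
        using ab by (simp add: emeasure_restrict_space ennreal_mult)
      also have "\<dots> \<le> ennreal ((1 + (b - a)) * K powr enn2real p)"
        using ab by (intro ennreal_leI) (simp add: algebra_simps)
      finally have "Lp_norm p {a..b} f \<le> ennreal ((1 + (b - a)) * K)"
        using ab K by (intro Lp_norm_le[OF False q]) auto
      then show ?thesis by (auto simp: Lp intro: order_le_less_trans)
    qed
  next
    case BV
    have "BV_norm {a..b} f \<le> total_variation {a..b} f + sup_norm {a..b} f"
      unfolding BV_norm_def by (rule INF_lower) simp
    also have "\<dots> \<le> ennreal (L * b - L * a) + ennreal K"
      using L K ab by (intro add_mono total_variation_le sup_norm_least ennreal_leI) (auto simp: right_diff_distrib)
    also have "\<dots> < \<infinity>" by simp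
    finally show ?thesis by (simp add: BV)
  qed
  then show ?thesis using fm by (simp add: V_space_def borel_measurable_lebesgue_on_borel)
qed

section \<open>Solutions of the delay equation decay\<close>

text \<open>
  Histories and kernels are Lebesgue measurable only, whereas Fubini is applied on products with the Borel-Lebesgue
  measure; both are therefore replaced by Borel versions.
\<close>

lemma ex_borel_version:
  fixes f :: "real \<Rightarrow> 'a::euclidean_space"
  assumes f: "f \<in> borel_measurable lebesgue"
  shows "\<exists>g\<in>borel_measurable borel. AE x in lborel. f x = g x"
proof -
  have "\<forall>i\<in>Basis. \<exists>g. g \<in> borel_measurable borel \<and> (AE x in lborel. f x \<bullet> i = g x)"
  proof
    fix i :: 'a
    have "(\<lambda>x. f x \<bullet> i) \<in> borel_measurable (completion lborel)" using f by auto
    then show "\<exists>g. g \<in> borel_measurable borel \<and> (AE x in lborel. f x \<bullet> i = g x)"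
      using completion_ex_borel_measurable_real[of "\<lambda>x. f x \<bullet> i" lborel] by auto
  qed
  then obtain g where g: "\<And>i. i \<in> Basis \<Longrightarrow> g i \<in> borel_measurable borel"
    "\<And>i. i \<in> Basis \<Longrightarrow> AE x in lborel. f x \<bullet> i = g i x" by metis
  have "(\<lambda>x. \<Sum>i\<in>Basis. g i x *\<^sub>R i) \<in> borel_measurable borel"
    using g(1) by (intro borel_measurable_sum borel_measurable_scaleR) auto
  moreover have "AE x in lborel. \<forall>i\<in>Basis. f x \<bullet> i = g i x"
    using g(2) by (intro AE_finite_allI) auto
  then have "AE x in lborel. f x = (\<Sum>i\<in>Basis. g i x *\<^sub>R i)"
  proof (rule eventually_mono)
    fix x assume "\<forall>i\<in>Basis. f x \<bullet> i = g i x"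
    then have "(\<Sum>i\<in>Basis. g i x *\<^sub>R i) = (\<Sum>i\<in>Basis. (f x \<bullet> i) *\<^sub>R i)" by (simp cong: sum.cong)
    then show "f x = (\<Sum>i\<in>Basis. g i x *\<^sub>R i)" by (simp only: euclidean_representation)
  qed
  ultimately show ?thesis by (rule bexI[where x="\<lambda>x. \<Sum>i\<in>Basis. g i x *\<^sub>R i", rotated])
qed

lemma measurable_lebesgue_on_AE:
  fixes f g :: "real \<Rightarrow> 'a::euclidean_space"
  assumes "g \<in> borel_measurable borel" "C \<in> sets borel" "AE s in lborel. s \<in> C \<longrightarrow> f s = g s"
  shows "f \<in> borel_measurable (lebesgue_on C)"
proof -
  have "(\<lambda>s. indicator C s *\<^sub>R g s) \<in> borel_measurable lebesgue"
    using assms by (intro measurable_completion) auto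
  moreover have "AE s in lebesgue. indicator C s *\<^sub>R g s = indicator C s *\<^sub>R f s"
    using assms(3) unfolding AE_completion_iff by eventually_elim (auto simp: indicator_def)
  ultimately have "(\<lambda>s. indicator C s *\<^sub>R f s) \<in> borel_measurable lebesgue"
    by (rule borel_measurable_AE)
  then show ?thesis using assms(2) by (subst borel_measurable_restrict_space_iff) auto
qed

text \<open>
  A function on the product of the counting measure with Lebesgue measure: the fibre over \<open>0\<close> carries the density
  \<open>\<phi>\<close>, and the fibre over \<open>Suc k\<close> carries the atom \<open>\<psi> k\<close>, spread over an interval of length \<open>1\<close>, so that integration
  yields the integral of \<open>\<phi>\<close> plus the sum of \<open>\<psi>\<close>.
\<close>

definition mixed :: "(real \<Rightarrow> 'a) \<Rightarrow> (nat \<Rightarrow> 'a) \<Rightarrow> nat \<times> real \<Rightarrow> 'a::real_vector" where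
  "mixed \<phi> \<psi> = (\<lambda>(k, s). case k of 0 \<Rightarrow> \<phi> s | Suc k \<Rightarrow> indicator {0<..<1} s *\<^sub>R \<psi> k)"

lemma mixed_measurable:
  fixes \<phi> :: "real \<Rightarrow> 'a::{banach, second_countable_topology}"
  assumes "\<phi> \<in> borel_measurable borel"
  shows "(mixed \<phi> \<psi>)
     \<in> borel_measurable (count_space UNIV \<Otimes>\<^sub>M (lborel :: real measure))"
proof (rule measurable_pair_measure_countable1)
  fix k :: nat
  show "(\<lambda>y. mixed \<phi> \<psi> (k, y)) \<in> borel_measurable lborel"
    using assms by (cases k) (auto simp: mixed_def)
qed auto

lemma mixed_integrable:
  fixes \<phi> :: "real \<Rightarrow> 'a::{banach, second_countable_topology}"
  assumes \<phi>: "integrable lborel \<phi>" and \<psi>: "summable (\<lambda>k. norm (\<psi> k))"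
  shows "integrable (count_space UNIV \<Otimes>\<^sub>M lborel) (mixed \<phi> \<psi>)"
proof -
  interpret P: pair_sigma_finite "count_space (UNIV :: nat set)" "lborel :: real measure"
    by (intro pair_sigma_finite.intro sigma_finite_measure_count_space lborel.sigma_finite_measure_axioms)
  show ?thesis
  proof (rule P.Fubini_integrable)
    show "(mixed \<phi> \<psi>) \<in> borel_measurable (count_space UNIV \<Otimes>\<^sub>M lborel)"
      using \<phi> by (intro mixed_measurable) auto
    show "AE k in count_space UNIV. integrable lborel (\<lambda>s. mixed \<phi> \<psi> (k, s))"
    proof (rule AE_I2)
      fix k :: nat
      show "integrable lborel (\<lambda>s. mixed \<phi> \<psi> (k, s))"
        using \<phi> by (cases k) (auto simp: mixed_def)
    qed
    let ?n = "\<lambda>k. LINT s|lborel. norm (mixed \<phi> \<psi> (k, s))"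
    have "?n (Suc k) = norm (\<psi> k)" for k by (simp add: mixed_def)
    then have "summable (\<lambda>k. norm (?n (Suc k)))" using \<psi> by simp
    then have "summable (\<lambda>k. norm (?n k))" using summable_Suc_iff by blast
    then show "integrable (count_space UNIV) ?n" by (simp only: integrable_count_space_nat_iff)
  qed
qed

lemma mixed_integral:
  fixes \<phi> :: "real \<Rightarrow> 'a::{banach, second_countable_topology}"
  assumes int: "integrable (count_space UNIV \<Otimes>\<^sub>M lborel) (mixed \<phi> \<psi>)"
  shows "(LINT r|(count_space UNIV \<Otimes>\<^sub>M lborel). mixed \<phi> \<psi> r)
      = (LINT s|lborel. \<phi> s) + (\<Sum>k. \<psi> k)"
proof -
  interpret P: pair_sigma_finite "count_space (UNIV :: nat set)" "lborel :: real measure"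
    by (intro pair_sigma_finite.intro sigma_finite_measure_count_space lborel.sigma_finite_measure_axioms)
  have i: "integrable (count_space UNIV) (\<lambda>k. LINT s|lborel. mixed \<phi> \<psi> (k, s))" using P.integrable_fst'[OF int] .
  have "(\<lambda>k. LINT s|lborel. mixed \<phi> \<psi> (k, s)) sums (LINT k|count_space UNIV. LINT s|lborel. mixed \<phi> \<psi> (k, s))"
    by (rule sums_integral_count_space_nat[OF i])
  also have "(LINT k|count_space UNIV. LINT s|lborel. mixed \<phi> \<psi> (k, s)) = (LINT r|(count_space UNIV \<Otimes>\<^sub>M lborel). mixed \<phi> \<psi> r)"
    by (rule P.integral_fst'[OF int])
  finally have s: "(\<lambda>k. LINT s|lborel. mixed \<phi> \<psi> (k, s)) sums (LINT r|(count_space UNIV \<Otimes>\<^sub>M lborel). mixed \<phi> \<psi> r)" .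
  have "(\<Sum>k. LINT s|lborel. mixed \<phi> \<psi> (k, s)) = (\<Sum>k. LINT s|lborel. mixed \<phi> \<psi> (Suc k, s)) + (LINT s|lborel. mixed \<phi> \<psi> (0, s))"
    using suminf_split_head[OF sums_summable[OF s]] by simp
  then show ?thesis using sums_unique[OF s] by (simp add: add.commute mixed_def)
qed

locale delay_equation =
  fixes T :: real and A :: "nat \<Rightarrow> real^'n^'n" and \<tau> :: "nat \<Rightarrow> real" and N Nb :: "real \<Rightarrow> real^'n^'n"
  assumes T: "T > 0" and A: "summable (\<lambda>k. norm (A k))" and \<tau>: "\<And>k. 0 < \<tau> k" "\<And>k. \<tau> k \<le> T"
    and Nb: "Nb \<in> borel_measurable borel" "integrable lborel (\<lambda>s. indicator {0<..<T} s *\<^sub>R Nb s)"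
    and N_Nb: "AE s in lborel. s \<in> {0<..<T} \<longrightarrow> N s = Nb s"
begin

definition delay_measure :: "(nat \<times> real) measure" where "delay_measure = count_space UNIV \<Otimes>\<^sub>M lborel"

definition weight :: "nat \<times> real \<Rightarrow> real^'n^'n" where
  "weight = mixed (\<lambda>s. indicator {0<..<T} s *\<^sub>R Nb s) A"

definition lag :: "nat \<times> real \<Rightarrow> real" where
  "lag = (\<lambda>(k, s). case k of 0 \<Rightarrow> indicator {0<..<T} s *\<^sub>R s | Suc k \<Rightarrow> \<tau> k)"

lemma delay_kernel: "delay_kernel delay_measure weight lag T"
proof (intro delay_kernel.intro delay_kernel_axioms.intro)
  interpret P: pair_sigma_finite "count_space (UNIV :: nat set)" "lborel :: real measure"
    by (intro pair_sigma_finite.intro sigma_finite_measure_count_space lborel.sigma_finite_measure_axioms)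
  show "sigma_finite_measure delay_measure" unfolding delay_measure_def by (rule P.sigma_finite_measure_axioms)
  show "integrable delay_measure weight" unfolding delay_measure_def weight_def by (rule mixed_integrable[OF Nb(2) A])
  show "lag \<in> borel_measurable delay_measure"
    unfolding delay_measure_def
  proof (rule measurable_pair_measure_countable1)
    show "(\<lambda>y. lag (k, y)) \<in> borel_measurable lborel" for k by (cases k) (auto simp: lag_def)
  qed auto
  show "0 \<le> lag r" "lag r \<le> T" for r
    using less_imp_le[OF T] by (auto simp: lag_def indicator_def less_imp_le \<tau> split: nat.split prod.split)
qed

sublocale delay_kernel delay_measure weight lag T by (rule delay_kernel)

lemma conv_eq:
  assumes "integrable delay_measure (\<lambda>r. weight r *v u (t - lag r))"
  shows "conv u t = (LINT s|lborel. indicator {0<..<T} s *\<^sub>R (Nb s *v u (t - s))) + (\<Sum>k. A k *v u (t - \<tau> k))"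
proof -
  interpret m: bounded_bilinear "(*v) :: real^'n^'n \<Rightarrow> _" by (rule bounded_bilinear_matrix_vector_mult)
  have eq: "(\<lambda>r. weight r *v u (t - lag r))
      = mixed (\<lambda>s. indicator {0<..<T} s *\<^sub>R (Nb s *v u (t - s))) (\<lambda>k. A k *v u (t - \<tau> k))"
    by (auto simp: fun_eq_iff mixed_def weight_def lag_def m.scaleR_left indicator_def split: nat.split)
  show ?thesis unfolding conv_def eq by (rule mixed_integral[OF assms[unfolded eq delay_measure_def], folded delay_measure_def])
qed

lemma char_matrix_eq: "char_matrix T A \<tau> N z = mat z + symbol z"
proof -
  let ?F = "\<lambda>s M. map_matrix (\<lambda>a. complex_of_real a * exp (- of_real s * z)) M"
  let ?f = "\<lambda>s. indicator {0<..<T} s *\<^sub>R ?F s (Nb s)"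
  have eq: "kernel z = mixed ?f (\<lambda>k. ?F (\<tau> k) (A k))"
  proof
    fix r :: "nat \<times> real"
    obtain k s where r: "r = (k, s)" by force
    show "kernel z r = mixed ?f (\<lambda>k. ?F (\<tau> k) (A k)) r"
      unfolding kernel_def r by (cases k) (auto simp: mixed_def weight_def lag_def indicator_def vec_eq_iff)
  qed
  have s: "symbol z = (LINT s|lborel. ?f s) + (\<Sum>k. ?F (\<tau> k) (A k))"
    unfolding symbol_def eq by (rule mixed_integral[OF kernel_integrable[of z, unfolded eq delay_measure_def], folded delay_measure_def])
  have m: "?f \<in> borel_measurable borel"
  proof (rule borel_measurable_scaleR)
    show "(\<lambda>s. ?F s (Nb s)) \<in> borel_measurable borel"
      unfolding map_matrix_def
      by (rule borel_measurable_continuous_Pair[where H="\<lambda>x A. \<chi> i j. of_real (A $ i $ j) * exp (- of_real x * z)"])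
         (auto intro!: continuous_intros continuous_on_vec_lambda Nb)
  qed auto
  have ae: "AE s in lborel. ?f s
     = indicator {0<..<T} s *\<^sub>R ?F s (N s)"
    using N_Nb by eventually_elim (auto simp: indicator_def)
  have "(LINT s:{0<..<T}|lebesgue. ?F s (N s))
      = (LINT s|lebesgue. ?f s)"
    unfolding set_lebesgue_integral_def
  proof (rule integral_cong_AE)
    show 1: "?f \<in> borel_measurable lebesgue"
      using m by (intro measurable_completion) simp
    show "(\<lambda>s. indicator {0<..<T} s *\<^sub>R ?F s (N s)) \<in> borel_measurable lebesgue"
      by (rule borel_measurable_AE[OF 1]) (use ae in \<open>simp add: AE_completion_iff\<close>)
  qed (use ae in \<open>auto simp: AE_completion_iff elim!: eventually_mono\<close>)
  also have "\<dots> = (LINT s|lborel. ?f s)"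
    using m by (intro integral_completion) simp
  finally show ?thesis unfolding char_matrix_def s by (simp add: ac_simps)
qed

text \<open>
  At almost every \<open>t\<close> the solution agrees with its Borel version \<open>u\<close> at all times that the equation refers to;
  then the guarded form of the equation reduces to \<open>X' t = - conv u t\<close>.
\<close>

lemma derivative_eq_conv:
  assumes int: "integrable delay_measure (\<lambda>r. weight r *v u (t - lag r))"
    and eq1: "\<And>k. X (t - \<tau> k) = u (t - \<tau> k)"
    and eq2: "AE s in lborel. s \<in> {0<..<T} \<longrightarrow> X (t - s) = u (t - s)"
    and um: "u \<in> borel_measurable borel"
    and dde: "dde_at T A \<tau> N X t"
  shows "vector_derivative X (at t) = - conv u t"
proof -
  have m: "(\<lambda>s. indicator {0<..<T} s *\<^sub>R (Nb s *v u (t - s))) \<in> borel_measurable borel"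
  proof (rule borel_measurable_scaleR)
    show "(\<lambda>s. Nb s *v u (t - s)) \<in> borel_measurable borel"
      using um Nb(1) by (intro borel_measurable_continuous_Pair[where H="(*v)"] bounded_bilinear.continuous_on[OF bounded_bilinear_matrix_vector_mult])
        (auto intro!: continuous_intros)
  qed auto
  have "(LINT s:{0<..<T}|lebesgue. N s *v X (t - s)) = (LINT s|lebesgue. indicator {0<..<T} s *\<^sub>R (Nb s *v u (t - s)))"
    unfolding set_lebesgue_integral_def
  proof (rule integral_cong_AE)
    show "(\<lambda>s. indicator {0<..<T} s *\<^sub>R (N s *v X (t - s))) \<in> borel_measurable lebesgue"
      using dde by (auto simp: dde_at_def set_integrable_def)
    show "(\<lambda>s. indicator {0<..<T} s *\<^sub>R (Nb s *v u (t - s))) \<in> borel_measurable lebesgue"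
      using m by (intro measurable_completion) simp
    show "AE s in lebesgue. indicator {0<..<T} s *\<^sub>R (N s *v X (t - s)) = indicator {0<..<T} s *\<^sub>R (Nb s *v u (t - s))"
      unfolding AE_completion_iff using N_Nb eq2 by eventually_elim (auto simp: indicator_def)
  qed
  also have "\<dots> = (LINT s|lborel. indicator {0<..<T} s *\<^sub>R (Nb s *v u (t - s)))"
    using m by (intro integral_completion) simp
  finally have "conv u t = (\<Sum>k. A k *v X (t - \<tau> k)) + (LINT s:{0<..<T}|lebesgue. N s *v X (t - s))"
    by (simp add: conv_eq[OF int] eq1)
  then have "vector_derivative X (at t) + conv u t = 0" using dde by (simp add: dde_at_def add.assoc)
  then show ?thesis by (simp only: eq_neg_iff_add_eq_0)
qed

end

context delay_equation begin

text \<open>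
  The solution is split into a Borel version \<open>y0\<close> of its history and its part \<open>x\<close> on the half-line.  Each delay
  \<open>\<tau> k\<close> shifts the null set where \<open>X\<close> differs from \<open>y0 + x\<close>; countably many delays still leave a null set.
\<close>

lemma solution_volterra:
  fixes X X0 :: "real \<Rightarrow> real^'n"
  assumes V: "V = BV \<or> (\<exists>p\<ge>1. V = Lp p)"
    and X0: "X0 \<in> V_space V {-T..0}" and sol: "dde_solution V T A \<tau> N X0 x0 X"
  obtains y0 x where
    "y0 \<in> borel_measurable borel" "\<And>s. s \<notin> {-T..<0} \<Longrightarrow> y0 s = 0" "integrable lborel y0"
    "AE s in lborel. s \<in> {-T..0} \<longrightarrow> X0 s = y0 s"
    "continuous_on {0..} x" "\<And>s. s < 0 \<Longrightarrow> x s = 0" "\<And>s. s \<ge> 0 \<Longrightarrow> x s = X s"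
    "AE s in lborel. s \<ge> -T \<longrightarrow> X s = y0 s + x s"
    "\<And>R. integrable lborel (\<lambda>s. indicator {..R} s *\<^sub>R (y0 s + x s))"
    "\<And>a b. 0 \<le> a \<Longrightarrow> a \<le> b \<Longrightarrow> X b - X a = - (LINT s:{a..b}|lborel. conv (\<lambda>s. y0 s + x s) s)"
    "\<And>t. t \<ge> 0 \<Longrightarrow> x t = x0 + (LINT s:{0..t}|lborel. - (indicator {0..T} s *\<^sub>R conv y0 s) - conv x s)"
proof -
  have X0m: "X0 \<in> borel_measurable (lebesgue_on {-T..0})" and X0V: "V_norm V {-T..0} X0 < \<infinity>"
    using X0 by (auto simp: V_space_def)
  have "(\<lambda>s. indicator {-T..0} s *\<^sub>R X0 s) \<in> borel_measurable lebesgue"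
    using X0m by (subst borel_measurable_restrict_space_iff[symmetric]) auto
  then obtain Xb where Xb: "Xb \<in> borel_measurable borel" "AE s in lborel. indicator {-T..0} s *\<^sub>R X0 s = Xb s"
    using ex_borel_version by blast
  define y0 where "y0 = (\<lambda>s. indicator {-T..<0} s *\<^sub>R Xb s)"
  have y0m[measurable]: "y0 \<in> borel_measurable borel" unfolding y0_def using Xb(1) by measurable
  have y0_out: "y0 s = 0" if "s \<notin> {-T..<0}" for s using that by (simp add: y0_def)
  have y0_ae: "AE s in lborel. s \<in> {-T..0} \<longrightarrow> X0 s = y0 s"
    using Xb(2) AE_lborel_singleton[of "0::real"] by eventually_elim (auto simp: y0_def indicator_def)
  have y0i: "integrable lborel y0"
  proof (rule integrableI_bounded)
    have "(\<integral>\<^sup>+ s. ennreal (norm (y0 s)) \<partial>lborel) = (\<integral>\<^sup>+ s. ennreal (norm (y0 s)) * indicator {-T..0} s \<partial>lborel)"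
      by (intro nn_integral_cong) (auto simp: indicator_def y0_out)
    also have "\<dots> = (\<integral>\<^sup>+ s. ennreal (norm (y0 s)) \<partial>lebesgue_on {-T..0})"
      by (rule nn_integral_lebesgue_on_borel[symmetric]) auto
    also have "\<dots> = (\<integral>\<^sup>+ s. ennreal (norm (X0 s)) \<partial>lebesgue_on {-T..0})"
      using y0_ae by (intro nn_integral_cong_AE) (auto simp: AE_lebesgue_on_iff elim!: eventually_mono)
    also have "\<dots> \<le> ennreal (1 + (0 - (-T))) * V_norm V {-T..0} X0"
      using T by (intro V_norm_dominates_L1[OF V X0m]) auto
    also have "\<dots> < \<infinity>" using X0V by (simp add: ennreal_mult_less_top)
    finally show "(\<integral>\<^sup>+ s. ennreal (norm (y0 s)) \<partial>lborel) < \<infinity>" .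
  qed simp
  have ac: "absolutely_continuous_on {a..b} X" if "0 \<le> a" "a \<le> b" for a b
    using sol that by (auto simp: dde_solution_def)
  have contX: "continuous_on {0..} X"
  proof (rule continuous_on_atLeast)
    show "continuous_on {0..R} X" for R :: real
      by (cases "0 \<le> R") (auto intro: absolutely_continuous_on_imp_continuous_on ac)
  qed
  define x where "x = (\<lambda>s. if s < 0 then 0 else X s)"
  have x: "continuous_on {0..} x" "\<And>s. s < 0 \<Longrightarrow> x s = 0" "\<And>s. s \<ge> 0 \<Longrightarrow> x s = X s"
    using contX by (auto simp: x_def intro: continuous_on_eq)
  have xm[measurable]: "x \<in> borel_measurable borel" by (rule continuous_on_halfline_measurable[OF x(1,2)])
  note xi = halfline_locally_integrable[OF x(1,2)]
  define u where "u = (\<lambda>s. y0 s + x s)"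
  have um: "u \<in> borel_measurable borel" unfolding u_def by measurable
  have ui: "integrable lborel (\<lambda>s. indicator {..R} s *\<^sub>R u s)" for R
    using Bochner_Integration.integrable_add[OF integrable_mult_indicator[OF _ y0i, of "{..R}"] xi]
    by (simp add: u_def scaleR_add_right)
  have X_u: "AE s in lborel. s \<ge> -T \<longrightarrow> X s = u s"
  proof -
    have "AE s in lborel. s \<in> {-T..<0} \<longrightarrow> X s = X0 s"
      using sol by (auto simp: dde_solution_def AE_lebesgue_on_iff)
    then show ?thesis using y0_ae
      by eventually_elim (auto simp: u_def x_def y0_out not_less)
  qed
  have int_ae: "AE t in lborel. integrable delay_measure (\<lambda>r. weight r *v u (t - lag r))" by (rule conv_local(1)[OF ui])
  have "AE t in lborel. t > 0 \<longrightarrow> X differentiable (at t) \<and> vector_derivative X (at t) = - conv u t"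
  proof -
    have 1: "AE t in lborel. t \<in> {0<..} \<longrightarrow> dde_at T A \<tau> N X t"
      using sol by (auto simp: dde_solution_def AE_lebesgue_on_iff)
    have "AE t in lborel. \<forall>k. t - \<tau> k \<ge> -T \<longrightarrow> X (t - \<tau> k) = u (t - \<tau> k)"
      unfolding AE_all_countable
    proof
      fix k
      show "AE t in lborel. t - \<tau> k \<ge> -T \<longrightarrow> X (t - \<tau> k) = u (t - \<tau> k)"
        using AE_lborel_shift[OF X_u, of 1 "- \<tau> k"] by simp
    qed
    then show ?thesis using 1 int_ae
    proof eventually_elim
      case (elim t)
      show ?case
      proof
        assume t: "t > 0"
        have "AE s in lborel. t - s \<ge> -T \<longrightarrow> X (t - s) = u (t - s)"
          using AE_lborel_shift[OF X_u, of "-1" t] by simp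
        then have 2: "AE s in lborel. s \<in> {0<..<T} \<longrightarrow> X (t - s) = u (t - s)"
          by (rule eventually_mono) (use t in auto)
        have 3: "X (t - \<tau> k) = u (t - \<tau> k)" for k
          using elim t \<tau>(2)[of k] by auto
        have 4: "dde_at T A \<tau> N X t" using elim t by auto
        show "X differentiable (at t) \<and> vector_derivative X (at t) = - conv u t"
          using derivative_eq_conv[OF elim(3) 3 2 um 4] 4 by (simp add: dde_at_def)
      qed
    qed
  qed
  then obtain S where S: "S \<in> null_sets lborel"
     "\<And>t. t \<notin> S \<Longrightarrow> t > 0 \<Longrightarrow> X differentiable (at t) \<and> vector_derivative X (at t) = - conv u t"
    by (auto simp: eventually_ae_filter)
  have negl: "negligible (insert 0 S)"
    using S(1) by (simp add: negligible_iff_null_sets null_sets_completionI)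
  have ftc: "X b - X a = - (LINT s:{a..b}|lborel. conv u s)" if ab: "0 \<le> a" "a \<le> b" for a b
  proof -
    have "((\<lambda>t. - conv u t) has_integral (X b - X a)) {a..b}"
    proof (rule absolutely_continuous_on_FTC[OF ab(2) ac[OF ab] negl])
      fix t assume t: "t \<in> {a..b} - insert 0 S"
      then have "X differentiable (at t)" "vector_derivative X (at t) = - conv u t"
        using S(2)[of t] ab by auto
      then show "(X has_vector_derivative - conv u t) (at t within {a..b})"
        by (metis has_vector_derivative_at_within vector_derivative_works)
    qed
    moreover have si: "set_integrable lborel {a..b} (conv u)" by (rule conv_local(2)[OF ui])
    then have "((\<lambda>t. - conv u t) has_integral - (LINT s:{a..b}|lborel. conv u s)) {a..b}"
      using set_borel_integral_eq_integral[OF si] by (intro has_integral_neg) (metis integrable_integral)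
    ultimately show ?thesis by (rule has_integral_unique)
  qed
  have volt: "x t = x0 + (LINT s:{0..t}|lborel. - (indicator {0..T} s *\<^sub>R conv y0 s) - conv x s)" if t: "t \<ge> 0" for t
  proof -
    have "X t = x0 - (LINT s:{0..t}|lborel. conv u s)"
      using ftc[of 0 t] t sol by (auto simp: dde_solution_def algebra_simps)
    also have "(LINT s:{0..t}|lborel. conv u s) = - (LINT s:{0..t}|lborel. - (indicator {0..T} s *\<^sub>R conv y0 s) - conv x s)"
    proof -
      have "(LINT s:{0..t}|lborel. conv u s) = (LINT s:{0..t}|lborel. - (- (indicator {0..T} s *\<^sub>R conv y0 s) - conv x s))"
        unfolding set_lebesgue_integral_def
      proof (rule integral_cong_AE)
        show "(\<lambda>s. indicator {0..t} s *\<^sub>R conv u s) \<in> borel_measurable lborel"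
          using conv_local(2)[OF ui, of 0 t] by (auto simp: set_integrable_def)
        have "conv y0 \<in> borel_measurable borel" using conv_integrable(2)[OF y0i] by auto
        moreover have "(\<lambda>s. indicator {0..t} s *\<^sub>R conv x s) \<in> borel_measurable borel"
          using conv_local(2)[OF xi, of 0 t] by (auto simp: set_integrable_def)
        ultimately have "(\<lambda>s. indicator {0..t} s *\<^sub>R (indicator {0..T} s *\<^sub>R conv y0 s) + indicator {0..t} s *\<^sub>R conv x s) \<in> borel_measurable borel"
          by measurable
        then show "(\<lambda>s. indicator {0..t} s *\<^sub>R - (- (indicator {0..T} s *\<^sub>R conv y0 s) - conv x s)) \<in> borel_measurable lborel"
          by (simp add: scaleR_add_right add.commute)
        have "AE s in lborel. integrable delay_measure (\<lambda>r. weight r *v y0 (s - lag r))" by (rule conv_integrable(1)[OF y0i])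
        moreover have "AE s in lborel. integrable delay_measure (\<lambda>r. weight r *v x (s - lag r))" by (rule conv_local(1)[OF xi])
        ultimately show "AE s in lborel. indicator {0..t} s *\<^sub>R conv u s = indicator {0..t} s *\<^sub>R - (- (indicator {0..T} s *\<^sub>R conv y0 s) - conv x s)"
        proof eventually_elim
          case (elim s)
          have "conv u s = conv y0 s + conv x s"
            using Bochner_Integration.integral_add[OF elim] by (simp add: conv_def u_def matrix_vector_right_distrib)
          moreover have "conv y0 s = indicator {0..T} s *\<^sub>R conv y0 s" if "s \<ge> 0"
          proof (cases "s \<le> T")
            case False
            then have "conv y0 s = conv (\<lambda>_. 0) s" by (intro conv_cong y0_out) auto
            then show ?thesis using False by (simp add: conv_def)
          qed (use that in auto)
          ultimately show ?case by (auto simp: indicator_def)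
        qed
      qed
      then show ?thesis
        by (simp only: set_lebesgue_integral_def scaleR_minus_right Bochner_Integration.integral_minus)
    qed
    finally show ?thesis using t x(3) by simp
  qed
  show ?thesis
    by (rule that[OF y0m y0_out y0i y0_ae x X_u[unfolded u_def] ui[unfolded u_def] ftc[unfolded u_def] volt])
qed

text \<open>
  Write \<open>J\<close> for the norm of the data and \<open>E = exp (- \<nu> t) J\<close>.  The constant \<open>C1\<close> bounds \<open>\<bar>X t\<bar>\<close> by a multiple of \<open>E\<close>, and
  \<open>C2\<close> bounds the supremum and the variation of \<open>X\<close> over the window \<open>[t - T, t]\<close> intersected with the half-line.
\<close>

theorem decay_of_roots:
  assumes V: "V = BV \<or> (\<exists>p\<ge>1. V = Lp p)" and nu: "\<nu> \<ge> 0"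
    and roots: "\<And>z. det (char_matrix T A \<tau> N z) = 0 \<Longrightarrow> Re z < - \<nu>"
  shows "\<exists>C\<ge>1. exp_decay V T A \<tau> N \<nu> C"
proof -
  have det: "det (mat z + symbol z) \<noteq> 0" if "- \<nu> \<le> Re z" for z
    using roots[of z] that by (auto simp: char_matrix_eq)
  obtain C where C: "C \<ge> 0" "\<And>f x x0 t. integrable lborel f \<Longrightarrow> (\<forall>t. t \<notin> {0..T} \<longrightarrow> f t = 0) \<Longrightarrow>
      continuous_on {0..} x \<Longrightarrow> (\<forall>t<0. x t = 0) \<Longrightarrow>
      (\<forall>t\<ge>0. x t = x0 + (LINT s:{0..t}|lborel. f s - conv x s)) \<Longrightarrow> 0 \<le> t \<Longrightarrow>
      norm (x t) \<le> C * exp (- \<nu> * t) * (norm x0 + (LINT s|lborel. norm (f s)))"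
    using volterra_decay[OF nu det] by blast
  define C1 where "C1 = C * (1 + mass * (1 + T))"
  define C2 where "C2 = C1 * exp (\<nu> * T) + mass * (exp (2 * \<nu> * T) * ((1 + T) + 2 * T * C1))"
  define C3 where "C3 = 1 + ((3 + T) * (exp (\<nu> * T) + C2) + C1)"
  have C1: "C1 \<ge> 0" using C(1) T mass_nonneg by (simp add: C1_def)
  have C2: "C2 \<ge> 0" using C1 T mass_nonneg by (simp add: C2_def)
  have C3: "C3 \<ge> 1" using C1 C2 T by (simp add: C3_def)
  have "exp_decay V T A \<tau> N \<nu> C3"
    unfolding exp_decay_def
  proof (intro ballI allI impI)
    fix X0 X :: "real \<Rightarrow> real^'n" and x0 :: "real^'n" and t :: real
    assume X0: "X0 \<in> V_space V {-T..0}" and sol: "dde_solution V T A \<tau> N X0 x0 X" and t: "0 \<le> t"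
    obtain y0 x where y0m[measurable]: "y0 \<in> borel_measurable borel" and y0_out: "\<And>s. s \<notin> {-T..<0} \<Longrightarrow> y0 s = 0"
      and y0i: "integrable lborel y0" and y0_ae: "AE s in lborel. s \<in> {-T..0} \<longrightarrow> X0 s = y0 s"
      and x: "continuous_on {0..} x" and x_neg: "\<And>s. s < 0 \<Longrightarrow> x s = 0" and xX: "\<And>s. s \<ge> 0 \<Longrightarrow> x s = X s"
      and X_u: "AE s in lborel. s \<ge> -T \<longrightarrow> X s = y0 s + x s"
      and ui: "\<And>R. integrable lborel (\<lambda>s. indicator {..R} s *\<^sub>R (y0 s + x s))"
      and ftc: "\<And>a b. 0 \<le> a \<Longrightarrow> a \<le> b \<Longrightarrow> X b - X a = - (LINT s:{a..b}|lborel. conv (\<lambda>s. y0 s + x s) s)"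
      and volt: "\<And>t. t \<ge> 0 \<Longrightarrow> x t = x0 + (LINT s:{0..t}|lborel. - (indicator {0..T} s *\<^sub>R conv y0 s) - conv x s)"
    proof (rule solution_volterra[OF V X0 sol], goal_cases)
      case (1 y0 x)
      show ?case by (rule 1(1)[OF 1(2-12)])
    qed
    define u where "u = (\<lambda>s. y0 s + x s)"
    have xm[measurable]: "x \<in> borel_measurable borel" by (rule continuous_on_halfline_measurable[OF x x_neg])
    have um[measurable]: "u \<in> borel_measurable borel" unfolding u_def by measurable
    have X0m: "X0 \<in> borel_measurable (lebesgue_on {-T..0})" and X0V: "V_norm V {-T..0} X0 < \<infinity>"
      using X0 by (auto simp: V_space_def)
    define W where "W = enn2real (V_norm V {-T..0} X0)"
    have W: "V_norm V {-T..0} X0 = ennreal W" "W \<ge> 0" using X0V by (auto simp: W_def)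
    define J where "J = W + norm x0"
    have J: "J \<ge> 0" "W \<le> J" "norm x0 \<le> J" using W by (auto simp: J_def)
    have y0V: "V_norm V {-T..0} y0 = ennreal W"
      unfolding W(1)[symmetric]
    proof (rule V_norm_cong_AE)
      show "AE s in lebesgue_on {- T..0}. y0 s = X0 s"
        using y0_ae by (auto simp: AE_lebesgue_on_iff elim!: eventually_mono)
    qed (auto intro!: X0m borel_measurable_lebesgue_on_borel)
    have y0L1: "(LINT s|lborel. norm (y0 s)) \<le> (1 + T) * W"
    proof -
      have "ennreal (LINT s|lborel. norm (y0 s)) = (\<integral>\<^sup>+ s. ennreal (norm (y0 s)) \<partial>lborel)"
        using y0i by (intro nn_integral_eq_integral[symmetric]) auto
      also have "\<dots> = (\<integral>\<^sup>+ s. ennreal (norm (y0 s)) * indicator {-T..0} s \<partial>lborel)"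
        by (intro nn_integral_cong) (auto simp: indicator_def y0_out)
      also have "\<dots> = (\<integral>\<^sup>+ s. ennreal (norm (y0 s)) \<partial>lebesgue_on {-T..0})"
        by (rule nn_integral_lebesgue_on_borel[symmetric]) auto
      also have "\<dots> \<le> ennreal (1 + (0 - (-T))) * V_norm V {-T..0} y0"
        using T by (intro V_norm_dominates_L1[OF V] borel_measurable_lebesgue_on_borel) auto
      also have "\<dots> = ennreal ((1 + T) * W)" using T W by (simp add: y0V ennreal_mult)
      finally show ?thesis using T W by (simp add: ennreal_le_iff)
    qed
    have x_bound: "norm (x s) \<le> C1 * exp (- \<nu> * s) * J" if s: "s \<ge> 0" for s
    proof -
      let ?f = "\<lambda>s. - (indicator {0..T} s *\<^sub>R conv y0 s)"
      have fi: "integrable lborel ?f"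
        using integrable_mult_indicator[OF _ conv_integrable(2)[OF y0i], of "{0..T}"] by auto
      have "norm (x s) \<le> C * exp (- \<nu> * s) * (norm x0 + (LINT s|lborel. norm (?f s)))"
        by (rule C(2)[OF fi _ x _ _ s]) (use x_neg volt in auto)
      also have "\<dots> \<le> C * exp (- \<nu> * s) * ((1 + mass * (1 + T)) * J)"
      proof (rule mult_left_mono)
        have "(LINT s|lborel. norm (?f s)) \<le> (LINT s|lborel. norm (conv y0 s))"
          by (intro integral_mono integrable_norm fi conv_integrable(2)[OF y0i]) (auto simp: indicator_def)
        also have "\<dots> \<le> mass * (LINT s|lborel. norm (y0 s))" by (rule conv_integrable(3)[OF y0i])
        also have "\<dots> \<le> mass * ((1 + T) * J)"
          using J T by (intro mult_left_mono mass_nonneg order_trans[OF y0L1 mult_left_mono]) auto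
        finally show "norm x0 + (LINT s|lborel. norm (?f s)) \<le> (1 + mass * (1 + T)) * J"
          using J(3) by (simp add: algebra_simps)
      qed (use C(1) in simp)
      finally show ?thesis by (simp add: C1_def mult_ac)
    qed
    \<comment> \<open>any bound at a time at most \<open>h\<close> before \<open>t\<close> loses the factor \<open>exp (\<nu> h)\<close> only (\<open>shift\<close>); the history is seen before time \<open>h\<close> only, where \<open>exp (- \<nu> t)\<close> is not small (\<open>early\<close>)\<close>
    define E where "E = exp (- \<nu> * t) * J"
    have E: "E \<ge> 0" using J by (simp add: E_def)
    have shift: "C1 * exp (- \<nu> * s) * J \<le> C1 * exp (\<nu> * h) * E" if "t - h \<le> s" for s h
    proof -
      have "\<nu> * (t - h) \<le> \<nu> * s" using that nu by (rule mult_left_mono)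
      then have "exp (- \<nu> * s) \<le> exp (\<nu> * h) * exp (- \<nu> * t)"
        by (simp add: algebra_simps flip: exp_add)
      then have "C1 * exp (- \<nu> * s) * J \<le> C1 * (exp (\<nu> * h) * exp (- \<nu> * t)) * J"
        using C1 J by (intro mult_right_mono mult_left_mono) auto
      then show ?thesis by (simp add: E_def mult_ac)
    qed
    have early: "1 \<le> exp (\<nu> * h) * exp (- \<nu> * t)" if "t \<le> h" for h
    proof -
      have "\<nu> * t \<le> \<nu> * h" using that nu by (rule mult_left_mono)
      then show ?thesis by (simp flip: exp_add)
    qed
    have tv: "total_variation {max (t - T) 0..t} u \<le> ennreal (C2 * E)"
    proof -
      let ?a = "max (t - T) 0"
      let ?v = "\<lambda>r. LINT s:{?a..r}|lborel. norm (conv u s)"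
      have at: "?a \<le> t" using t T by auto
      have si: "set_integrable lborel {a..b} (conv u)" for a b
        unfolding u_def by (rule conv_local(2)[OF ui])
      have sin: "set_integrable lborel {a..b} (\<lambda>s. norm (conv u s))" for a b
        using set_integrable_norm[OF si] .
      have "total_variation {?a..t} u \<le> ennreal (?v t - ?v ?a)"
      proof (rule total_variation_le[OF _ at])
        fix a b assume ab: "?a \<le> a" "a \<le> b" "b \<le> t"
        have "u b - u a = X b - X a" using ab by (simp add: u_def y0_out xX)
        also have "\<dots> = - (LINT s:{a..b}|lborel. conv u s)" unfolding u_def by (rule ftc) (use ab in auto)
        finally have "norm (u b - u a) \<le> (LINT s:{a..b}|lborel. norm (conv u s))"
          using set_integral_norm_bound[OF si] by simp
        also have "\<dots> = ?v b - ?v a"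
        proof -
          have "?v b = (LINT s:{?a..a} \<union> {a..b}|lborel. norm (conv u s))" using ab by (simp add: ivl_disj_un_two_touch)
          also have "\<dots> = ?v a + (LINT s:{a..b}|lborel. norm (conv u s))"
          proof (rule set_integral_Un_AE)
            show "AE s in lborel. \<not> (s \<in> {?a..a} \<and> s \<in> {a..b})"
              using AE_lborel_singleton[of a] by eventually_elim auto
          qed (use sin in auto)
          finally show ?thesis by simp
        qed
        finally show "norm (u b - u a) \<le> ?v b - ?v a" .
      qed
      also have "\<dots> \<le> ennreal (C2 * E)"
      proof (rule ennreal_leI)
        let ?e = "exp (\<nu> * (2 * T)) * exp (- \<nu> * t)"
        have "(LINT s:{?a - T..t}|lborel. norm (u s)) \<le> (LINT s|lborel. norm (y0 s) * ?e + indicator {t - 2 * T..t} s * (C1 * exp (\<nu> * (2 * T)) * E))"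
          unfolding set_lebesgue_integral_def
      proof (rule integral_mono)
        have eq: "(\<lambda>s. indicator {?a - T..t} s *\<^sub>R norm (u s)) = (\<lambda>s. norm (indicator {?a - T..} s *\<^sub>R (indicator {..t} s *\<^sub>R u s)))"
          by (auto simp: fun_eq_iff indicator_def)
        show "integrable lborel (\<lambda>s. indicator {?a - T..t} s *\<^sub>R norm (u s))"
        proof (rule back_subst[of "integrable lborel", OF _ eq[symmetric]])
          show "integrable lborel (\<lambda>s. norm (indicator {?a - T..} s *\<^sub>R (indicator {..t} s *\<^sub>R u s)))"
            unfolding u_def by (rule integrable_norm, rule integrable_mult_indicator[OF _ ui[of t]]) simp
        qed
        show "integrable lborel (\<lambda>s. norm (y0 s) * (exp (\<nu> * (2 * T)) * exp (- \<nu> * t)) + indicator {t - 2 * T..t} s * (C1 * exp (\<nu> * (2 * T)) * E))"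
          using y0i by (intro Bochner_Integration.integrable_add integrable_mult_left integrable_norm)
            (auto simp: integrable_indicator_iff emeasure_lborel_Icc_eq)
        fix s
        show "indicator {?a - T..t} s *\<^sub>R norm (u s) \<le> norm (y0 s) * (exp (\<nu> * (2 * T)) * exp (- \<nu> * t)) + indicator {t - 2 * T..t} s * (C1 * exp (\<nu> * (2 * T)) * E)"
        proof (cases "s \<in> {?a - T..t}")
          case True
          then have s: "s \<in> {t - 2 * T..t}" by auto
          show ?thesis
          proof (cases "s < 0")
            case neg: True
            then have "norm (u s) \<le> norm (y0 s) * (exp (\<nu> * (2 * T)) * exp (- \<nu> * t))"
              using early[of "2 * T"] s by (simp add: u_def x_neg mult_left_mono[of 1 _ "norm (y0 s)", simplified])
            then show ?thesis using True C1 E by (intro add_increasing2) (auto simp: indicator_def)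
          next
            case False
            then have "norm (u s) \<le> C1 * exp (\<nu> * (2 * T)) * E"
              using x_bound[of s] shift[of "2 * T" s] s by (simp add: u_def y0_out)
            then show ?thesis using True s by (intro add_increasing) auto
          qed
        next
          case False
          then show ?thesis using C1 E by (auto intro!: add_nonneg_nonneg mult_nonneg_nonneg)
        qed
      qed
        also have "\<dots> = (LINT s|lborel. norm (y0 s)) * ?e + 2 * T * (C1 * exp (\<nu> * (2 * T)) * E)"
          using y0i T by (subst Bochner_Integration.integral_add) auto
        also have "\<dots> \<le> (1 + T) * J * ?e + 2 * T * (C1 * exp (\<nu> * (2 * T)) * E)"
          using J T C1 E by (intro add_mono mult_right_mono order_trans[OF y0L1 mult_left_mono]) auto
        also have "\<dots> = exp (2 * \<nu> * T) * ((1 + T) + 2 * T * C1) * E"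
          by (simp add: E_def algebra_simps)
        finally have "mass * (LINT s:{?a - T..t}|lborel. norm (u s)) \<le> mass * (exp (2 * \<nu> * T) * ((1 + T) + 2 * T * C1) * E)"
          by (rule mult_left_mono[OF _ mass_nonneg])
        also have "\<dots> \<le> C2 * E"
          unfolding mult.assoc[symmetric] using C1 E by (intro mult_right_mono) (auto simp: C2_def mult.assoc)
        finally have "mass * (LINT s:{?a - T..t}|lborel. norm (u s)) \<le> C2 * E" .
        moreover have "?v t \<le> mass * (LINT s:{?a - T..t}|lborel. norm (u s))"
          unfolding u_def by (rule conv_local(3)[OF ui])
        moreover have "0 \<le> ?v ?a"
          unfolding set_lebesgue_integral_def by (simp add: integral_nonneg_AE)
        ultimately show "?v t - ?v ?a \<le> C2 * E" by linarith
      qed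
      finally show ?thesis .
    qed
    have Vu: "V_norm V {-T..0} (partial_trajectory u t) \<le> ennreal (3 + T) * ((if t < T then V_norm V {-T..0} y0 else 0) + ennreal (C2 * E))"
    proof (rule V_norm_partial_trajectory_le[OF V T t _ um y0m _ _ tv])
      show "0 \<le> C2 * E" using C2 E by simp
      show "u s = y0 s" if "s < 0" for s using that by (simp add: u_def x_neg)
      show "norm (u s) \<le> C2 * E" if "0 \<le> s" "t - T \<le> s" "s \<le> t" for s
      proof -
        have "norm (u s) \<le> C1 * exp (\<nu> * T) * E"
          using x_bound[of s] shift[of T s] that by (simp add: u_def y0_out)
        also have "\<dots> \<le> C2 * E"
          using E C1 T mass_nonneg by (intro mult_right_mono) (auto simp: C2_def)
        finally show ?thesis .
      qed
    qed
    also have "\<dots> \<le> ennreal (3 + T) * (ennreal (exp (\<nu> * T) * E) + ennreal (C2 * E))"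
    proof (intro mult_left_mono add_mono order_refl)
      have "W \<le> exp (\<nu> * T) * E" if "t < T"
      proof -
        have "1 * J \<le> exp (\<nu> * T) * exp (- \<nu> * t) * J" using early[of T] that J by (intro mult_right_mono) auto
        then show ?thesis using J by (simp add: E_def mult_ac)
      qed
      then show "(if t < T then V_norm V {-T..0} y0 else 0) \<le> ennreal (exp (\<nu> * T) * E)"
        by (auto simp: y0V intro: ennreal_leI)
    qed simp
    also have "\<dots> = ennreal ((3 + T) * (exp (\<nu> * T) + C2) * E)"
      using T E C2 by (simp add: distrib_left distrib_right flip: ennreal_mult ennreal_plus)
    finally have Vu: "V_norm V {-T..0} (partial_trajectory u t) \<le> ennreal ((3 + T) * (exp (\<nu> * T) + C2) * E)" .
    have "V_norm V {-T..0} (partial_trajectory X t) = V_norm V {-T..0} (partial_trajectory u t)"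
    proof -
      have ae: "AE s in lborel. s \<in> {-T..0} \<longrightarrow> partial_trajectory X t s = partial_trajectory u t s"
        using AE_lborel_shift[OF X_u, of 1 t] t by (auto simp: partial_trajectory_def u_def elim!: eventually_mono)
      have m: "partial_trajectory u t \<in> borel_measurable borel" unfolding partial_trajectory_def by measurable
      show ?thesis
        by (rule V_norm_cong_AE)
           (auto intro!: borel_measurable_lebesgue_on_borel m measurable_lebesgue_on_AE[OF m _ ae] simp: AE_lebesgue_on_iff ae[simplified])
    qed
    with Vu have "V_norm V {-T..0} (partial_trajectory X t) + ennreal (norm (X t)) \<le> ennreal ((3 + T) * (exp (\<nu> * T) + C2) * E) + ennreal (C1 * E)"
      using x_bound[OF t] xX[OF t] by (intro add_mono ennreal_leI) (auto simp: E_def mult.assoc)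
    also have "\<dots> = ennreal (((3 + T) * (exp (\<nu> * T) + C2) + C1) * E)"
      using T E C2 C1 by (simp add: distrib_right flip: ennreal_plus)
    also have "\<dots> \<le> ennreal (C3 * E)" using E by (intro ennreal_leI mult_right_mono) (auto simp: C3_def)
    also have "\<dots> = ennreal (C3 * exp (- \<nu> * t)) * (V_norm V {-T..0} X0 + ennreal (norm x0))"
      using C3 W by (simp add: E_def J_def mult.assoc flip: ennreal_mult ennreal_plus)
    finally show "V_norm V {-T..0} (partial_trajectory X t) + ennreal (norm (X t))
       \<le> ennreal (C3 * exp (- \<nu> * t)) * (V_norm V {-T..0} X0 + ennreal (norm x0))" .
  qed
  then show ?thesis using C3 by blast
qed

end

section \<open>Exponential solutions and the characterization\<close>

definition cre :: "complex^'n \<Rightarrow> real^'n" where "cre x = (\<chi> i. Re (x $ i))"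

lemma norm_cre_le: "norm (cre x) \<le> norm x"
  unfolding norm_vec_def by (intro L2_set_mono) (auto simp: cre_def abs_Re_le_cmod)

lemma bounded_linear_cre: "bounded_linear cre"
  by (rule bounded_linear_intro[where K=1]) (simp_all add: norm_cre_le, simp_all add: cre_def vec_eq_iff)

text \<open>
  The two terms are the real and the imaginary part of \<open>x\<close>.
\<close>

lemma norm_le_cre: "norm x \<le> norm (cre x) + norm (cre ((- \<i>) *s x))"
proof -
  have "x = cvec (cre x) + \<i> *s cvec (cre ((- \<i>) *s x))"
    by (simp add: vec_eq_iff cvec_def cre_def complex_eq_iff)
  then have "norm x \<le> norm (cvec (cre x)) + norm (\<i> *s cvec (cre ((- \<i>) *s x)))"
    using norm_triangle_ineq by metis
  then show ?thesis by (simp add: norm_vector_scalar_mult)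
qed

lemma real_matrix_mult_cre: "A *v cre x = cre (map_matrix of_real A *v x)"
  by (simp add: vec_eq_iff cre_def matrix_vector_mult_def)

lemma norm_map_matrix_scale: "norm (map_matrix (\<lambda>a. of_real a * w) A) = norm A * norm (w :: complex)"
  by (simp add: norm_vec_def norm_mult map_matrix_def flip: L2_set_left_distrib)

text \<open>
  The real part of \<open>exp (z t) v\<close>; the imaginary part is obtained by replacing \<open>v\<close> with \<open>- i v\<close>.
\<close>

definition exp_mode :: "complex \<Rightarrow> complex^'n \<Rightarrow> real \<Rightarrow> real^'n" where
  "exp_mode z v t = cre (exp (z * of_real t) *s v)"

lemma norm_exp_mode_le: "norm (exp_mode z v t) \<le> exp (Re z * t) * norm v"
  unfolding exp_mode_def by (rule order_trans[OF norm_cre_le]) (simp add: norm_vector_scalar_mult)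

lemma exp_mode_derivative: "(exp_mode z v has_vector_derivative exp_mode z (z *s v) t) (at t within S)"
proof -
  have bl: "bounded_linear (\<lambda>c. cre (c *s v))"
    by (rule bounded_linear_compose[OF bounded_linear_cre bounded_bilinear.bounded_linear_left[OF bounded_bilinear_vector_scalar_mult]])
  have "((\<lambda>t. exp (z * of_real t)) has_vector_derivative (exp (z * of_real t) * z)) (at t within S)"
    by (rule has_vector_derivative_real_field) (auto intro!: derivative_eq_intros)
  from bounded_linear.has_vector_derivative[OF bl this]
  show ?thesis by (simp add: exp_mode_def[abs_def])
qed

lemma exp_mode_continuous: "continuous_on S (exp_mode z v)"
  using exp_mode_derivative by (intro continuous_on_vector_derivative) blast

lemma exp_mode_lipschitz:
  assumes "a \<le> s" "s \<le> t" "t \<le> b"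
  shows "norm (exp_mode z v t - exp_mode z v s) \<le> exp (\<bar>Re z\<bar> * max \<bar>a\<bar> \<bar>b\<bar>) * norm (z *s v) * (t - s)"
proof -
  have "(exp_mode z (z *s v) has_integral (exp_mode z v t - exp_mode z v s)) {s..t}"
    using assms by (intro fundamental_theorem_of_calculus exp_mode_derivative)
  moreover have "norm (exp_mode z (z *s v) x) \<le> exp (\<bar>Re z\<bar> * max \<bar>a\<bar> \<bar>b\<bar>) * norm (z *s v)" if "x \<in> {s..t}" for x
  proof -
    have "Re z * x \<le> \<bar>Re z\<bar> * \<bar>x\<bar>" by (metis abs_ge_self abs_mult)
    also have "\<dots> \<le> \<bar>Re z\<bar> * max \<bar>a\<bar> \<bar>b\<bar>" using that assms by (intro mult_left_mono) auto
    finally show ?thesis by (intro order_trans[OF norm_exp_mode_le mult_right_mono]) auto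
  qed
  ultimately show ?thesis
    using has_integral_bound_real[of "exp (\<bar>Re z\<bar> * max \<bar>a\<bar> \<bar>b\<bar>) * norm (z *s v)" "{}" "exp_mode z (z *s v)" _ s t] assms by auto
qed

lemma exp_mode_in_V_space:
  assumes "V = BV \<or> (\<exists>p\<ge>1. V = Lp p)" "a \<le> b"
  shows "exp_mode z v \<in> V_space V {a..b}"
  using assms exp_mode_lipschitz by (rule lipschitz_in_V_space[OF _ _ exp_mode_continuous])

lemma det_eq_0_kernel:
  fixes P :: "complex^'n^'n"
  assumes "det P = 0"
  obtains v where "v \<noteq> 0" "P *v v = 0"
proof -
  have "\<not> invertible P" using assms by (simp add: invertible_det_nz)
  then have "\<not> (\<exists>B. B ** P = mat 1)" unfolding invertible_def using matrix_left_right_inverse by blast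
  then show ?thesis using that matrix_left_invertible_ker by blast
qed

context delay_equation begin

text \<open>
  All terms of the equation are images of the corresponding terms of the characteristic matrix under the bounded
  linear map \<open>M \<mapsto> Re (M exp (z t) v)\<close>, and the characteristic matrix itself is mapped to \<open>0\<close>.
\<close>

lemma exp_mode_dde_at:
  assumes Nint: "set_integrable lebesgue {0<..<T} N" and ker: "char_matrix T A \<tau> N z *v v = 0"
  shows "dde_at T A \<tau> N (exp_mode z v) t"
proof -
  define L where "L M = cre (M *v (exp (z * of_real t) *s v))" for M :: "complex^'n^'n"
  have bl: "bounded_linear L"
    unfolding L_def
    by (rule bounded_linear_compose[OF bounded_linear_cre bounded_bilinear.bounded_linear_left[OF bounded_bilinear_matrix_vector_mult]])
  let ?F = "\<lambda>s M. map_matrix (\<lambda>a. complex_of_real a * exp (- of_real s * z)) M"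
  have L_F: "M *v exp_mode z v (t - s) = L (?F s M)" for M :: "real^'n^'n" and s
  proof -
    have "exp (- of_real s * z) * exp (z * of_real t) = exp (z * of_real (t - s))"
      by (simp add: algebra_simps flip: exp_add)
    then have "map_matrix of_real M *v (exp (z * of_real (t - s)) *s v) = ?F s M *v (exp (z * of_real t) *s v)"
      by (simp add: vec_eq_iff matrix_vector_mult_def mult_ac)
    then show ?thesis by (simp add: exp_mode_def L_def real_matrix_mult_cre)
  qed
  have nF: "norm (?F s M) \<le> exp (\<bar>Re z\<bar> * T) * norm M" if "0 \<le> s" "s \<le> T" for s M
  proof -
    have "- s * Re z \<le> \<bar>Re z\<bar> * T"
      using that by (intro order_trans[OF _ mult_left_mono[of s T "\<bar>Re z\<bar>"]]) (auto simp: abs_if mult.commute mult_less_0_iff not_less)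
    then show ?thesis unfolding norm_map_matrix_scale by (auto simp: mult.commute intro!: mult_left_mono)
  qed
  have sumF: "summable (\<lambda>k. ?F (\<tau> k) (A k))"
  proof (rule summable_comparison_test'[where N=0])
    show "summable (\<lambda>k. exp (\<bar>Re z\<bar> * T) * norm (A k))" using A by (rule summable_mult)
    show "norm (?F (\<tau> k) (A k)) \<le> exp (\<bar>Re z\<bar> * T) * norm (A k)" for k
      by (rule nF[OF less_imp_le[OF \<tau>(1)] \<tau>(2)])
  qed
  have intF: "integrable lebesgue (\<lambda>s. indicator {0<..<T} s *\<^sub>R ?F s (N s))"
  proof (rule Bochner_Integration.integrable_bound)
    show "integrable lebesgue (\<lambda>s. exp (\<bar>Re z\<bar> * T) * norm (indicator {0<..<T} s *\<^sub>R N s))"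
      using Nint unfolding set_integrable_def by (intro integrable_mult_right integrable_norm)
    have eq: "indicator {0<..<T} s *\<^sub>R ?F s (N s) = ?F s (indicator {0<..<T} s *\<^sub>R N s)" for s
      by (auto simp: indicator_def vec_eq_iff)
    show "(\<lambda>s. indicator {0<..<T} s *\<^sub>R ?F s (N s)) \<in> borel_measurable lebesgue"
      unfolding eq unfolding map_matrix_def
    proof (rule borel_measurable_continuous_Pair[where H="\<lambda>x A. \<chi> i j. of_real (A $ i $ j) * exp (- of_real x * z)"])
      show "(\<lambda>s::real. s) \<in> borel_measurable lebesgue" by (rule measurable_completion) simp
      show "(\<lambda>s. indicator {0<..<T} s *\<^sub>R N s) \<in> borel_measurable lebesgue"
        using Nint by (auto simp: set_integrable_def)
    qed (auto intro!: continuous_intros continuous_on_vec_lambda)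
    show "AE s in lebesgue. norm (indicator {0<..<T} s *\<^sub>R ?F s (N s)) \<le> norm (exp (\<bar>Re z\<bar> * T) * norm (indicator {0<..<T} s *\<^sub>R N s))"
    proof (rule AE_I2)
      fix s
      show "norm (indicator {0<..<T} s *\<^sub>R ?F s (N s)) \<le> norm (exp (\<bar>Re z\<bar> * T) * norm (indicator {0<..<T} s *\<^sub>R N s))"
      proof (cases "s \<in> {0<..<T}")
        case True
        then show ?thesis using nF[of s "N s"] by simp
      qed simp
    qed
  qed
  have L_ind: "indicator {0<..<T} s *\<^sub>R L M = L (indicator {0<..<T} s *\<^sub>R M)" for s M
    by (simp add: linear_scale[OF bounded_linear.linear[OF bl]])
  have der: "vector_derivative (exp_mode z v) (at t) = L (mat z)"
  proof -
    have "vector_derivative (exp_mode z v) (at t) = exp_mode z (z *s v) t"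
      by (rule vector_derivative_at[OF exp_mode_derivative])
    then show ?thesis by (simp add: L_def exp_mode_def mat_vector_mult mult.commute)
  qed
  have "L (mat z) + (\<Sum>k. L (?F (\<tau> k) (A k))) + (LINT s|lebesgue. L (indicator {0<..<T} s *\<^sub>R ?F s (N s))) = L (char_matrix T A \<tau> N z)"
    unfolding char_matrix_def bounded_linear.suminf[OF bl sumF] integral_bounded_linear[OF bl intF]
      linear_add[OF bounded_linear.linear[OF bl]] set_lebesgue_integral_def ..
  also have "\<dots> = 0"
  proof -
    have "char_matrix T A \<tau> N z *v (exp (z * of_real t) *s v) = exp (z * of_real t) *s (char_matrix T A \<tau> N z *v v)"
      by (simp add: vec_eq_iff matrix_vector_mult_def sum_distrib_left mult_ac)
    then show ?thesis by (simp add: L_def ker cre_def vec_eq_iff)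
  qed
  finally show ?thesis
    unfolding dde_at_def L_F der set_integrable_def set_lebesgue_integral_def L_ind
    by (intro conjI differentiableI_vector[OF exp_mode_derivative] bounded_linear.summable[OF bl sumF] integrable_bounded_linear[OF bl intF])
qed

lemma exp_mode_solution:
  assumes V: "V = BV \<or> (\<exists>p\<ge>1. V = Lp p)"
    and Nint: "set_integrable lebesgue {0<..<T} N" and ker: "char_matrix T A \<tau> N z *v v = 0"
  shows "dde_solution V T A \<tau> N (exp_mode z v) (exp_mode z v 0) (exp_mode z v)"
  unfolding dde_solution_def
proof (intro conjI allI impI)
  fix a b :: real assume "0 \<le> a" "a \<le> b"
  show "absolutely_continuous_on {a..b} (exp_mode z v)"
  proof (rule lipschitz_imp_absolutely_continuous_on)
    fix s t assume "s \<in> {a..b}" "t \<in> {a..b}"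
    then show "norm (exp_mode z v t - exp_mode z v s) \<le> exp (\<bar>Re z\<bar> * max \<bar>a\<bar> \<bar>b\<bar>) * norm (z *s v) * \<bar>t - s\<bar>"
      using exp_mode_lipschitz[of a s t b z v] exp_mode_lipschitz[of a t s b z v]
      by (cases "s \<le> t") (auto simp: norm_minus_commute)
  qed
next
  have "(\<lambda>t. vector_derivative (exp_mode z v) (at t)) = exp_mode z (z *s v)"
    using vector_derivative_at[OF exp_mode_derivative] by blast
  then show "(\<lambda>t. vector_derivative (exp_mode z v) (at t)) \<in> V_loc V"
    by (auto simp: V_loc_def intro!: exp_mode_in_V_space[OF V])
next
  show "AE t in lebesgue_on {0<..}. dde_at T A \<tau> N (exp_mode z v) t"
    using exp_mode_dde_at[OF Nint ker] by simp
qed auto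

text \<open>
  Applying the decay estimate to the exponential solutions for \<open>v\<close> and \<open>- i v\<close> shows that \<open>exp (t (Re z + \<nu>)) \<bar>v\<bar>\<close> stays
  bounded for \<open>t \<ge> 0\<close>.
\<close>

lemma root_of_decay:
  assumes V: "V = BV \<or> (\<exists>p\<ge>1. V = Lp p)"
    and Nint: "set_integrable lebesgue {0<..<T} N" and root: "det (char_matrix T A \<tau> N z) = 0"
    and decay: "exp_decay V T A \<tau> N \<nu> C" and C: "C \<ge> 1"
  shows "Re z \<le> - \<nu>"
proof (rule ccontr)
  assume neg: "\<not> Re z \<le> - \<nu>"
  obtain v where v: "v \<noteq> 0" "char_matrix T A \<tau> N z *v v = 0" using det_eq_0_kernel[OF root] .
  have bound: "\<exists>K\<ge>0. \<forall>t\<ge>0. norm (exp_mode z w t) \<le> K * exp (- \<nu> * t)" if w: "char_matrix T A \<tau> N z *v w = 0" for w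
  proof -
    let ?D = "V_norm V {-T..0} (exp_mode z w) + ennreal (norm (exp_mode z w 0))"
    have mem: "exp_mode z w \<in> V_space V {-T..0}" using T by (intro exp_mode_in_V_space[OF V]) auto
    then have fin: "?D < \<infinity>" by (simp add: V_space_def)
    have "norm (exp_mode z w t) \<le> C * enn2real ?D * exp (- \<nu> * t)" if t: "t \<ge> 0" for t
    proof -
      have "ennreal (norm (exp_mode z w t)) \<le> V_norm V {-T..0} (partial_trajectory (exp_mode z w) t) + ennreal (norm (exp_mode z w t))"
        by simp
      also have "\<dots> \<le> ennreal (C * exp (- \<nu> * t)) * ?D"
        using decay mem exp_mode_solution[OF V Nint w] t unfolding exp_decay_def by blast
      also have "\<dots> = ennreal (C * exp (- \<nu> * t)) * ennreal (enn2real ?D)" using fin by simp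
      also have "\<dots> = ennreal (C * exp (- \<nu> * t) * enn2real ?D)" by (rule ennreal_mult[symmetric]) (use C in auto)
      finally show ?thesis using C by (simp add: ennreal_le_iff mult_ac)
    qed
    then show ?thesis using C by (intro exI[of _ "C * enn2real ?D"]) auto
  qed
  have "char_matrix T A \<tau> N z *v ((- \<i>) *s v) = (- \<i>) *s (char_matrix T A \<tau> N z *v v)"
    by (simp add: vec_eq_iff matrix_vector_mult_def sum_distrib_left sum_negf[symmetric] mult_ac)
  then have v': "char_matrix T A \<tau> N z *v ((- \<i>) *s v) = 0" using v by (simp add: vec_eq_iff)
  obtain K1 where K1: "K1 \<ge> 0" "\<And>t. t \<ge> 0 \<Longrightarrow> norm (exp_mode z v t) \<le> K1 * exp (- \<nu> * t)"
    using bound[OF v(2)] by blast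
  obtain K2 where K2: "K2 \<ge> 0" "\<And>t. t \<ge> 0 \<Longrightarrow> norm (exp_mode z ((- \<i>) *s v) t) \<le> K2 * exp (- \<nu> * t)"
    using bound[OF v'] by blast
  have le: "((Re z + \<nu>) * t) * norm v \<le> K1 + K2" if t: "t \<ge> 0" for t
  proof -
    have "exp (Re z * t) * norm v = norm (exp (z * of_real t) *s v)" by (simp add: norm_vector_scalar_mult)
    also have "\<dots> \<le> norm (exp_mode z v t) + norm (exp_mode z ((- \<i>) *s v) t)"
      using norm_le_cre[of "exp (z * of_real t) *s v"] by (simp add: exp_mode_def mult.commute)
    also have "\<dots> \<le> (K1 + K2) * exp (- \<nu> * t)" using K1(2)[OF t] K2(2)[OF t] by (simp add: distrib_right)
    finally have "exp (\<nu> * t) * (exp (Re z * t) * norm v) \<le> exp (\<nu> * t) * ((K1 + K2) * exp (- \<nu> * t))"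
      by (rule mult_left_mono) simp
    then have "exp ((Re z + \<nu>) * t) * norm v \<le> K1 + K2"
    proof -
      have "exp (\<nu> * t) * (exp (Re z * t) * norm v) = exp ((Re z + \<nu>) * t) * norm v"
        by (simp add: algebra_simps exp_add)
      moreover have "exp (\<nu> * t) * ((K1 + K2) * exp (- \<nu> * t)) = K1 + K2" by (simp add: exp_minus)
      ultimately show ?thesis using \<open>exp (\<nu> * t) * (exp (Re z * t) * norm v) \<le> exp (\<nu> * t) * ((K1 + K2) * exp (- \<nu> * t))\<close>
        by (simp only:)
    qed
    moreover have "(Re z + \<nu>) * t \<le> exp ((Re z + \<nu>) * t)" using exp_ge_add_one_self[of "(Re z + \<nu>) * t"] by linarith
    ultimately show ?thesis using mult_right_mono[of "(Re z + \<nu>) * t" "exp ((Re z + \<nu>) * t)" "norm v"] by simp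
  qed
  let ?c = "(Re z + \<nu>) * norm v"
  have c: "?c > 0" using neg v by simp
  show False using le[of "(K1 + K2 + 1) / ?c"] c K1(1) K2(1) neg v(1) by (simp add: field_simps)
qed

end

theorem theorem10:
  fixes V :: fspace and T :: real
    and A :: "nat \<Rightarrow> real^'n^'n" and \<tau> :: "nat \<Rightarrow> real" and N :: "real \<Rightarrow> real^'n^'n"
  assumes "V = BV \<or> (\<exists>p\<ge>1. V = Lp p)"
    and "T > 0"
    and "summable (\<lambda>k. norm (A k))"
    and "strict_mono \<tau>" and "\<And>k. 0 < \<tau> k \<and> \<tau> k \<le> T"
    and "set_integrable lebesgue {0<..<T} N"
  shows "(exponentially_stable V T A \<tau> N \<longleftrightarrow>
            (\<exists>\<nu>0>0. \<forall>z. det (char_matrix T A \<tau> N z) = 0 \<longrightarrow> Re z < - \<nu>0))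
       \<and> (\<forall>\<nu>0>0. (\<forall>z. det (char_matrix T A \<tau> N z) = 0 \<longrightarrow> Re z < - \<nu>0)
            \<longrightarrow> (\<exists>C\<ge>1. exp_decay V T A \<tau> N \<nu>0 C))"
proof -
  have Nint: "integrable lebesgue (\<lambda>s. indicator {0<..<T} s *\<^sub>R N s)"
    using assms(6) by (simp add: set_integrable_def)
  then obtain Nb where Nb: "Nb \<in> borel_measurable borel" "AE s in lborel. indicator {0<..<T} s *\<^sub>R N s = Nb s"
    using ex_borel_version borel_measurable_integrable by blast
  have "integrable lebesgue Nb"
    using Nint Nb
    by (subst integrable_cong_AE[where g="\<lambda>s. indicator {0<..<T} s *\<^sub>R N s"])
       (auto simp: AE_completion_iff eq_commute measurable_completion)
  then have "integrable lborel Nb" using Nb(1) by (simp add: integrable_completion)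
  then have Nb2: "integrable lborel (\<lambda>s. indicator {0<..<T} s *\<^sub>R Nb s)"
    by (intro integrable_mult_indicator) auto
  have Nb3: "AE s in lborel. s \<in> {0<..<T} \<longrightarrow> N s = Nb s"
    using Nb(2) by eventually_elim (auto simp: indicator_def)
  interpret delay_equation T A \<tau> N Nb
    by standard (use assms Nb(1) Nb2 Nb3 in auto)
  have decay: "\<exists>C\<ge>1. exp_decay V T A \<tau> N \<nu> C"
    if "\<nu> > 0" "\<forall>z. det (char_matrix T A \<tau> N z) = 0 \<longrightarrow> Re z < - \<nu>" for \<nu>
    using decay_of_roots[OF assms(1), of \<nu>] that by auto
  have "\<exists>\<nu>0>0. \<forall>z. det (char_matrix T A \<tau> N z) = 0 \<longrightarrow> Re z < - \<nu>0"
    if st: "exponentially_stable V T A \<tau> N"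
  proof -
    obtain \<nu> C where "\<nu> > 0" "C \<ge> 1" "exp_decay V T A \<tau> N \<nu> C"
      using st by (auto simp: exponentially_stable_def)
    then have "Re z < - (\<nu> / 2)" if "det (char_matrix T A \<tau> N z) = 0" for z
      using root_of_decay[OF assms(1,6) that, of \<nu> C] by linarith
    then show ?thesis using \<open>\<nu> > 0\<close> by (intro exI[of _ "\<nu> / 2"]) auto
  qed
  then show ?thesis using decay unfolding exponentially_stable_def by blast
qed

end
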